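(* Let $p$ be a prime, $0\le s<n$, let $A=(a_{ij})_{0\le i\le s,\ s+1\le j\le n}$ be an $(s+1)\times(n-s)$ matrix over $\mathbb{Q}_p$, and let $\mathcal{L}\subset\mathbb{Q}_p^n$ be the $s$-dimensional affine subspace parametrized by $R_A=(I_{s+1}\ \ A)$, i.e. $$\mathcal{L}=\{\mathbf{y}\in\mathbb{Q}_p^n : (1,\mathbf{y})=(1,\mathbf{x})R_A \text{ for some }\mathbf{x}\in\mathbb{Q}_p^s\}.$$ If all the rows of $A$ are rational multiples of one row of $A$, or all the columns of $A$ are rational multiples of one column of $A$, then $$w_p(\mathcal{L})=\max(n,w_p(A))\quad\text{and}\quad w(\mathcal{L})=\max(n+1,w(A)).$$
   Context: $\|\cdot\|_\infty$ and $\|\cdot\|_p$ denote the maxima of the real, respectively $p$-adic, absolute values of the coordinates. Exponents of vectors. For $\mathbf{y}\in\mathbb{Q}_p^n$, $w(\mathbf{y})$ is the supremum of $v>0$ such that there are infinitely many $\tilde{\mathbf{q}}=(q_0,\mathbf{q})\in\mathbb{Z}\times\mathbb{Z}^{n}$ with $|q_0+\mathbf{q}\cdot\mathbf{y}|_p\le\|\tilde{\mathbf{q}}\|_\infty^{-v}$; and $w_p(\mathbf{y})$ is the supremum of those $v$ for which there exist $\tilde{\mathbf{q}}=(q_0,\mathbf{q})\in\mathbb{Z}[1/p]\times\mathbb{Z}[1/p]^{n}$ with arbitrarily large $\|\mathbf{q}\|_p\|\tilde{\mathbf{q}}\|_\infty$ such that $|\mathbf{q}\cdot\mathbf{y}+q_0|_p<(\|\mathbf{q}\|_p\|\tilde{\mathbf{q}}\|_\infty)^{-v}\|\tilde{\mathbf{q}}\|_\infty^{-1}$.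 Exponents of $\mathcal{L}$. Let $\mu$ be the pushforward of Haar measure on $\mathbb{Q}_p^s$ under an affine isomorphism $\mathbb{Q}_p^s\to\mathcal{L}$. Then $w(\mathcal{L})=\sup\{v:\mu(\{\mathbf{y}:w(\mathbf{y})>v\})>0\}$ and $w_p(\mathcal{L})=\sup\{v:\mu(\{\mathbf{y}:w_p(\mathbf{y})>v\})>0\}$. Exponents of a matrix. For an $m\times k$ matrix $A$ over $\mathbb{Q}_p$, $w_p(A)$ is the supremum of those $v$ for which there exist $\tilde{\mathbf{q}}=(\mathbf{q}_0,\mathbf{q})\in\mathbb{Z}[1/p]^m\times\mathbb{Z}[1/p]^k$ with arbitrarily large $\|\mathbf{q}\|_p\|\tilde{\mathbf{q}}\|_\infty$ such that $\|A\mathbf{q}+\mathbf{q}_0\|_p\le(\|\mathbf{q}\|_p\|\tilde{\mathbf{q}}\|_\infty)^{-v}\|\tilde{\mathbf{q}}\|_\infty^{-1}$; and $w(A)$ is the supremum of those $v$ for which there exist infinitely many $\tilde{\mathbf{q}}=(\mathbf{q}_0,\mathbf{q})\in\mathbb{Z}^{m}\times\mathbb{Z}^k$ with $\|A\mathbf{q}+\mathbf{q}_0\|_p\le\|\tilde{\mathbf{q}}\|_\infty^{-v}$. *)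

theory Defs
  imports "HOL-Analysis.Analysis" "Berlekamp_Zassenhaus.Finite_Field"
begin

section \<open>The field of p-adic numbers\<close>

definition padic_abs :: "nat \<Rightarrow> rat \<Rightarrow> real" where
  "padic_abs p x =
     (if x = 0 then 0
      else real p powi (int (multiplicity (int p) (snd (quotient_of x)))
                        - int (multiplicity (int p) (fst (quotient_of x)))))"

context
  fixes p :: nat
  assumes prime_p: "prime p"
begin

lemma p_gt_1: "real p > 1"
  using prime_gt_1_nat[OF prime_p] by simp

lemma prime_elem_p: "prime_elem (int p)"
  using prime_p by simp

lemma padic_abs_frac:
  assumes "a \<noteq> 0" "b \<noteq> 0"
  shows "padic_abs p (of_int a / of_int b) =
           real p powi (int (multiplicity (int p) b) - int (multiplicity (int p) a))"
proof -
  obtain c d where cd: "quotient_of (of_int a / of_int b) = (c, d)"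
    by fastforce
  have d: "d > 0"
    using cd quotient_of_denom_pos by blast
  have eq: "(of_int a / of_int b :: rat) = of_int c / of_int d"
    using cd quotient_of_div by blast
  then have c: "c \<noteq> 0"
    using assms d by auto
  have "(of_int (a * d) :: rat) = of_int (c * b)"
    using eq assms d by (simp add: field_simps)
  then have "a * d = c * b"
    using of_int_eq_iff by blast
  then have "multiplicity (int p) (a * d) = multiplicity (int p) (c * b)"
    by simp
  then have "multiplicity (int p) a + multiplicity (int p) d
           = multiplicity (int p) c + multiplicity (int p) b"
    using assms c d by (simp add: prime_elem_multiplicity_mult_distrib[OF prime_elem_p])
  then have "int (multiplicity (int p) d) - int (multiplicity (int p) c)
           = int (multiplicity (int p) b) - int (multiplicity (int p) a)"
    by linarith
  then show ?thesis
    using assms cd by (simp add: padic_abs_def)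
qed

lemma padic_abs_0 [simp]: "padic_abs p 0 = 0"
  by (simp add: padic_abs_def)

lemma padic_abs_pos: "x \<noteq> 0 \<Longrightarrow> padic_abs p x > 0"
  using p_gt_1 by (simp add: padic_abs_def)

lemma padic_abs_nonneg [simp]: "padic_abs p x \<ge> 0"
  using padic_abs_pos[of x] by (cases "x = 0") auto

lemma padic_abs_eq_0_iff [simp]: "padic_abs p x = 0 \<longleftrightarrow> x = 0"
  using padic_abs_pos[of x] by (cases "x = 0") auto

lemma rat_common_denom:
  obtains a c b where "(x::rat) = of_int a / of_int b" "(y::rat) = of_int c / of_int b" "b \<noteq> 0"
proof -
  obtain a b where x: "quotient_of x = (a, b)" by fastforce
  obtain c d where y: "quotient_of y = (c, d)" by fastforce
  have "b > 0" "d > 0"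
    using x y quotient_of_denom_pos by blast+
  moreover have "x = of_int a / of_int b" "y = of_int c / of_int d"
    using x y quotient_of_div by blast+
  ultimately show ?thesis
    by (intro that[of "a * d" "b * d" "c * b"]) auto
qed

lemma padic_abs_mult: "padic_abs p (x * y) = padic_abs p x * padic_abs p y"
proof (cases "x = 0 \<or> y = 0")
  case False
  obtain a c b where xy: "x = of_int a / of_int b" "y = of_int c / of_int b" "b \<noteq> 0"
    by (rule rat_common_denom)
  with False have nz: "a \<noteq> 0" "c \<noteq> 0" by auto
  have "x * y = of_int (a * c) / of_int (b * b)"
    using xy by simp
  then have "padic_abs p (x * y) =
      real p powi (int (multiplicity (int p) (b * b)) - int (multiplicity (int p) (a * c)))"
    using padic_abs_frac[of "a * c" "b * b"] nz xy(3) by simp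
  also have "\<dots> = real p powi ((int (multiplicity (int p) b) - int (multiplicity (int p) a))
                 + (int (multiplicity (int p) b) - int (multiplicity (int p) c)))"
    using nz xy(3) by (simp add: prime_elem_multiplicity_mult_distrib[OF prime_elem_p] algebra_simps)
  also have "\<dots> = padic_abs p x * padic_abs p y"
    unfolding xy padic_abs_frac[OF nz(1) xy(3)] padic_abs_frac[OF nz(2) xy(3)]
    using p_gt_1 by (intro power_int_add) auto
  finally show ?thesis .
qed auto

lemma padic_abs_1 [simp]: "padic_abs p 1 = 1"
  using padic_abs_mult[of 1 1] padic_abs_pos[of 1] by simp

lemma padic_abs_minus [simp]: "padic_abs p (- x) = padic_abs p x"
proof -
  have "padic_abs p (-1) * padic_abs p (-1) = 1"
    using padic_abs_mult[of "-1" "-1"] by simp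
  then have "(padic_abs p (-1))\<^sup>2 = 1"
    by (simp add: power2_eq_square)
  then have "padic_abs p (-1) = 1"
    using padic_abs_nonneg[of "-1"] by (auto simp: power2_eq_1_iff)
  then show ?thesis
    using padic_abs_mult[of "-1" x] by simp
qed

lemma padic_abs_diff_commute: "padic_abs p (x - y) = padic_abs p (y - x)"
  using padic_abs_minus[of "x - y"] by simp

lemma padic_abs_inverse: "padic_abs p (inverse x) = inverse (padic_abs p x)"
proof (cases "x = 0")
  case False
  then have "padic_abs p x * padic_abs p (inverse x) = 1"
    using padic_abs_mult[of x "inverse x"] by simp
  then show ?thesis
    by (metis inverse_unique)
qed auto

lemma padic_abs_add_max: "padic_abs p (x + y) \<le> max (padic_abs p x) (padic_abs p y)"
proof (cases "x = 0 \<or> y = 0 \<or> x + y = 0")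
  case True
  then show ?thesis by (auto simp: le_max_iff_disj)
next
  case False
  obtain a c b where xy: "x = of_int a / of_int b" "y = of_int c / of_int b" "b \<noteq> 0"
    by (rule rat_common_denom)
  have s: "x + y = of_int (a + c) / of_int b"
    using xy by (simp add: add_divide_distrib)
  with False xy have nz: "a \<noteq> 0" "c \<noteq> 0" "a + c \<noteq> 0"
    by auto
  note fracs = padic_abs_frac[OF nz(3) xy(3), folded s]
    padic_abs_frac[OF nz(1) xy(3), folded xy(1)] padic_abs_frac[OF nz(2) xy(3), folded xy(2)]
  let ?m = "min (multiplicity (int p) a) (multiplicity (int p) c)"
  have "int p ^ ?m dvd a" "int p ^ ?m dvd c"
    by (simp_all add: multiplicity_dvd')
  then have "int p ^ ?m dvd a + c"
    by simp
  then have "?m \<le> multiplicity (int p) (a + c)"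
    using nz(3) prime_elem_p by (intro multiplicity_geI) (auto dest: prime_elem_not_unit)
  then have "multiplicity (int p) a \<le> multiplicity (int p) (a + c)
           \<or> multiplicity (int p) c \<le> multiplicity (int p) (a + c)"
    by linarith
  then show ?thesis
  proof
    assume "multiplicity (int p) a \<le> multiplicity (int p) (a + c)"
    then have "padic_abs p (x + y) \<le> padic_abs p x"
      unfolding fracs
      using p_gt_1 by (intro power_int_increasing) auto
    then show ?thesis by simp
  next
    assume "multiplicity (int p) c \<le> multiplicity (int p) (a + c)"
    then have "padic_abs p (x + y) \<le> padic_abs p y"
      unfolding fracs
      using p_gt_1 by (intro power_int_increasing) auto
    then show ?thesis by simp
  qed
qed

lemma padic_abs_triangle: "padic_abs p (x + y) \<le> padic_abs p x + padic_abs p y"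
  using padic_abs_add_max[of x y] padic_abs_nonneg[of x] padic_abs_nonneg[of y] by linarith

lemma padic_abs_triangle2: "\<bar>padic_abs p x - padic_abs p y\<bar> \<le> padic_abs p (x - y)"
  using padic_abs_triangle[of "x - y" y] padic_abs_triangle[of "y - x" x]
    padic_abs_diff_commute[of x y] by simp

end

definition padic_vanishes :: "nat \<Rightarrow> (nat \<Rightarrow> rat) \<Rightarrow> bool" where
  "padic_vanishes p X \<longleftrightarrow> (\<lambda>n. padic_abs p (X n)) \<longlonglongrightarrow> 0"

definition padic_cauchy :: "nat \<Rightarrow> (nat \<Rightarrow> rat) \<Rightarrow> bool" where
  "padic_cauchy p X \<longleftrightarrow> (\<forall>e>0. \<exists>N. \<forall>m\<ge>N. \<forall>n\<ge>N. padic_abs p (X m - X n) < e)"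

definition padic_rel :: "nat \<Rightarrow> (nat \<Rightarrow> rat) \<Rightarrow> (nat \<Rightarrow> rat) \<Rightarrow> bool" where
  "padic_rel p X Y \<longleftrightarrow> padic_cauchy p X \<and> padic_cauchy p Y \<and> padic_vanishes p (\<lambda>n. X n - Y n)"

context
  fixes p :: nat
  assumes prime_p: "prime p"
begin

private lemmas [simp] = padic_abs_0[OF prime_p] padic_abs_nonneg[OF prime_p]
  padic_abs_eq_0_iff[OF prime_p] padic_abs_1[OF prime_p] padic_abs_minus[OF prime_p]
private lemmas abs_mult = padic_abs_mult[OF prime_p]
private lemmas abs_add = padic_abs_triangle[OF prime_p]
private lemmas abs_add2 = padic_abs_triangle2[OF prime_p]
private lemmas abs_commute = padic_abs_diff_commute[OF prime_p]

lemma padic_vanishes_squeeze: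
  assumes "f \<longlonglongrightarrow> 0" "\<And>n. padic_abs p (X n) \<le> f n"
  shows "padic_vanishes p X"
  unfolding padic_vanishes_def
  by (rule tendsto_sandwich[of "\<lambda>_. 0" _ _ f]) (use assms in auto)

lemma padic_vanishes_const [simp]: "padic_vanishes p (\<lambda>_. c) \<longleftrightarrow> c = 0"
  by (simp add: padic_vanishes_def LIMSEQ_const_iff)

lemma padic_vanishes_add:
  assumes "padic_vanishes p X" "padic_vanishes p Y"
  shows "padic_vanishes p (\<lambda>n. X n + Y n)"
  using tendsto_add[OF assms[unfolded padic_vanishes_def]] abs_add
  by (intro padic_vanishes_squeeze) auto

lemma padic_vanishes_minus_iff [simp]: "padic_vanishes p (\<lambda>n. - X n) \<longleftrightarrow> padic_vanishes p X"
  by (simp add: padic_vanishes_def)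

lemma padic_vanishes_commute:
  "padic_vanishes p (\<lambda>n. X n - Y n) \<longleftrightarrow> padic_vanishes p (\<lambda>n. Y n - X n)"
  by (simp add: padic_vanishes_def abs_commute)

lemma padic_cauchy_abs_Cauchy:
  assumes "padic_cauchy p X"
  shows "Cauchy (\<lambda>n. padic_abs p (X n))"
proof (rule CauchyI)
  fix e :: real assume "e > 0"
  then obtain N where "\<forall>m\<ge>N. \<forall>n\<ge>N. padic_abs p (X m - X n) < e"
    using assms by (auto simp: padic_cauchy_def)
  then show "\<exists>M. \<forall>m\<ge>M. \<forall>n\<ge>M. norm (padic_abs p (X m) - padic_abs p (X n)) < e"
    by (intro exI[of _ N] allI impI) (auto intro: le_less_trans[OF abs_add2])
qed

lemma padic_cauchy_abs_lim:
  "padic_cauchy p X \<Longrightarrow> (\<lambda>n. padic_abs p (X n)) \<longlonglongrightarrow> lim (\<lambda>n. padic_abs p (X n))"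
  using padic_cauchy_abs_Cauchy Cauchy_convergent convergent_LIMSEQ_iff by blast

lemma padic_cauchy_bounded:
  assumes "padic_cauchy p X"
  obtains B where "B > 0" "\<And>n. padic_abs p (X n) \<le> B"
  using Cauchy_Bseq[OF padic_cauchy_abs_Cauchy[OF assms]] that
  by (auto elim!: BseqE)

lemma padic_cauchy_const [simp]: "padic_cauchy p (\<lambda>_. c)"
  by (simp add: padic_cauchy_def)

lemma padic_cauchy_squeeze:
  assumes "padic_cauchy p X" "padic_cauchy p Y" "B > 0"
    and "\<And>m n. m \<ge> K \<Longrightarrow> n \<ge> K \<Longrightarrow>
           padic_abs p (Z m - Z n) \<le> B * (padic_abs p (X m - X n) + padic_abs p (Y m - Y n))"
  shows "padic_cauchy p Z"
  unfolding padic_cauchy_def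
proof (intro allI impI)
  fix e :: real assume "e > 0"
  then have e: "e / (2 * B) > 0" using assms(3) by simp
  obtain M where M: "\<forall>m\<ge>M. \<forall>n\<ge>M. padic_abs p (X m - X n) < e / (2 * B)"
    using assms(1) e unfolding padic_cauchy_def by blast
  obtain N where N: "\<forall>m\<ge>N. \<forall>n\<ge>N. padic_abs p (Y m - Y n) < e / (2 * B)"
    using assms(2) e unfolding padic_cauchy_def by blast
  show "\<exists>N. \<forall>m\<ge>N. \<forall>n\<ge>N. padic_abs p (Z m - Z n) < e"
  proof (intro exI[of _ "max K (max M N)"] allI impI)
    fix m n assume mn: "max K (max M N) \<le> m" "max K (max M N) \<le> n"
    have "padic_abs p (Z m - Z n) \<le> B * (padic_abs p (X m - X n) + padic_abs p (Y m - Y n))"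
      using mn by (intro assms(4)) auto
    also have "\<dots> < B * (e / (2 * B) + e / (2 * B))"
      using M N mn by (intro mult_strict_left_mono[OF add_strict_mono assms(3)]) auto
    also have "\<dots> = e"
      using assms(3) by simp
    finally show "padic_abs p (Z m - Z n) < e" .
  qed
qed

lemma padic_cauchy_add:
  assumes "padic_cauchy p X" "padic_cauchy p Y"
  shows "padic_cauchy p (\<lambda>n. X n + Y n)"
proof (rule padic_cauchy_squeeze[OF assms, of 1 0])
  fix m n
  have "X m + Y m - (X n + Y n) = (X m - X n) + (Y m - Y n)" by simp
  then show "padic_abs p (X m + Y m - (X n + Y n))
      \<le> 1 * (padic_abs p (X m - X n) + padic_abs p (Y m - Y n))"
    using abs_add[of "X m - X n" "Y m - Y n"] by (simp only: mult_1)
qed auto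

lemma padic_cauchy_minus:
  assumes "padic_cauchy p X"
  shows "padic_cauchy p (\<lambda>n. - X n)"
proof (rule padic_cauchy_squeeze[OF assms assms, of 1 0])
  fix m n
  have "- X m - - X n = - (X m - X n)" by simp
  then show "padic_abs p (- X m - - X n) \<le> 1 * (padic_abs p (X m - X n) + padic_abs p (X m - X n))"
    by (simp only: padic_abs_minus[OF prime_p]) simp
qed auto

lemma padic_cauchy_mult:
  assumes "padic_cauchy p X" "padic_cauchy p Y"
  shows "padic_cauchy p (\<lambda>n. X n * Y n)"
proof -
  obtain B where B: "B > 0" "\<And>n. padic_abs p (X n) \<le> B"
    using padic_cauchy_bounded[OF assms(1)] by blast
  obtain C where C: "C > 0" "\<And>n. padic_abs p (Y n) \<le> C"
    using padic_cauchy_bounded[OF assms(2)] by blast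
  show ?thesis
  proof (rule padic_cauchy_squeeze[OF assms, of "B + C" 0])
    fix m n
    have "X m * Y m - X n * Y n = X m * (Y m - Y n) + (X m - X n) * Y n"
      by (simp add: algebra_simps)
    then have "padic_abs p (X m * Y m - X n * Y n)
        \<le> padic_abs p (X m) * padic_abs p (Y m - Y n) + padic_abs p (X m - X n) * padic_abs p (Y n)"
      using abs_add[of "X m * (Y m - Y n)" "(X m - X n) * Y n"] by (simp add: abs_mult)
    also have "\<dots> \<le> (B + C) * padic_abs p (Y m - Y n) + padic_abs p (X m - X n) * (B + C)"
      using B(1) C(1) B(2)[of m] C(2)[of n]
      by (intro add_mono mult_right_mono mult_left_mono) auto
    finally show "padic_abs p (X m * Y m - X n * Y n)
        \<le> (B + C) * (padic_abs p (X m - X n) + padic_abs p (Y m - Y n))"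
      by (simp add: algebra_simps)
  qed (use B C in auto)
qed

lemma padic_not_vanishes_lower:
  assumes "padic_cauchy p X" "\<not> padic_vanishes p X"
  obtains b K where "b > 0" "\<And>n. n \<ge> K \<Longrightarrow> padic_abs p (X n) \<ge> b"
proof -
  let ?l = "lim (\<lambda>n. padic_abs p (X n))"
  have lim: "(\<lambda>n. padic_abs p (X n)) \<longlonglongrightarrow> ?l"
    by (rule padic_cauchy_abs_lim[OF assms(1)])
  have "?l \<ge> 0"
    by (rule LIMSEQ_le_const[OF lim]) auto
  moreover have "?l \<noteq> 0"
    using lim assms(2) by (auto simp: padic_vanishes_def)
  ultimately have "?l > 0" by simp
  then have "eventually (\<lambda>n. padic_abs p (X n) > ?l / 2) sequentially"
    by (intro order_tendstoD(1)[OF lim]) auto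
  then obtain K where "\<And>n. n \<ge> K \<Longrightarrow> padic_abs p (X n) > ?l / 2"
    by (auto simp: eventually_sequentially)
  then show ?thesis
    using \<open>?l > 0\<close> by (intro that[of "?l / 2" K]) (auto intro: less_imp_le)
qed

lemma padic_abs_inverse_diff:
  assumes "b > 0" "c > 0" "padic_abs p x \<ge> b" "padic_abs p y \<ge> c"
  shows "padic_abs p (inverse x - inverse y) \<le> inverse (b * c) * padic_abs p (x - y)"
proof -
  have nz: "x \<noteq> 0" "y \<noteq> 0"
    using assms by auto
  have "inverse x - inverse y = - (inverse x * (x - y) * inverse y)"
    using nz by (simp add: inverse_diff_inverse)
  then have "padic_abs p (inverse x - inverse y)
      = inverse (padic_abs p x * padic_abs p y) * padic_abs p (x - y)"
    by (simp only: padic_abs_minus[OF prime_p] abs_mult padic_abs_inverse[OF prime_p]) simp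
  also have "\<dots> \<le> inverse (b * c) * padic_abs p (x - y)"
    using assms by (intro mult_right_mono le_imp_inverse_le mult_mono) auto
  finally show ?thesis .
qed

lemma padic_cauchy_inverse:
  assumes "padic_cauchy p X" "\<not> padic_vanishes p X"
  shows "padic_cauchy p (\<lambda>n. inverse (X n))"
proof -
  obtain b K where b: "b > 0" "\<And>n. n \<ge> K \<Longrightarrow> padic_abs p (X n) \<ge> b"
    using padic_not_vanishes_lower[OF assms] by blast
  show ?thesis
  proof (rule padic_cauchy_squeeze[OF assms(1) assms(1), of "inverse (b * b)" K])
    fix m n assume "m \<ge> K" "n \<ge> K"
    then have "padic_abs p (inverse (X m) - inverse (X n)) \<le> inverse (b * b) * padic_abs p (X m - X n)"
      using b by (intro padic_abs_inverse_diff) auto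
    also have "\<dots> \<le> inverse (b * b) * (padic_abs p (X m - X n) + padic_abs p (X m - X n))"
      using b(1) by (intro mult_left_mono) auto
    finally show "padic_abs p (inverse (X m) - inverse (X n)) \<le> \<dots>" .
  qed (use b in auto)
qed

lemma padic_vanishes_mult:
  assumes "padic_vanishes p X" "padic_cauchy p Y"
  shows "padic_vanishes p (\<lambda>n. X n * Y n)"
proof -
  obtain C where C: "C > 0" "\<And>n. padic_abs p (Y n) \<le> C"
    using padic_cauchy_bounded[OF assms(2)] by blast
  have "(\<lambda>n. padic_abs p (X n) * C) \<longlonglongrightarrow> 0"
    using tendsto_mult_right[OF assms(1)[unfolded padic_vanishes_def], of C] by simp
  then show ?thesis
    by (rule padic_vanishes_squeeze) (simp add: abs_mult mult_left_mono C)
qed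

lemma padic_vanishes_diff_inverse:
  assumes X: "padic_cauchy p X" "\<not> padic_vanishes p X"
    and Y: "padic_cauchy p Y" "\<not> padic_vanishes p Y"
    and XY: "padic_vanishes p (\<lambda>n. X n - Y n)"
  shows "padic_vanishes p (\<lambda>n. inverse (X n) - inverse (Y n))"
proof -
  obtain b K where b: "b > 0" "\<And>n. n \<ge> K \<Longrightarrow> padic_abs p (X n) \<ge> b"
    using padic_not_vanishes_lower[OF X] by blast
  obtain c L where c: "c > 0" "\<And>n. n \<ge> L \<Longrightarrow> padic_abs p (Y n) \<ge> c"
    using padic_not_vanishes_lower[OF Y] by blast
  have lim: "(\<lambda>n. inverse (b * c) * padic_abs p (X n - Y n)) \<longlonglongrightarrow> 0"
    using tendsto_mult_left[OF XY[unfolded padic_vanishes_def], of "inverse (b * c)"] by simp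
  have "eventually (\<lambda>n. padic_abs p (inverse (X n) - inverse (Y n))
          \<le> inverse (b * c) * padic_abs p (X n - Y n)) sequentially"
    using eventually_ge_at_top[of "max K L"]
    by eventually_elim (use b c in \<open>auto intro!: padic_abs_inverse_diff simp del: inverse_mult_distrib\<close>)
  then show ?thesis
    unfolding padic_vanishes_def
    by (intro tendsto_sandwich[OF _ _ tendsto_const lim]) auto
qed

lemma part_equivp_padic_rel: "part_equivp (padic_rel p)"
proof (rule part_equivpI)
  show "\<exists>X. padic_rel p X X"
    by (rule exI[of _ "\<lambda>_. 0"]) (simp add: padic_rel_def)
  show "symp (padic_rel p)"
    using padic_vanishes_commute by (auto simp: symp_def padic_rel_def)
  show "transp (padic_rel p)"
  proof (rule transpI)
    fix X Y Z assume "padic_rel p X Y" "padic_rel p Y Z"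
    then show "padic_rel p X Z"
      using padic_vanishes_add[of "\<lambda>n. X n - Y n" "\<lambda>n. Y n - Z n"] by (simp add: padic_rel_def)
  qed
qed

lemma padic_rel_refl: "padic_cauchy p X \<Longrightarrow> padic_rel p X X"
  by (simp add: padic_rel_def)

lemma padic_rel_add:
  assumes "padic_rel p X X'" "padic_rel p Y Y'"
  shows "padic_rel p (\<lambda>n. X n + Y n) (\<lambda>n. X' n + Y' n)"
proof -
  have "(\<lambda>n. X n + Y n - (X' n + Y' n)) = (\<lambda>n. (X n - X' n) + (Y n - Y' n))"
    by auto
  then show ?thesis
    using assms padic_vanishes_add[of "\<lambda>n. X n - X' n" "\<lambda>n. Y n - Y' n"]
    by (auto simp: padic_rel_def intro: padic_cauchy_add)
qed

lemma padic_rel_minus: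
  assumes "padic_rel p X X'"
  shows "padic_rel p (\<lambda>n. - X n) (\<lambda>n. - X' n)"
proof -
  have "(\<lambda>n. - X n - - X' n) = (\<lambda>n. - (X n - X' n))"
    by auto
  then show ?thesis
    using assms padic_vanishes_minus_iff[of "\<lambda>n. X n - X' n"]
    by (auto simp: padic_rel_def intro: padic_cauchy_minus)
qed

lemma padic_rel_mult:
  assumes "padic_rel p X X'" "padic_rel p Y Y'"
  shows "padic_rel p (\<lambda>n. X n * Y n) (\<lambda>n. X' n * Y' n)"
proof -
  have "(\<lambda>n. X n * Y n - X' n * Y' n) = (\<lambda>n. (X n - X' n) * Y n + (Y n - Y' n) * X' n)"
    by (auto simp: algebra_simps)
  then show ?thesis
    using assms padic_vanishes_add[OF padic_vanishes_mult[of "\<lambda>n. X n - X' n" Y]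
        padic_vanishes_mult[of "\<lambda>n. Y n - Y' n" X']]
    by (auto simp: padic_rel_def intro: padic_cauchy_mult)
qed

lemma padic_rel_vanishes_iff:
  assumes "padic_rel p X Y"
  shows "padic_vanishes p X \<longleftrightarrow> padic_vanishes p Y"
  using assms padic_vanishes_add[of "\<lambda>n. X n - Y n" Y] padic_vanishes_add[of "\<lambda>n. Y n - X n" X]
    padic_vanishes_commute[of X Y]
  by (auto simp: padic_rel_def)

lemma padic_rel_inverse:
  assumes "padic_rel p X Y"
  shows "padic_rel p (if padic_vanishes p X then (\<lambda>n. 0) else (\<lambda>n. inverse (X n)))
                     (if padic_vanishes p Y then (\<lambda>n. 0) else (\<lambda>n. inverse (Y n)))"
  using padic_rel_vanishes_iff[OF assms] assms
  by (auto simp: padic_rel_def intro!: padic_cauchy_inverse padic_vanishes_diff_inverse)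

lemma padic_rel_lim:
  assumes "padic_rel p X Y"
  shows "lim (\<lambda>n. padic_abs p (X n)) = lim (\<lambda>n. padic_abs p (Y n))"
proof -
  have "(\<lambda>n. padic_abs p (X n) - padic_abs p (Y n)) \<longlonglongrightarrow> 0"
  proof (rule Lim_null_comparison)
    show "\<forall>\<^sub>F n in sequentially. norm (padic_abs p (X n) - padic_abs p (Y n)) \<le> padic_abs p (X n - Y n)"
      by (simp add: abs_add2)
    show "(\<lambda>n. padic_abs p (X n - Y n)) \<longlonglongrightarrow> 0"
      using assms by (simp add: padic_rel_def padic_vanishes_def)
  qed
  moreover have "(\<lambda>n. padic_abs p (X n) - padic_abs p (Y n))
      \<longlonglongrightarrow> lim (\<lambda>n. padic_abs p (X n)) - lim (\<lambda>n. padic_abs p (Y n))"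
    using assms by (intro tendsto_diff padic_cauchy_abs_lim) (auto simp: padic_rel_def)
  ultimately show ?thesis
    using LIMSEQ_unique by fastforce
qed

end

text \<open>
  The field of \<open>p\<close>-adic numbers, with \<open>p = CARD('p)\<close>, as the completion of the rationals
  with respect to the \<open>p\<close>-adic absolute value (Cauchy sequences modulo null sequences).
\<close>

typedef (overloaded) 'p padic =
  "{c. \<exists>X. padic_rel CARD('p::prime_card) X X \<and> c = Collect (padic_rel CARD('p) X)}"
  using padic_rel_refl[OF prime_card padic_cauchy_const[OF prime_card]] by blast

definition Padic :: "(nat \<Rightarrow> rat) \<Rightarrow> 'p::prime_card padic" where
  "Padic X = Abs_padic (Collect (padic_rel CARD('p) X))"

definition rep_padic :: "'p::prime_card padic \<Rightarrow> nat \<Rightarrow> rat" where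
  "rep_padic x = (SOME X. X \<in> Rep_padic x)"

definition cr_padic :: "(nat \<Rightarrow> rat) \<Rightarrow> 'p::prime_card padic \<Rightarrow> bool" where
  "cr_padic X x \<longleftrightarrow> padic_rel CARD('p) X X \<and> Padic X = x"

(* quotient_type itself does not support a relation with a phantom type parameter *)
lemma Quotient_padic:
  "Quotient (padic_rel CARD('p)) Padic (rep_padic :: 'p::prime_card padic \<Rightarrow> _) cr_padic"
proof (rule Quotient3_to_Quotient)
  interpret quot_type "padic_rel CARD('p)" "Abs_padic :: _ \<Rightarrow> 'p padic" Rep_padic
    by (rule quot_type.intro[OF part_equivp_padic_rel[OF prime_card]])
      (use Rep_padic in \<open>auto simp: Rep_padic_inverse Abs_padic_inverse Rep_padic_inject\<close>)
  have "Padic = (abs :: _ \<Rightarrow> 'p padic)" "(rep_padic :: 'p padic \<Rightarrow> _) = rep"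
    by (auto simp: Padic_def abs_def rep_padic_def rep_def)
  then show "Quotient3 (padic_rel CARD('p)) Padic (rep_padic :: 'p padic \<Rightarrow> _)"
    using Quotient by simp
  show "(cr_padic :: _ \<Rightarrow> 'p padic \<Rightarrow> _) \<equiv> \<lambda>X x. padic_rel CARD('p) X X \<and> Padic X = x"
    by (intro eq_reflection ext) (simp add: cr_padic_def)
qed

setup_lifting Quotient_padic

lemma Padic_cases:
  obtains X where "padic_cauchy CARD('p) X" "x = (Padic X :: 'p::prime_card padic)"
  using Quotient_abs_rep[OF Quotient_padic, of x] Quotient_rep_reflp[OF Quotient_padic, of x]
  by (metis padic_rel_def)

lemma eq_Padic:
  assumes "padic_cauchy CARD('p) X" "padic_cauchy CARD('p) Y"
  shows "(Padic X :: 'p::prime_card padic) = Padic Y \<longleftrightarrow> padic_vanishes CARD('p) (\<lambda>n. X n - Y n)"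
proof -
  have "padic_rel CARD('p) X Y \<longleftrightarrow>
      padic_rel CARD('p) X X \<and> padic_rel CARD('p) Y Y \<and> (Padic X :: 'p padic) = Padic Y"
    by (rule Quotient_rel[OF Quotient_padic, symmetric])
  with assms show ?thesis
    by (simp add: padic_rel_def prime_card)
qed

instantiation padic :: (prime_card) field
begin

lift_definition zero_padic :: "'a padic" is "\<lambda>n. 0"
  by (simp add: padic_rel_refl prime_card)

lift_definition one_padic :: "'a padic" is "\<lambda>n. 1"
  by (simp add: padic_rel_refl prime_card)

lift_definition plus_padic :: "'a padic \<Rightarrow> 'a padic \<Rightarrow> 'a padic" is "\<lambda>X Y n. X n + Y n"
  by (rule padic_rel_add[OF prime_card])

lift_definition uminus_padic :: "'a padic \<Rightarrow> 'a padic" is "\<lambda>X n. - X n"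
  by (rule padic_rel_minus[OF prime_card])

lift_definition times_padic :: "'a padic \<Rightarrow> 'a padic \<Rightarrow> 'a padic" is "\<lambda>X Y n. X n * Y n"
  by (rule padic_rel_mult[OF prime_card])

lift_definition inverse_padic :: "'a padic \<Rightarrow> 'a padic" is
  "\<lambda>X. if padic_vanishes CARD('a) X then (\<lambda>n. 0) else (\<lambda>n. inverse (X n))"
  by (rule padic_rel_inverse[OF prime_card])

definition minus_padic :: "'a padic \<Rightarrow> 'a padic \<Rightarrow> 'a padic" where
  "minus_padic x y = x + - y"

definition divide_padic :: "'a padic \<Rightarrow> 'a padic \<Rightarrow> 'a padic" where
  "divide_padic x y = x * inverse y"

instance
proof
  fix x y z :: "'a padic"
  show "x + y + z = x + (y + z)"
    by transfer (simp add: padic_rel_refl padic_cauchy_add prime_card padic_rel_def ac_simps)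
  show "x + y = y + x"
    by transfer (simp add: padic_cauchy_add prime_card padic_rel_def ac_simps)
  show "0 + x = x"
    by transfer (simp add: prime_card padic_rel_def)
  show "- x + x = 0"
    by transfer (simp add: prime_card padic_rel_def)
  show "x - y = x + - y"
    by (fact minus_padic_def)
  show "x * y * z = x * (y * z)"
    by transfer (simp add: padic_cauchy_mult prime_card padic_rel_def ac_simps)
  show "x * y = y * x"
    by transfer (simp add: padic_cauchy_mult prime_card padic_rel_def ac_simps)
  show "1 * x = x"
    by transfer (simp add: prime_card padic_rel_def)
  show "(x + y) * z = x * z + y * z"
    by transfer (simp add: padic_cauchy_mult padic_cauchy_add prime_card padic_rel_def distrib_right)
  show "(0::'a padic) \<noteq> 1"
    by transfer (simp add: prime_card padic_rel_def)
  show "inverse x * x = 1" if "x \<noteq> 0"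
    using that
  proof transfer
    fix X
    assume X: "padic_rel CARD('a) X X" and nz: "\<not> padic_rel CARD('a) X (\<lambda>n. 0)"
    then have c: "padic_cauchy CARD('a) X" and nv: "\<not> padic_vanishes CARD('a) X"
      by (auto simp: padic_rel_def prime_card)
    obtain b K where b: "b > 0" "\<And>n. n \<ge> K \<Longrightarrow> padic_abs CARD('a) (X n) \<ge> b"
      using padic_not_vanishes_lower[OF prime_card c nv] by blast
    have "eventually (\<lambda>n. padic_abs CARD('a) (inverse (X n) * X n - 1) = 0) sequentially"
      using eventually_ge_at_top[of K]
    proof eventually_elim
      case (elim n)
      then have "X n \<noteq> 0"
        using b by (fastforce simp: padic_abs_0[OF prime_card])
      then show ?case
        by (simp add: padic_abs_0[OF prime_card])
    qed
    then have "padic_vanishes CARD('a) (\<lambda>n. inverse (X n) * X n - 1)"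
      unfolding padic_vanishes_def by (rule tendsto_eventually)
    then show "padic_rel CARD('a)
        (\<lambda>n. (if padic_vanishes CARD('a) X then (\<lambda>n. 0) else (\<lambda>n. inverse (X n))) n * X n) (\<lambda>n. 1)"
      using c nv by (simp add: padic_rel_def prime_card padic_cauchy_mult padic_cauchy_inverse)
  qed
  show "x div y = x * inverse y"
    by (fact divide_padic_def)
  show "inverse (0::'a padic) = 0"
    by transfer (simp add: prime_card padic_rel_def)
qed

end

lemma plus_Padic:
  assumes "padic_cauchy CARD('p) X" "padic_cauchy CARD('p) Y"
  shows "Padic X + Padic Y = (Padic (\<lambda>n. X n + Y n) :: 'p::prime_card padic)"
  using assms by (intro plus_padic.abs_eq) (auto simp: padic_rel_refl prime_card)

lemma minus_Padic:
  assumes "padic_cauchy CARD('p) X" "padic_cauchy CARD('p) Y"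
  shows "Padic X - Padic Y = (Padic (\<lambda>n. X n - Y n) :: 'p::prime_card padic)"
proof -
  have "- (Padic Y :: 'p padic) = Padic (\<lambda>n. - Y n)"
    using assms by (intro uminus_padic.abs_eq) (auto simp: padic_rel_refl prime_card)
  then show ?thesis
    using assms plus_Padic[of X "\<lambda>n. - Y n", where 'p = 'p]
    by (simp add: padic_cauchy_minus prime_card minus_padic_def)
qed

lemma times_Padic:
  assumes "padic_cauchy CARD('p) X" "padic_cauchy CARD('p) Y"
  shows "Padic X * Padic Y = (Padic (\<lambda>n. X n * Y n) :: 'p::prime_card padic)"
  using assms by (intro times_padic.abs_eq) (auto simp: padic_rel_refl prime_card)

lemma of_nat_padic: "(of_nat k :: 'p::prime_card padic) = Padic (\<lambda>_. of_nat k)"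
  by (induction k)
    (simp_all add: zero_padic.abs_eq one_padic.abs_eq plus_Padic prime_card)

instance padic :: (prime_card) ring_char_0
proof
  show "inj (of_nat :: nat \<Rightarrow> 'a padic)"
    by (rule injI) (simp add: of_nat_padic eq_Padic prime_card)
qed

instance padic :: (prime_card) field_char_0 ..

lemma of_int_padic: "(of_int k :: 'p::prime_card padic) = Padic (\<lambda>_. of_int k)"
proof (cases k rule: int_cases2)
  case (nonneg n)
  then show ?thesis by (simp add: of_nat_padic)
next
  case (nonpos n)
  have "- (Padic (\<lambda>_. of_nat n) :: 'p padic) = Padic (\<lambda>_. - of_nat n)"
    by (intro uminus_padic.abs_eq) (auto simp: padic_rel_refl prime_card)
  with nonpos show ?thesis by (simp add: of_nat_padic)
qed

lemma of_rat_padic: "(of_rat r :: 'p::prime_card padic) = Padic (\<lambda>_. r)"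
proof -
  obtain a b where ab: "quotient_of r = (a, b)" by fastforce
  have b: "b \<noteq> 0"
    using quotient_of_denom_pos[OF ab] by simp
  have r: "r = of_int a / of_int b"
    using quotient_of_div[OF ab] .
  have "(Padic (\<lambda>_. r) :: 'p padic) * of_int b = of_int a"
    using b by (simp add: of_int_padic times_Padic prime_card r)
  then have "(Padic (\<lambda>_. r) :: 'p padic) = of_int a / of_int b"
    using b by (simp add: field_simps)
  then show ?thesis
    by (simp add: r of_rat_divide)
qed

lift_definition padic_norm :: "'p::prime_card padic \<Rightarrow> real"
  is "\<lambda>X. lim (\<lambda>n. padic_abs CARD('p) (X n))"
  by (rule padic_rel_lim[OF prime_card])

lemma padic_norm_Padic:
  assumes "padic_cauchy CARD('p) X"
  shows "padic_norm (Padic X :: 'p::prime_card padic) = lim (\<lambda>n. padic_abs CARD('p) (X n))"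
  using assms by (intro padic_norm.abs_eq) (auto simp: padic_rel_refl prime_card)

lemma padic_norm_Padic_lim:
  assumes "padic_cauchy CARD('p) X"
  shows "(\<lambda>n. padic_abs CARD('p) (X n)) \<longlonglongrightarrow> padic_norm (Padic X :: 'p::prime_card padic)"
  using padic_cauchy_abs_lim[OF prime_card assms] padic_norm_Padic[OF assms] by simp

lemma padic_norm_of_rat [simp]: "padic_norm (of_rat r :: 'p::prime_card padic) = padic_abs CARD('p) r"
  by (simp add: of_rat_padic padic_norm_Padic prime_card)

lemma padic_norm_nonneg [simp]: "padic_norm (x :: 'p::prime_card padic) \<ge> 0"
proof (cases x rule: Padic_cases)
  case (1 X)
  then show ?thesis
    using LIMSEQ_le_const[OF padic_norm_Padic_lim[OF 1(1)], of 0] by (auto simp: padic_abs_nonneg prime_card)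
qed

lemma padic_norm_eq_0_iff [simp]: "padic_norm (x :: 'p::prime_card padic) = 0 \<longleftrightarrow> x = 0"
proof (cases x rule: Padic_cases)
  case (1 X)
  have "x = 0 \<longleftrightarrow> padic_vanishes CARD('p) X"
    using 1 eq_Padic[of X "\<lambda>_. 0", where 'p = 'p] by (simp add: zero_padic.abs_eq prime_card)
  moreover have "padic_norm x = 0 \<longleftrightarrow> padic_vanishes CARD('p) X"
    using padic_norm_Padic_lim[OF 1(1)] 1(2) LIMSEQ_unique[of "\<lambda>n. padic_abs CARD('p) (X n)" _ 0]
    by (auto simp: padic_vanishes_def)
  ultimately show ?thesis by simp
qed

lemma padic_norm_mult: "padic_norm (x * y :: 'p::prime_card padic) = padic_norm x * padic_norm y"
proof (cases x rule: Padic_cases)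
  case X: (1 X)
  show ?thesis
  proof (cases y rule: Padic_cases)
    case Y: (1 Y)
    have "(\<lambda>n. padic_abs CARD('p) (X n * Y n)) \<longlonglongrightarrow> padic_norm (x * y)"
      using padic_norm_Padic_lim[OF padic_cauchy_mult[OF prime_card X(1) Y(1)]] X Y
      by (simp add: times_Padic)
    moreover have "(\<lambda>n. padic_abs CARD('p) (X n * Y n)) \<longlonglongrightarrow> padic_norm x * padic_norm y"
      using tendsto_mult[OF padic_norm_Padic_lim[OF X(1)] padic_norm_Padic_lim[OF Y(1)]] X Y
      by (simp add: padic_abs_mult prime_card)
    ultimately show ?thesis
      by (rule LIMSEQ_unique)
  qed
qed

lemma padic_norm_add_max: "padic_norm (x + y :: 'p::prime_card padic) \<le> max (padic_norm x) (padic_norm y)"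
proof (cases x rule: Padic_cases)
  case X: (1 X)
  show ?thesis
  proof (cases y rule: Padic_cases)
    case Y: (1 Y)
    have "(\<lambda>n. padic_abs CARD('p) (X n + Y n)) \<longlonglongrightarrow> padic_norm (x + y)"
      using padic_norm_Padic_lim[OF padic_cauchy_add[OF prime_card X(1) Y(1)]] X Y
      by (simp add: plus_Padic)
    moreover have "(\<lambda>n. max (padic_abs CARD('p) (X n)) (padic_abs CARD('p) (Y n)))
        \<longlonglongrightarrow> max (padic_norm x) (padic_norm y)"
      using tendsto_max[OF padic_norm_Padic_lim[OF X(1)] padic_norm_Padic_lim[OF Y(1)]] X Y by simp
    ultimately show ?thesis
      by (rule LIMSEQ_le) (simp add: padic_abs_add_max[OF prime_card])
  qed
qed

lemma padic_norm_minus [simp]: "padic_norm (- x :: 'p::prime_card padic) = padic_norm x"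
proof (cases x rule: Padic_cases)
  case (1 X)
  have "- x = Padic (\<lambda>n. - X n)"
    unfolding 1(2) using 1(1) by (intro uminus_padic.abs_eq) (auto simp: padic_rel_refl prime_card)
  then show ?thesis
    using 1 by (simp add: padic_norm_Padic padic_cauchy_minus prime_card padic_abs_minus)
qed

instantiation padic :: (prime_card) metric_space
begin

definition dist_padic :: "'a padic \<Rightarrow> 'a padic \<Rightarrow> real" where
  "dist_padic x y = padic_norm (x - y)"

definition uniformity_padic :: "('a padic \<times> 'a padic) filter" where
  "uniformity_padic = (INF e\<in>{0 <..}. principal {(x, y). dist x y < e})"

definition open_padic :: "'a padic set \<Rightarrow> bool" where
  "open_padic U \<longleftrightarrow> (\<forall>x\<in>U. eventually (\<lambda>(x', y). x' = x \<longrightarrow> y \<in> U) uniformity)"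

instance
proof
  fix x y z :: "'a padic"
  show "dist x y = 0 \<longleftrightarrow> x = y"
    by (simp add: dist_padic_def)
  show "dist x y \<le> dist x z + dist y z"
    using padic_norm_add_max[of "x - z" "z - y"] padic_norm_minus[of "y - z"]
      padic_norm_nonneg[of "x - z"] padic_norm_nonneg[of "y - z"]
    by (simp add: dist_padic_def del: padic_norm_nonneg padic_norm_minus)
qed (simp_all only: uniformity_padic_def open_padic_def)

end

lemma rat_dense_padic:
  assumes "e > 0"
  shows "\<exists>r. dist (x :: 'p::prime_card padic) (of_rat r) < e"
proof (cases x rule: Padic_cases)
  case (1 X)
  obtain N where N: "\<forall>m\<ge>N. \<forall>n\<ge>N. padic_abs CARD('p) (X m - X n) < e / 2"
    using 1(1) assms unfolding padic_cauchy_def by (meson half_gt_zero)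
  have c: "padic_cauchy CARD('p) (\<lambda>n. X n - X N)"
    using padic_cauchy_add[OF prime_card 1(1) padic_cauchy_const[OF prime_card], of "- X N"] by simp
  have "x - of_rat (X N) = Padic (\<lambda>n. X n - X N)"
    using 1 by (simp add: of_rat_padic minus_Padic prime_card)
  then have "(\<lambda>n. padic_abs CARD('p) (X n - X N)) \<longlonglongrightarrow> dist x (of_rat (X N))"
    using padic_norm_Padic_lim[OF c] by (simp add: dist_padic_def)
  then have "dist x (of_rat (X N)) \<le> e / 2"
    by (rule LIMSEQ_le_const2) (use N in \<open>auto intro!: exI[of _ N] less_imp_le\<close>)
  then show ?thesis
    using assms by (intro exI[of _ "X N"]) auto
qed

instance padic :: (prime_card) complete_space
proof
  fix X :: "nat \<Rightarrow> 'a padic"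
  assume X: "Cauchy X"
  have "\<forall>n. \<exists>r. dist (X n) (of_rat r) < inverse (real (Suc n))"
    by (intro allI rat_dense_padic) auto
  then obtain r where r: "\<And>n. dist (X n) (of_rat (r n)) < inverse (real (Suc n))"
    by metis
  have lim0: "(\<lambda>n. dist (X n) (of_rat (r n))) \<longlonglongrightarrow> 0"
  proof (rule tendsto_sandwich[OF _ _ tendsto_const LIMSEQ_inverse_real_of_nat])
    show "\<forall>\<^sub>F n in sequentially. dist (X n) (of_rat (r n)) \<le> inverse (real (Suc n))"
      using r by (intro always_eventually allI less_imp_le)
  qed simp
  have pc: "padic_cauchy CARD('a) r"
    unfolding padic_cauchy_def
  proof (intro allI impI)
    fix e :: real assume "e > 0"
    then have e: "e / 3 > 0" by simp
    obtain M where M: "\<And>m n. m \<ge> M \<Longrightarrow> n \<ge> M \<Longrightarrow> dist (X m) (X n) < e / 3"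
      using X e unfolding Cauchy_def by blast
    obtain N where N: "\<And>n. n \<ge> N \<Longrightarrow> dist (X n) (of_rat (r n)) < e / 3"
      using order_tendstoD(2)[OF lim0 e] by (auto simp: eventually_sequentially)
    show "\<exists>N. \<forall>m\<ge>N. \<forall>n\<ge>N. padic_abs CARD('a) (r m - r n) < e"
    proof (intro exI[of _ "max M N"] allI impI)
      fix m n assume "max M N \<le> m" "max M N \<le> n"
      then have "dist (X m) (X n) < e / 3" "dist (X m) (of_rat (r m)) < e / 3"
          "dist (X n) (of_rat (r n)) < e / 3"
        using M N by auto
      moreover have "dist (of_rat (r m) :: 'a padic) (of_rat (r n))
          \<le> dist (X m) (of_rat (r m)) + dist (X m) (X n) + dist (X n) (of_rat (r n))"
        using dist_triangle[of "of_rat (r m)" "of_rat (r n)" "X m"]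
          dist_triangle[of "X m" "of_rat (r n)" "X n"] by (simp add: dist_commute)
      moreover have "dist (of_rat (r m) :: 'a padic) (of_rat (r n)) = padic_abs CARD('a) (r m - r n)"
        by (simp add: dist_padic_def flip: of_rat_diff)
      ultimately show "padic_abs CARD('a) (r m - r n) < e"
        by linarith
    qed
  qed
  let ?L = "Padic r :: 'a padic"
  have "(\<lambda>n. dist (of_rat (r n)) ?L) \<longlonglongrightarrow> 0"
  proof (rule LIMSEQ_I)
    fix e :: real assume "e > 0"
    then obtain N where N: "\<forall>m\<ge>N. \<forall>n\<ge>N. padic_abs CARD('a) (r m - r n) < e / 2"
      using pc unfolding padic_cauchy_def by (meson half_gt_zero)
    have "dist (of_rat (r k)) ?L < e" if "k \<ge> N" for k
    proof -
      have c: "padic_cauchy CARD('a) (\<lambda>n. r n - r k)"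
        using padic_cauchy_add[OF prime_card pc padic_cauchy_const[OF prime_card], of "- r k"] by simp
      have "?L - of_rat (r k) = Padic (\<lambda>n. r n - r k)"
        using pc by (simp add: of_rat_padic minus_Padic prime_card)
      then have "(\<lambda>n. padic_abs CARD('a) (r n - r k)) \<longlonglongrightarrow> dist ?L (of_rat (r k))"
        using padic_norm_Padic_lim[OF c] by (simp add: dist_padic_def)
      then have "dist ?L (of_rat (r k)) \<le> e / 2"
        by (rule LIMSEQ_le_const2) (use N that in \<open>auto intro!: exI[of _ N] less_imp_le\<close>)
      then show ?thesis
        using \<open>e > 0\<close> by (simp add: dist_commute)
    qed
    then show "\<exists>no. \<forall>n\<ge>no. norm (dist (of_rat (r n)) ?L - 0) < e"
      by auto
  qed
  with lim0 have lim: "(\<lambda>n. dist (X n) (of_rat (r n)) + dist (of_rat (r n)) ?L) \<longlonglongrightarrow> 0"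
    using tendsto_add[OF lim0, of "\<lambda>n. dist (of_rat (r n)) ?L" 0] by simp
  have "(\<lambda>n. dist (X n) ?L) \<longlonglongrightarrow> 0"
    by (rule tendsto_sandwich[OF _ _ tendsto_const lim])
      (auto intro!: always_eventually dist_triangle)
  then show "convergent X"
    unfolding convergent_def using tendsto_dist_iff by blast
qed


section \<open>Affine subspaces and Haar measure\<close>

text \<open>
  Vectors with coordinates indexed by \<open>I\<close> are extensional functions in \<open>I \<rightarrow>\<^sub>E UNIV\<close>,
  so that \<open>{1..s} \<rightarrow>\<^sub>E UNIV\<close> is \<open>\<rat>\<^sub>p\<^sup>s\<close>, including \<open>s = 0\<close>.
\<close>

definition padic_borel :: "nat set \<Rightarrow> (nat \<Rightarrow> 'p::prime_card padic) measure" where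
  "padic_borel I = sigma (I \<rightarrow>\<^sub>E UNIV) {U. openin (product_topology (\<lambda>_. euclidean) I) U}"

(* Regularity is automatic: Q_p^I is a locally compact, second countable group. *)
definition haar_measure :: "nat set \<Rightarrow> (nat \<Rightarrow> 'p::prime_card padic) measure \<Rightarrow> bool" where
  "haar_measure I \<nu> \<longleftrightarrow>
     sets \<nu> = sets (padic_borel I) \<and>
     emeasure \<nu> (space \<nu>) \<noteq> 0 \<and>
     (\<forall>K. compactin (product_topology (\<lambda>_. euclidean) I) K \<longrightarrow> emeasure \<nu> K < \<infinity>) \<and>
     (\<forall>a \<in> I \<rightarrow>\<^sub>E UNIV. \<forall>E \<in> sets \<nu>. emeasure \<nu> ((\<lambda>x. \<lambda>i\<in>I. a i + x i) ` E) = emeasure \<nu> E)"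

definition affine_isomorphism ::
  "nat \<Rightarrow> nat \<Rightarrow> (nat \<Rightarrow> 'p::prime_card padic) set \<Rightarrow> ((nat \<Rightarrow> 'p padic) \<Rightarrow> nat \<Rightarrow> 'p padic) \<Rightarrow> bool" where
  "affine_isomorphism s n L \<phi> \<longleftrightarrow>
     bij_betw \<phi> ({1..s} \<rightarrow>\<^sub>E UNIV) L \<and>
     (\<exists>b c. \<forall>x \<in> {1..s} \<rightarrow>\<^sub>E UNIV. \<phi> x = (\<lambda>j\<in>{1..n}. b j + (\<Sum>i=1..s. x i * c i j)))"

(* The matrix (I_(s+1)  A), with rows 0..s and columns 0..n. *)
definition R_mat :: "nat \<Rightarrow> (nat \<Rightarrow> nat \<Rightarrow> 'p::prime_card padic) \<Rightarrow> nat \<Rightarrow> nat \<Rightarrow> 'p padic" where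
  "R_mat s A i j = (if j \<le> s then (if i = j then 1 else 0) else A i j)"

(* x(0 := 1) is the vector (1, x). *)
definition affine_subspace ::
  "nat \<Rightarrow> nat \<Rightarrow> (nat \<Rightarrow> nat \<Rightarrow> 'p::prime_card padic) \<Rightarrow> (nat \<Rightarrow> 'p padic) set" where
  "affine_subspace s n A =
     {y \<in> {1..n} \<rightarrow>\<^sub>E UNIV. \<exists>x \<in> {1..s} \<rightarrow>\<^sub>E UNIV.
        \<forall>j\<in>{0..n}. (y(0 := 1)) j = (\<Sum>i=0..s. (x(0 := 1)) i * R_mat s A i j)}"

section \<open>Diophantine exponents\<close>

text \<open>
  Integer vectors and vectors over \<open>\<int>[1/p]\<close> are both represented as rational vectors, as both the
  real and the \<open>p\<close>-adic absolute value of their coordinates are needed.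
  Exponents take values in \<^typ>\<open>ereal\<close> because they may be infinite.
\<close>

definition Z_inv :: "nat \<Rightarrow> rat set" where
  "Z_inv p = {of_int a / of_nat p ^ k |a k. True}"

definition real_maxnorm :: "nat set \<Rightarrow> (nat \<Rightarrow> rat) \<Rightarrow> real" where
  "real_maxnorm I q = Max ((\<lambda>i. real_of_rat \<bar>q i\<bar>) ` I)"

definition padic_maxnorm :: "nat set \<Rightarrow> (nat \<Rightarrow> 'p::prime_card padic) \<Rightarrow> real" where
  "padic_maxnorm I y = Max ((\<lambda>i. padic_norm (y i)) ` I)"

(* Below, q is the vector (q_0, q_1, ..., q_n). *)
definition w_vec :: "nat \<Rightarrow> (nat \<Rightarrow> 'p::prime_card padic) \<Rightarrow> ereal" where
  "w_vec n y = Sup (ereal ` {v. v > 0 \<and>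
     infinite {q \<in> {0..n} \<rightarrow>\<^sub>E \<int>.
       padic_norm (of_rat (q 0) + (\<Sum>j=1..n. of_rat (q j) * y j)) \<le> real_maxnorm {0..n} q powr (- v)}})"

definition w_p_vec :: "nat \<Rightarrow> (nat \<Rightarrow> 'p::prime_card padic) \<Rightarrow> ereal" where
  "w_p_vec n y = Sup (ereal ` {v. \<forall>N::real. \<exists>q \<in> {0..n} \<rightarrow>\<^sub>E Z_inv CARD('p).
     let Q = padic_maxnorm {1..n} (\<lambda>j. of_rat (q j) :: 'p padic) * real_maxnorm {0..n} q in
       Q > N \<and>
       padic_norm ((\<Sum>j=1..n. of_rat (q j) * y j) + of_rat (q 0))
         < Q powr (- v) * inverse (real_maxnorm {0..n} q)})"

(* mu is the measure on Q_p^n carried by the affine subspace. *)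
definition w_measure :: "nat \<Rightarrow> (nat \<Rightarrow> 'p::prime_card padic) measure \<Rightarrow> ereal" where
  "w_measure n \<mu> = Sup (ereal ` {v. emeasure \<mu> {y \<in> space \<mu>. w_vec n y > ereal v} > 0})"

definition w_p_measure :: "nat \<Rightarrow> (nat \<Rightarrow> 'p::prime_card padic) measure \<Rightarrow> ereal" where
  "w_p_measure n \<mu> = Sup (ereal ` {v. emeasure \<mu> {y \<in> space \<mu>. w_p_vec n y > ereal v} > 0})"

(* I and J index the rows and the columns of the matrix. *)
definition w_mat :: "nat set \<Rightarrow> nat set \<Rightarrow> (nat \<Rightarrow> nat \<Rightarrow> 'p::prime_card padic) \<Rightarrow> ereal" where
  "w_mat I J A = Sup (ereal ` {v.
     infinite {(q0, q) \<in> (I \<rightarrow>\<^sub>E \<int>) \<times> (J \<rightarrow>\<^sub>E \<int>).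
       padic_maxnorm I (\<lambda>i. (\<Sum>j\<in>J. A i j * of_rat (q j)) + of_rat (q0 i))
         \<le> max (real_maxnorm I q0) (real_maxnorm J q) powr (- v)}})"

definition w_p_mat :: "nat set \<Rightarrow> nat set \<Rightarrow> (nat \<Rightarrow> nat \<Rightarrow> 'p::prime_card padic) \<Rightarrow> ereal" where
  "w_p_mat I J A = Sup (ereal ` {v. \<forall>N::real.
     \<exists>q0 \<in> I \<rightarrow>\<^sub>E Z_inv CARD('p). \<exists>q \<in> J \<rightarrow>\<^sub>E Z_inv CARD('p).
       let H = max (real_maxnorm I q0) (real_maxnorm J q);
           Q = padic_maxnorm J (\<lambda>j. of_rat (q j) :: 'p padic) * H in
         Q > N \<and>
         padic_maxnorm I (\<lambda>i. (\<Sum>j\<in>J. A i j * of_rat (q j)) + of_rat (q0 i))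
           \<le> Q powr (- v) * inverse H})"

definition rows_rational_multiples ::
  "nat set \<Rightarrow> nat set \<Rightarrow> (nat \<Rightarrow> nat \<Rightarrow> 'p::prime_card padic) \<Rightarrow> bool" where
  "rows_rational_multiples I J A \<longleftrightarrow>
     (\<exists>i0\<in>I. \<forall>i\<in>I. \<exists>c::rat. \<forall>j\<in>J. A i j = of_rat c * A i0 j)"

definition cols_rational_multiples ::
  "nat set \<Rightarrow> nat set \<Rightarrow> (nat \<Rightarrow> nat \<Rightarrow> 'p::prime_card padic) \<Rightarrow> bool" where
  "cols_rational_multiples I J A \<longleftrightarrow>
     (\<exists>j0\<in>J. \<forall>j\<in>J. \<exists>c::rat. \<forall>i\<in>I. A i j = of_rat c * A i j0)"

end

theory Submission
  imports Defs
begin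

text \<open>
  For \<open>y\<close> in the affine subspace, \<open>q\<^sub>0 + q \<cdot> y = (1, x) \<cdot> r(q)\<close> with \<open>r(q) = A q + q\<^sub>0\<close>, so every point has
  exponent at least \<open>w(A)\<close>, and at least \<open>n + 1\<close> by Dirichlet's pigeonhole argument.

  Conversely let \<open>max (n + 1) w(A) < u < v\<close>. Then \<open>\<parallel>r(q)\<parallel> \<ge> c \<parallel>q\<parallel>\<^bsup>-u\<^esup>\<close> for all nonzero integral \<open>q\<close>. In a
  fixed box the points with \<open>\<bar>q\<^sub>0 + q \<cdot> y\<bar>\<^sub>p \<le> \<parallel>q\<parallel>\<^bsup>-v\<^esup>\<close> have measure \<open>O(\<parallel>q\<parallel>\<^bsup>-v\<^esup> / \<parallel>r(q)\<parallel>)\<close>. The lower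
  bound on \<open>\<parallel>r(q)\<parallel>\<close> separates integer vectors with small values and thereby gives
  \<open>\<Sum> 1 / \<parallel>r(q)\<parallel> = O(T\<^bsup>u\<^esup> log T)\<close> over \<open>\<parallel>q\<parallel> \<le> T\<close>, so that Borel-Cantelli over dyadic ranges of
  \<open>\<parallel>q\<parallel>\<close> shows that almost no point has exponent greater than \<open>v\<close>.

  The statement on \<open>w\<^sub>p\<close> reduces to the one on \<open>w\<close>: scaling by a power of \<open>p\<close> turns a vector over \<open>\<int>[1/p]\<close>
  into an integral one whose height is the product \<open>\<parallel>q\<parallel>\<^sub>p \<parallel>q\<parallel>\<^sub>\<infinity>\<close> up to a constant, so that \<open>w\<^sub>p = w - 1\<close> for
  points, and likewise for matrices as far as nonnegative values are concerned.
\<close>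

section \<open>Arithmetic of the p-adic norm\<close>

text \<open>The threshold n + 1 is the number of coordinates of the integer vectors, and it enters
  twice: about T^(n+1) of them have height at most T, which feeds the pigeonhole argument, and u
  \<ge> n + 1 makes the count of vectors with value at most d linear in d. Summing the lower bound
  |r(q)| \<ge> c |q|^(-u) term by term would lose a factor T^(n+1) and give convergence only for v >
  u + n + 1. By the ultrametric inequality the difference of two vectors with small values again has
  a small value, so such vectors are rare; only the logarithm from a harmonic sum is lost, and any
  gap v - u > 0 pays for it. In the comparison of w_p with w, the scaling divides the value by the
  p-adic norm of q. This turns Q^(-v) / H, where H is the real height and Q the product of both
  norms, into Q^(-v-1), up to a constant. The delicate direction leads from integral vectors back to
  Z[1/p], because H can be large while Q stays bounded.\<close>

lemma prime_card_gt_1: "real CARD('p::prime_card) > 1"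
  using p_gt_1[OF prime_card] .

lemma padic_norm_0 [simp]: "padic_norm (0 :: 'p::prime_card padic) = 0"
  by simp

lemma padic_norm_diff_max:
  "padic_norm (x - y :: 'p::prime_card padic) \<le> max (padic_norm x) (padic_norm y)"
  using padic_norm_add_max[of x "- y"] by simp

lemma padic_norm_sum_le:
  assumes "B \<ge> 0" "\<And>i. i \<in> S \<Longrightarrow> padic_norm (f i :: 'p::prime_card padic) \<le> B"
  shows "padic_norm (\<Sum>i\<in>S. f i) \<le> B"
  using assms(2)
proof (induction S rule: infinite_finite_induct)
  case (insert x S)
  then have "padic_norm (f x) \<le> B" "padic_norm (sum f S) \<le> B" by auto
  then show ?case
    using insert order_trans[OF padic_norm_add_max[of "f x" "sum f S"], of B] by simp
qed (use assms(1) in auto)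

lemma padic_abs_of_int:
  assumes "a \<noteq> 0"
  shows "padic_abs CARD('p::prime_card) (of_int a) = CARD('p) powi (- int (multiplicity (int CARD('p)) a))"
  using padic_abs_frac[OF prime_card assms, of 1, where 'a1 = 'p] by simp

lemma padic_abs_of_int_le:
  "padic_abs CARD('p::prime_card) (of_int a) \<le> inverse (real CARD('p) ^ k) \<longleftrightarrow> int CARD('p) ^ k dvd a"
proof (cases "a = 0")
  case False
  have "padic_abs CARD('p) (of_int a) = inverse (real CARD('p) ^ multiplicity (int CARD('p)) a)"
    unfolding padic_abs_of_int[OF False] by (simp add: power_int_minus)
  also have "\<dots> \<le> inverse (real CARD('p) ^ k) \<longleftrightarrow> k \<le> multiplicity (int CARD('p)) a"
    using prime_card_gt_1[where 'p='p] by simp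
  also have "\<dots> \<longleftrightarrow> int CARD('p) ^ k dvd a"
    using False prime_gt_1_nat[OF prime_card[where 'a='p]] by (intro power_dvd_iff_le_multiplicity[symmetric]) auto
  finally show ?thesis .
qed (simp add: padic_abs_0[OF prime_card])

lemma padic_abs_of_int_le_1: "padic_abs CARD('p::prime_card) (of_int a) \<le> 1"
  using padic_abs_of_int_le[of a 0, where 'p='p] by simp

lemma padic_norm_of_nat_le_1: "padic_norm (of_nat a :: 'p::prime_card padic) \<le> 1"
  using padic_norm_of_rat[of "of_int (int a)", where 'p='p] padic_abs_of_int_le_1[of "int a", where 'p='p]
  by simp

text \<open>The \<open>p\<close>-part of a nonzero integer divides it and so cannot exceed its
  absolute value. This keeps the translates of a slab apart and bounds the \<open>p\<close>-adic
  size of integral vectors from below.\<close>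

lemma padic_abs_of_int_ge:
  assumes "a \<noteq> 0"
  shows "1 \<le> padic_abs CARD('p::prime_card) (of_int a) * \<bar>of_int a\<bar>"
proof -
  let ?m = "multiplicity (int CARD('p)) a"
  have "int CARD('p) ^ ?m dvd a" by (simp add: multiplicity_dvd)
  then have "int CARD('p) ^ ?m \<le> \<bar>a\<bar>"
    using assms by (metis abs_ge_self dvd_abs_iff dvd_imp_le_int order_trans abs_of_nat of_nat_power)
  then have "real CARD('p) ^ ?m \<le> \<bar>of_int a\<bar>"
    by (metis of_int_abs of_int_le_iff of_int_of_nat_eq of_int_power)
  then show ?thesis
    unfolding padic_abs_of_int[OF assms] using prime_card_gt_1[where 'p='p]
    by (simp add: power_int_minus field_simps)
qed

lemma padic_abs_powi:
  "padic_abs CARD('p::prime_card) (of_nat CARD('p) powi e) = CARD('p) powi (- e)"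
proof -
  have p: "CARD('p) > 1" using prime_gt_1_nat[OF prime_card] .
  have nat: "padic_abs CARD('p) (of_nat CARD('p) ^ k) = inverse (real CARD('p) ^ k)" for k
    using padic_abs_of_int[of "int CARD('p) ^ k", where 'p='p] p
    by (simp add: power_int_minus multiplicity_same_power)
  show ?thesis
  proof (cases "e \<ge> 0")
    case True
    then show ?thesis using nat[of "nat e"] by (simp add: power_int_def power_inverse)
  next
    case False
    then show ?thesis using nat[of "nat (-e)"] p
      by (simp add: power_int_def padic_abs_inverse[OF prime_card] power_inverse)
  qed
qed

text \<open>For clearing a \<open>p\<close>-adic norm exactly by scaling with a power of
  \<open>p\<close>.\<close>

lemma padic_abs_eq_powi:
  assumes "x \<noteq> 0"
  obtains e :: int where "padic_abs CARD('p::prime_card) x = CARD('p) powi e"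
  using assms by (auto simp: padic_abs_def)

text \<open>This is Z[1/p] \<inter> Z_p = Z: the only prime in the denominator is \<open>p\<close>,
  and the norm bound makes it cancel. It recognises a scaled vector as integral.\<close>

lemma Z_inv_padic_integer:
  assumes "x \<in> Z_inv CARD('p::prime_card)" "padic_abs CARD('p) x \<le> 1"
  shows "x \<in> \<int>"
proof -
  obtain a k where x: "x = of_int a / of_nat CARD('p) ^ k"
    using assms(1) by (auto simp: Z_inv_def)
  have p: "CARD('p) > 1" using prime_gt_1_nat[OF prime_card] .
  then have a: "of_int a = x * of_nat CARD('p) powi (int k)"
    using x by simp
  have "padic_abs CARD('p) (of_int a) \<le> inverse (real CARD('p) ^ k)"
    unfolding a padic_abs_mult[OF prime_card] padic_abs_powi
    using assms(2) mult_right_mono[OF assms(2), of "inverse (real CARD('p) ^ k)"]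
    by (simp add: power_int_minus)
  then have "int CARD('p) ^ k dvd a"
    by (simp add: padic_abs_of_int_le)
  then obtain b where "a = int CARD('p) ^ k * b" by (auto elim: dvdE)
  then have "x = of_int b" using x p by simp
  then show ?thesis by simp
qed

lemma Z_inv_mult_powi:
  assumes "x \<in> Z_inv CARD('p::prime_card)"
  shows "of_nat CARD('p) powi e * x \<in> Z_inv CARD('p)"
proof -
  obtain a k where x: "x = of_int a / of_nat CARD('p) ^ k"
    using assms by (auto simp: Z_inv_def)
  have p: "CARD('p) > 1" using prime_gt_1_nat[OF prime_card] .
  show ?thesis
  proof (cases "e \<ge> 0")
    case True
    then have "of_nat CARD('p) powi e * x = of_int (int CARD('p) ^ nat e * a) / of_nat CARD('p) ^ k"
      using x by (simp add: power_int_def)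
    then show ?thesis unfolding Z_inv_def by blast
  next
    case False
    then have "of_nat CARD('p) powi e * x = of_int a / of_nat CARD('p) ^ (nat (- e) + k)"
      using x by (simp add: power_int_def field_simps power_add)
    then show ?thesis unfolding Z_inv_def by blast
  qed
qed

lemma Ints_subset_Z_inv: "x \<in> \<int> \<Longrightarrow> x \<in> Z_inv p"
  unfolding Z_inv_def by (force elim!: Ints_cases intro: exI[of _ "0::nat"])

text \<open>Truncation of the \<open>p\<close>-adic expansion after \<open>k\<close> digits,
  obtained by approximating \<open>x\<close> by a fraction \<open>b / c\<close> and reducing that
  modulo \<open>p ^ k\<close>. The finite range of \<open>a\<close> serves both the pigeonhole
  argument and the compactness of balls.\<close>

lemma padic_digit_approx:
  assumes "padic_norm (x :: 'p::prime_card padic) \<le> 1"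
  obtains a where "a < CARD('p) ^ k" "padic_norm (x - of_nat a) \<le> inverse (real CARD('p) ^ k)"
proof -
  let ?P = "CARD('p) ^ k"
  have p: "CARD('p) > 1" using prime_gt_1_nat[OF prime_card] .
  obtain r where r: "padic_norm (x - of_rat r) < inverse (real ?P)"
    using rat_dense_padic[of "inverse (real ?P)" x] p by (auto simp: dist_padic_def)
  have "padic_norm (of_rat r :: 'p padic) \<le> max (padic_norm x) (padic_norm (x - of_rat r))"
    using padic_norm_diff_max[of x "x - of_rat r"] by simp
  also have "\<dots> \<le> 1"
    using r assms p inverse_le_1_iff[of "real ?P"] by (auto simp del: inverse_le_1_iff)
  finally have r1: "padic_abs CARD('p) r \<le> 1" by simp
  obtain b c where bc: "quotient_of r = (b, c)" by fastforce
  have c: "c > 0" "coprime b c" "r = of_int b / of_int c"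
    using quotient_of_denom_pos[OF bc] quotient_of_coprime[OF bc] quotient_of_div[OF bc] by auto
  \<comment> \<open>If \<open>p\<close> divided \<open>c\<close>, it would not divide
    \<open>b\<close>; but |b| = |r| |c| \<le> 1 / p says that it does.\<close>
  have cop: "coprime c (int CARD('p))"
  proof (rule ccontr)
    assume "\<not> coprime c (int CARD('p))"
    then have "int CARD('p) dvd c"
      using prime_card_int[where 'a='p] by (meson coprime_commute prime_imp_coprime)
    then have nb: "\<not> int CARD('p) dvd b"
      using coprime_common_divisor[OF c(2), of "int CARD('p)"] p by auto
    have "of_int b = r * of_int c" using c by simp
    then have "padic_abs CARD('p) (of_int b) = padic_abs CARD('p) r * padic_abs CARD('p) (of_int c)"
      by (simp only: padic_abs_mult[OF prime_card])
    also have "\<dots> \<le> 1 * padic_abs CARD('p) (of_int c)"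
      by (intro mult_right_mono r1 padic_abs_nonneg[OF prime_card])
    also have "\<dots> \<le> inverse (real CARD('p) ^ 1)"
      using padic_abs_of_int_le[of c 1, where 'p='p] \<open>int CARD('p) dvd c\<close> by simp
    finally show False
      using nb padic_abs_of_int_le[of b 1, where 'p='p] by simp
  qed
  then have "coprime c (int ?P)" by simp
  then obtain d where d: "[c * d = 1] (mod int ?P)"
    using cong_solve_coprime_int by blast
  \<comment> \<open>The residue of \<open>b / c\<close>, as \<open>d\<close> inverts the denominator
    modulo \<open>p ^ k\<close>.\<close>
  define a where "a = nat ((d * b) mod int ?P)"
  have a: "int a = (d * b) mod int ?P" "a < ?P"
    using p unfolding a_def by (auto simp: nat_less_iff)
  have "[c * int a = (c * d) * b] (mod int ?P)"
    unfolding a by (simp add: cong_def mod_mult_right_eq mult.assoc)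
  also have "[(c * d) * b = 1 * b] (mod int ?P)"
    by (rule cong_mult[OF d cong_refl])
  finally have dv: "int CARD('p) ^ k dvd b - c * int a"
    by (simp add: cong_iff_dvd_diff dvd_diff_commute)
  have c1: "padic_abs CARD('p) (of_int c) = 1"
  proof -
    have "\<not> int CARD('p) dvd c"
      using coprime_common_divisor[OF cop, of "int CARD('p)"] p by auto
    then have "multiplicity (int CARD('p)) c = 0" by (rule not_dvd_imp_multiplicity_0)
    then show ?thesis using padic_abs_of_int[of c, where 'p='p] c by simp
  qed
  \<comment> \<open>\<open>c\<close> is a \<open>p\<close>-adic unit, so multiplying by it clears
    the denominator at no cost.\<close>
  have "padic_abs CARD('p) (r - of_int (int a)) = padic_abs CARD('p) (r - of_int (int a)) * padic_abs CARD('p) (of_int c)"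
    using c1 by simp
  also have "\<dots> = padic_abs CARD('p) (of_int (b - c * int a))"
    unfolding padic_abs_mult[OF prime_card, symmetric] using c by (simp add: field_simps)
  also have "\<dots> \<le> inverse (real CARD('p) ^ k)"
    using dv padic_abs_of_int_le[of "b - c * int a" k, where 'p='p] by simp
  finally have ra: "padic_norm (of_rat (r - of_int (int a)) :: 'p padic) \<le> inverse (real CARD('p) ^ k)"
    by simp
  have "x - of_nat a = (x - of_rat r) + of_rat (r - of_int (int a))"
    by (simp add: of_rat_diff)
  also have "padic_norm \<dots> \<le> max (padic_norm (x - of_rat r)) (padic_norm (of_rat (r - of_int (int a)) :: 'p padic))"
    by (rule padic_norm_add_max)
  also have "\<dots> \<le> inverse (real CARD('p) ^ k)"
    using r ra by simp
  finally have "padic_norm (x - of_nat a) \<le> inverse (real CARD('p) ^ k)" .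
  with a(2) show ?thesis by (rule that)
qed

section \<open>Systems of approximate linear equations\<close>

declare padic_abs_nonneg[OF prime_card, simp] padic_abs_0[OF prime_card, simp] padic_abs_1[OF prime_card, simp]

lemma real_of_rat_abs_of_int: "real_of_rat \<bar>of_int a\<bar> = \<bar>of_int a\<bar>"
  by (metis of_int_abs of_rat_of_int_eq)

section \<open>Maximum norms of vectors\<close>

lemma padic_maxnorm_le_iff:
  "finite I \<Longrightarrow> I \<noteq> {} \<Longrightarrow> padic_maxnorm I y \<le> B \<longleftrightarrow> (\<forall>i\<in>I. padic_norm (y i) \<le> B)"
  by (simp add: padic_maxnorm_def)

lemma padic_maxnorm_ge: "finite I \<Longrightarrow> i \<in> I \<Longrightarrow> padic_norm (y i) \<le> padic_maxnorm I y"
  by (simp add: padic_maxnorm_def)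

lemma padic_maxnorm_attained:
  assumes "finite I" "I \<noteq> {}"
  obtains i where "i \<in> I" "padic_maxnorm I y = padic_norm (y i)"
proof -
  have "padic_maxnorm I y \<in> (\<lambda>i. padic_norm (y i)) ` I"
    unfolding padic_maxnorm_def using assms by (intro Max_in) auto
  then show ?thesis using that by auto
qed

lemma padic_maxnorm_nonneg: "finite I \<Longrightarrow> I \<noteq> {} \<Longrightarrow> padic_maxnorm I y \<ge> 0"
  using padic_maxnorm_attained[of I y] by (metis padic_norm_nonneg)

lemma padic_maxnorm_mult:
  assumes "finite I" "I \<noteq> {}"
  shows "padic_maxnorm I (\<lambda>i. c * y i) = padic_norm c * padic_maxnorm I y"
proof (rule antisym)
  show "padic_maxnorm I (\<lambda>i. c * y i) \<le> padic_norm c * padic_maxnorm I y"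
    using assms by (simp add: padic_maxnorm_le_iff padic_norm_mult mult_left_mono padic_maxnorm_ge)
  obtain i where "i \<in> I" "padic_maxnorm I y = padic_norm (y i)"
    using padic_maxnorm_attained[OF assms] .
  then show "padic_norm c * padic_maxnorm I y \<le> padic_maxnorm I (\<lambda>i. c * y i)"
    using padic_maxnorm_ge[of I i "\<lambda>i. c * y i"] assms by (simp add: padic_norm_mult)
qed

lemma padic_maxnorm_cong: "(\<And>i. i \<in> I \<Longrightarrow> y i = z i) \<Longrightarrow> padic_maxnorm I y = padic_maxnorm I z"
  unfolding padic_maxnorm_def by (intro arg_cong[of _ _ Max] image_cong) auto

lemma real_maxnorm_le_iff:
  "finite I \<Longrightarrow> I \<noteq> {} \<Longrightarrow> real_maxnorm I q \<le> B \<longleftrightarrow> (\<forall>i\<in>I. real_of_rat \<bar>q i\<bar> \<le> B)"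
  by (simp add: real_maxnorm_def)

lemma real_maxnorm_ge: "finite I \<Longrightarrow> i \<in> I \<Longrightarrow> real_of_rat \<bar>q i\<bar> \<le> real_maxnorm I q"
  by (simp add: real_maxnorm_def)

lemma real_maxnorm_attained:
  assumes "finite I" "I \<noteq> {}"
  obtains i where "i \<in> I" "real_maxnorm I q = real_of_rat \<bar>q i\<bar>"
proof -
  have "real_maxnorm I q \<in> (\<lambda>i. real_of_rat \<bar>q i\<bar>) ` I"
    unfolding real_maxnorm_def using assms by (intro Max_in) auto
  then show ?thesis using that by auto
qed

lemma real_maxnorm_nonneg: "finite I \<Longrightarrow> I \<noteq> {} \<Longrightarrow> real_maxnorm I q \<ge> 0"
  using real_maxnorm_attained[of I q] by (metis abs_ge_zero zero_le_of_rat_iff)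

lemma real_maxnorm_cong: "(\<And>i. i \<in> I \<Longrightarrow> y i = z i) \<Longrightarrow> real_maxnorm I y = real_maxnorm I z"
  unfolding real_maxnorm_def by (intro arg_cong[of _ _ Max] image_cong) auto

lemma real_maxnorm_mult:
  assumes "finite I" "I \<noteq> {}"
  shows "real_maxnorm I (\<lambda>i. c * q i) = real_of_rat \<bar>c\<bar> * real_maxnorm I q"
proof (rule antisym)
  show "real_maxnorm I (\<lambda>i. c * q i) \<le> real_of_rat \<bar>c\<bar> * real_maxnorm I q"
    using assms
    by (simp add: real_maxnorm_le_iff abs_mult of_rat_mult mult_left_mono real_maxnorm_ge)
  obtain i where "i \<in> I" "real_maxnorm I q = real_of_rat \<bar>q i\<bar>"
    using real_maxnorm_attained[OF assms] .
  then show "real_of_rat \<bar>c\<bar> * real_maxnorm I q \<le> real_maxnorm I (\<lambda>i. c * q i)"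
    using real_maxnorm_ge[of I i "\<lambda>i. c * q i"] assms by (simp add: abs_mult of_rat_mult)
qed

lemma real_maxnorm_Un:
  assumes "finite I" "I \<noteq> {}" "finite J" "J \<noteq> {}"
  shows "real_maxnorm (I \<union> J) q = max (real_maxnorm I q) (real_maxnorm J q)"
  unfolding real_maxnorm_def image_Un using assms by (intro Max_Un) auto

lemma real_maxnorm_ge_1:
  assumes "finite K" "K \<noteq> {}" "\<forall>i\<in>K. q i \<in> \<int>" "real_maxnorm K q > 0"
  shows "real_maxnorm K q \<ge> 1"
proof -
  obtain i where i: "i \<in> K" "real_maxnorm K q = real_of_rat \<bar>q i\<bar>"
    using real_maxnorm_attained[OF assms(1,2)] .
  then obtain a where "q i = of_int a" using assms(3) by (auto elim: Ints_cases)
  with i assms(4) show ?thesis by simp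
qed

lemma padic_maxnorm_le_1:
  assumes "finite J" "J \<noteq> {}" "\<forall>i\<in>J. q i \<in> \<int>"
  shows "padic_maxnorm J (\<lambda>j. of_rat (q j) :: 'p::prime_card padic) \<le> 1"
  using assms by (auto simp: padic_maxnorm_le_iff padic_abs_of_int_le_1 elim!: Ints_cases)

lemma finite_integer_vectors:
  assumes "finite K" "K \<noteq> {}"
  shows "finite {q \<in> K \<rightarrow>\<^sub>E \<int>. real_maxnorm K q \<le> N}"
proof (rule finite_subset)
  show "{q \<in> K \<rightarrow>\<^sub>E \<int>. real_maxnorm K q \<le> N} \<subseteq> K \<rightarrow>\<^sub>E (of_int ` {-\<lceil>N\<rceil>..\<lceil>N\<rceil>})"
  proof (intro subsetI PiE_I)
    fix q i assume q: "q \<in> {q \<in> K \<rightarrow>\<^sub>E \<int>. real_maxnorm K q \<le> N}" and i: "i \<in> K"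
    then obtain a where a: "q i = of_int a" by (auto elim!: PiE_E Ints_cases)
    have "\<bar>of_int a\<bar> \<le> N"
      using real_maxnorm_ge[OF assms(1) i, of q] q unfolding a real_of_rat_abs_of_int by simp
    then have "a \<in> {-\<lceil>N\<rceil>..\<lceil>N\<rceil>}"
      by (auto simp: abs_le_iff le_ceiling_iff) linarith+
    then show "q i \<in> of_int ` {-\<lceil>N\<rceil>..\<lceil>N\<rceil>}" using a by auto
  qed auto
qed (use assms in \<open>auto intro: finite_PiE\<close>)

text \<open>One vector \<open>q\<close> carries both blocks: its entries on \<open>I\<close> are the
  shift q_0, those on \<open>J\<close> the argument of \<open>A\<close>. A single point is the case
  \<open>I = {0}\<close> with constant rows, so that points and matrices share the lemmas.\<close>

definition lin_norm ::
  "nat set \<Rightarrow> nat set \<Rightarrow> (nat \<Rightarrow> nat \<Rightarrow> 'p::prime_card padic) \<Rightarrow> (nat \<Rightarrow> rat) \<Rightarrow> real" where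
  "lin_norm I J A q = padic_maxnorm I (\<lambda>i. (\<Sum>j\<in>J. A i j * of_rat (q j)) + of_rat (q i))"

lemma lin_norm_cong: "(\<And>i. i \<in> I \<union> J \<Longrightarrow> q i = r i) \<Longrightarrow> lin_norm I J A q = lin_norm I J A r"
  unfolding lin_norm_def by (intro padic_maxnorm_cong) auto

lemma lin_norm_nonneg: "finite I \<Longrightarrow> I \<noteq> {} \<Longrightarrow> lin_norm I J A q \<ge> 0"
  unfolding lin_norm_def by (rule padic_maxnorm_nonneg)

lemma lin_norm_mult:
  fixes A :: "nat \<Rightarrow> nat \<Rightarrow> 'p::prime_card padic"
  assumes "finite I" "I \<noteq> {}"
  shows "lin_norm I J A (\<lambda>i. c * q i) = padic_abs CARD('p) c * lin_norm I J A q"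
proof -
  have "(\<lambda>i. (\<Sum>j\<in>J. A i j * of_rat (c * q j)) + of_rat (c * q i))
      = (\<lambda>i. of_rat c * ((\<Sum>j\<in>J. A i j * of_rat (q j)) + of_rat (q i)))"
    by (simp add: of_rat_mult sum_distrib_left algebra_simps)
  then show ?thesis
    using padic_maxnorm_mult[OF assms, of "of_rat c :: 'p padic"] by (simp add: lin_norm_def)
qed

lemma lin_norm_diff:
  assumes "finite I" "I \<noteq> {}"
  shows "lin_norm I J A (\<lambda>i. q i - r i) \<le> max (lin_norm I J A q) (lin_norm I J A r)"
proof -
  let ?f = "\<lambda>q i. (\<Sum>j\<in>J. A i j * of_rat (q j)) + of_rat (q i)"
  have "padic_norm (?f (\<lambda>i. q i - r i) i) \<le> max (lin_norm I J A q) (lin_norm I J A r)" if "i \<in> I" for i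
  proof -
    have "?f (\<lambda>i. q i - r i) i = ?f q i - ?f r i"
      by (simp add: of_rat_diff algebra_simps sum_subtractf)
    also have "padic_norm \<dots> \<le> max (padic_norm (?f q i)) (padic_norm (?f r i))"
      by (rule padic_norm_diff_max)
    also have "\<dots> \<le> max (lin_norm I J A q) (lin_norm I J A r)"
      unfolding lin_norm_def using assms that
      by (intro max.mono padic_maxnorm_ge[where y = "?f _"])
    finally show ?thesis .
  qed
  then show ?thesis
    using assms by (simp add: lin_norm_def[of I J A "\<lambda>i. q i - r i"] padic_maxnorm_le_iff)
qed

text \<open>Solve the \<open>i\<close>-th equation for \<open>q i\<close>. This controls the entries
  on \<open>I\<close> by those on \<open>J\<close>, the only ones whose \<open>p\<close>-adic norm
  enters the exponents.\<close>

lemma padic_abs_le_lin_norm: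
  fixes A :: "nat \<Rightarrow> nat \<Rightarrow> 'p::prime_card padic"
  assumes "finite I" "i \<in> I" "finite J" "J \<noteq> {}" "\<forall>i\<in>I. \<forall>j\<in>J. padic_norm (A i j) \<le> P"
  shows "padic_abs CARD('p) (q i)
    \<le> max (lin_norm I J A q) (P * padic_maxnorm J (\<lambda>j. of_rat (q j) :: 'p padic))"
proof -
  let ?S = "\<Sum>j\<in>J. A i j * of_rat (q j)"
  obtain j where "j \<in> J" using assms(4) by auto
  then have P: "P \<ge> 0"
    using assms(2,5) order_trans[OF padic_norm_nonneg] by blast
  have nn: "0 \<le> P * padic_maxnorm J (\<lambda>j. of_rat (q j) :: 'p padic)"
    using P padic_maxnorm_nonneg[OF assms(3,4)] by (rule mult_nonneg_nonneg)
  have "padic_norm (of_rat (q i) :: 'p padic) = padic_norm ((?S + of_rat (q i)) - ?S)"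
    by simp
  also have "\<dots> \<le> max (padic_norm (?S + of_rat (q i))) (padic_norm ?S)"
    by (rule padic_norm_diff_max)
  also have "\<dots> \<le> max (lin_norm I J A q) (P * padic_maxnorm J (\<lambda>j. of_rat (q j) :: 'p padic))"
  proof (intro max.mono)
    show "padic_norm (?S + of_rat (q i)) \<le> lin_norm I J A q"
      unfolding lin_norm_def using assms
      by (intro padic_maxnorm_ge[where y = "\<lambda>i. (\<Sum>j\<in>J. A i j * of_rat (q j)) + of_rat (q i)"])
    show "padic_norm ?S \<le> P * padic_maxnorm J (\<lambda>j. of_rat (q j) :: 'p padic)"
    proof (rule padic_norm_sum_le[OF nn])
      fix j assume "j \<in> J"
      then show "padic_norm (A i j * of_rat (q j)) \<le> P * padic_maxnorm J (\<lambda>j. of_rat (q j) :: 'p padic)"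
        unfolding padic_norm_mult using assms P
        by (intro mult_mono padic_maxnorm_ge[where y = "\<lambda>j. of_rat (q j)"]) auto
    qed
  qed
  finally show ?thesis by simp
qed

text \<open>The bound is a power of \<open>p\<close> so that it can be built into the scaling factor
  of \<open>padic_normalise\<close>.\<close>

lemma obtain_coefficient_bound:
  fixes A :: "nat \<Rightarrow> nat \<Rightarrow> 'p::prime_card padic"
  assumes "finite I" "finite J"
  obtains M :: nat where "\<forall>i\<in>I. \<forall>j\<in>J. padic_norm (A i j) \<le> real CARD('p) ^ M"
proof -
  let ?B = "Max (insert 0 ((\<lambda>(i,j). padic_norm (A i j)) ` (I \<times> J)))"
  obtain M where M: "?B < real CARD('p) ^ M"
    using real_arch_pow[OF prime_card_gt_1] by blast
  have "padic_norm (A i j) \<le> real CARD('p) ^ M" if "i \<in> I" "j \<in> J" for i j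
  proof -
    have "padic_norm (A i j) \<le> ?B"
      using assms that by (intro Max_ge) (auto intro!: image_eqI[of _ _ "(i,j)"])
    with M show ?thesis by simp
  qed
  then show ?thesis using that by blast
qed

section \<open>Approximation by integral vectors\<close>

text \<open>Unbounded height replaces infinitude, and \<open>q\<close> may take any values outside
  \<open>K\<close>, so that scaled vectors are admissible as they stand.\<close>

definition int_approx :: "nat set \<Rightarrow> ((nat \<Rightarrow> rat) \<Rightarrow> real) \<Rightarrow> real \<Rightarrow> bool" where
  "int_approx K \<eta> v \<longleftrightarrow>
     (\<forall>N. \<exists>q. (\<forall>i\<in>K. q i \<in> \<int>) \<and> N < real_maxnorm K q \<and> \<eta> q \<le> real_maxnorm K q powr (- v))"

text \<open>Only finitely many integral vectors have bounded height, so an infinite set of them is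
  one of unbounded height.\<close>

lemma infinite_iff_int_approx:
  assumes K: "finite K" "K \<noteq> {}" and \<eta>: "\<And>q. \<eta> (restrict q K) = \<eta> q"
  shows "infinite {q \<in> K \<rightarrow>\<^sub>E \<int>. \<eta> q \<le> real_maxnorm K q powr (- v)} \<longleftrightarrow> int_approx K \<eta> v"
    (is "infinite ?S \<longleftrightarrow> _")
proof
  assume inf: "infinite ?S"
  show "int_approx K \<eta> v"
    unfolding int_approx_def
  proof
    fix N
    have "\<not> ?S \<subseteq> {q \<in> K \<rightarrow>\<^sub>E \<int>. real_maxnorm K q \<le> N}"
      using inf finite_integer_vectors[OF K] finite_subset by blast
    then obtain q where "q \<in> ?S" "\<not> real_maxnorm K q \<le> N" by blast
    then show "\<exists>q. (\<forall>i\<in>K. q i \<in> \<int>) \<and> N < real_maxnorm K q \<and> \<eta> q \<le> real_maxnorm K q powr (- v)"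
      by (intro exI[of _ q]) auto
  qed
next
  assume app: "int_approx K \<eta> v"
  show "infinite ?S"
  proof
    assume fin: "finite ?S"
    then have "bdd_above (real_maxnorm K ` ?S)" by (intro bdd_above_finite finite_imageI)
    then obtain N where N: "\<forall>q\<in>?S. real_maxnorm K q \<le> N"
      unfolding bdd_above_def by blast
    obtain q where q: "\<forall>i\<in>K. q i \<in> \<int>" "N < real_maxnorm K q" "\<eta> q \<le> real_maxnorm K q powr (- v)"
      using app unfolding int_approx_def by blast
    have *: "real_maxnorm K (restrict q K) = real_maxnorm K q"
      by (intro real_maxnorm_cong) auto
    have "restrict q K \<in> ?S" using q by (auto simp: * \<eta>)
    then have "real_maxnorm K q \<le> N" using N * by metis
    with q(2) show False by simp
  qed
qed

lemma int_approx_mono: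
  assumes "finite K" "K \<noteq> {}" "int_approx K \<eta> v" "u \<le> v"
  shows "int_approx K \<eta> u"
  unfolding int_approx_def
proof
  fix N
  \<comment> \<open>Heights above 1 make the power monotone in its exponent.\<close>
  obtain q where q: "\<forall>i\<in>K. q i \<in> \<int>" "max N 1 < real_maxnorm K q" "\<eta> q \<le> real_maxnorm K q powr (- v)"
    using assms(3) unfolding int_approx_def by blast
  then have "real_maxnorm K q powr (- v) \<le> real_maxnorm K q powr (- u)"
    using assms(4) by (intro powr_mono) auto
  with q have "\<eta> q \<le> real_maxnorm K q powr (- u)" by linarith
  with q show "\<exists>q. (\<forall>i\<in>K. q i \<in> \<int>) \<and> N < real_maxnorm K q \<and> \<eta> q \<le> real_maxnorm K q powr (- u)"
    by (intro exI[of _ q]) auto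
qed

text \<open>The integer multiples of a nonzero exact solution have value 0 and unbounded height, so
  they serve for every exponent.\<close>

lemma int_approx_zero:
  fixes A :: "nat \<Rightarrow> nat \<Rightarrow> 'p::prime_card padic"
  assumes I: "finite I" "I \<noteq> {}" and J: "finite J"
    and q: "\<forall>i\<in>I \<union> J. q i \<in> \<int>" "real_maxnorm (I \<union> J) q > 0" "lin_norm I J A q = 0"
  shows "int_approx (I \<union> J) (lin_norm I J A) v"
  unfolding int_approx_def
proof
  fix N
  let ?K = "I \<union> J"
  have K: "finite ?K" "?K \<noteq> {}" using I J by auto
  obtain m :: nat where m: "N < of_nat m * real_maxnorm ?K q"
    using reals_Archimedean3[OF q(2)] by blast
  have "real_maxnorm ?K (\<lambda>i. of_nat m * q i) = of_nat m * real_maxnorm ?K q"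
    using real_maxnorm_mult[OF K, of "of_nat m" q] by simp
  moreover have "lin_norm I J A (\<lambda>i. of_nat m * q i) = 0"
    using lin_norm_mult[OF I, of J A "of_nat m" q] q by simp
  ultimately show "\<exists>q. (\<forall>i\<in>?K. q i \<in> \<int>) \<and> N < real_maxnorm ?K q \<and>
      lin_norm I J A q \<le> real_maxnorm ?K q powr (- v)"
    using q m by (intro exI[of _ "\<lambda>i. of_nat m * q i"]) auto
qed

lemma integer_vectors_lower_bound:
  assumes K: "finite K" "K \<noteq> {}" and \<eta>: "\<And>q. \<eta> (restrict q K) = \<eta> q"
    and pos: "\<And>q. \<forall>i\<in>K. q i \<in> \<int> \<Longrightarrow> real_maxnorm K q > 0 \<Longrightarrow> \<eta> q > 0"
  obtains c :: real where "c > 0"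
    "\<And>q. \<forall>i\<in>K. q i \<in> \<int> \<Longrightarrow> real_maxnorm K q > 0 \<Longrightarrow> real_maxnorm K q \<le> R \<Longrightarrow> c \<le> \<eta> q"
proof -
  let ?F = "{q \<in> K \<rightarrow>\<^sub>E \<int>. real_maxnorm K q \<le> R} \<inter> {q. real_maxnorm K q > 0}"
  \<comment> \<open>The 1 keeps the minimum meaningful when there is no such vector.\<close>
  let ?c = "Min (insert 1 (\<eta> ` ?F))"
  have fin: "finite (insert 1 (\<eta> ` ?F))"
    using finite_integer_vectors[OF K] by auto
  show ?thesis
  proof (rule that)
    show "?c > 0"
      using fin pos by (subst Min_gr_iff) (auto simp: PiE_iff)
    fix q assume q: "\<forall>i\<in>K. q i \<in> \<int>" "real_maxnorm K q > 0" "real_maxnorm K q \<le> R"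
    have "real_maxnorm K (restrict q K) = real_maxnorm K q"
      by (intro real_maxnorm_cong) auto
    then have "restrict q K \<in> ?F" using q by auto
    then have "?c \<le> \<eta> (restrict q K)"
      using fin by (intro Min_le) auto
    then show "?c \<le> \<eta> q" by (simp add: \<eta>)
  qed
qed

lemma lin_norm_restrict: "lin_norm I J A (restrict q (I \<union> J)) = lin_norm I J A q"
  by (rule lin_norm_cong) auto

text \<open>Beyond some height the failure of approximation gives the bound with constant 1. The
  finitely many lower vectors have a positive minimum, because an exact zero would give
  approximation of every order.\<close>

lemma not_int_approx_lower_bound:
  fixes A :: "nat \<Rightarrow> nat \<Rightarrow> 'p::prime_card padic"
  assumes I: "finite I" "I \<noteq> {}" and J: "finite J" and v: "v \<ge> 0"
    and na: "\<not> int_approx (I \<union> J) (lin_norm I J A) v"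
  obtains c :: real where "c > 0"
    "\<And>q. \<forall>i\<in>I \<union> J. q i \<in> \<int> \<Longrightarrow> real_maxnorm (I \<union> J) q > 0
       \<Longrightarrow> c * real_maxnorm (I \<union> J) q powr (- v) \<le> lin_norm I J A q"
proof -
  let ?K = "I \<union> J"
  have K: "finite ?K" "?K \<noteq> {}" using I J by auto
  have pos: "lin_norm I J A q > 0" if "\<forall>i\<in>?K. q i \<in> \<int>" "real_maxnorm ?K q > 0" for q
  proof -
    have "lin_norm I J A q \<noteq> 0" using int_approx_zero[OF I J that] na by blast
    with lin_norm_nonneg[OF I, of J A q] show ?thesis by simp
  qed
  obtain N where N: "\<And>q. \<forall>i\<in>?K. q i \<in> \<int> \<Longrightarrow> N < real_maxnorm ?K q
      \<Longrightarrow> real_maxnorm ?K q powr (- v) < lin_norm I J A q"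
  proof -
    from na obtain N where "\<not> (\<exists>q. (\<forall>i\<in>?K. q i \<in> \<int>) \<and> N < real_maxnorm ?K q
        \<and> lin_norm I J A q \<le> real_maxnorm ?K q powr (- v))"
      unfolding int_approx_def by blast
    then show ?thesis using that[of N] by (meson not_le)
  qed
  obtain c where c: "c > 0" "\<And>q. \<forall>i\<in>?K. q i \<in> \<int> \<Longrightarrow> real_maxnorm ?K q > 0
      \<Longrightarrow> real_maxnorm ?K q \<le> N \<Longrightarrow> c \<le> lin_norm I J A q"
    by (rule integer_vectors_lower_bound[of ?K "lin_norm I J A" N])
      (use K pos in \<open>simp_all add: lin_norm_restrict\<close>)
  show ?thesis
  proof (rule that[of "min 1 c"])
    fix q assume q: "\<forall>i\<in>?K. q i \<in> \<int>" "real_maxnorm ?K q > 0"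
    let ?X = "real_maxnorm ?K q powr (- v)"
    have X: "0 \<le> ?X" "?X \<le> 1"
      using real_maxnorm_ge_1[OF K q] v powr_mono[of "-v" 0 "real_maxnorm ?K q"] by auto
    show "min 1 c * ?X \<le> lin_norm I J A q"
    proof (cases "real_maxnorm ?K q \<le> N")
      case True
      then have "c \<le> lin_norm I J A q" using c(2) q by blast
      moreover have "min 1 c * ?X \<le> c * 1" using X c(1) by (intro mult_mono) auto
      ultimately show ?thesis by simp
    next
      case False
      then have "?X < lin_norm I J A q" using N q by force
      moreover have "min 1 c * ?X \<le> 1 * ?X" using X by (intro mult_right_mono) auto
      ultimately show ?thesis by simp
    qed
  qed (use c in auto)
qed

section \<open>Passing between Z[1/p] and Z\<close>

text \<open>\<open>R\<close> is \<open><\<close> in the exponent of a point and \<open>\<le>\<close>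
  in that of a matrix.\<close>

definition pinv_approx ::
  "(real \<Rightarrow> real \<Rightarrow> bool) \<Rightarrow> nat set \<Rightarrow> nat set \<Rightarrow> (nat \<Rightarrow> nat \<Rightarrow> 'p::prime_card padic) \<Rightarrow> real \<Rightarrow> bool" where
  "pinv_approx R I J A v \<longleftrightarrow>
     (\<forall>N. \<exists>q. (\<forall>i\<in>I \<union> J. q i \<in> Z_inv CARD('p)) \<and>
       (let H = real_maxnorm (I \<union> J) q;
            Q = padic_maxnorm J (\<lambda>j. of_rat (q j) :: 'p padic) * H
        in N < Q \<and> R (lin_norm I J A q) (Q powr (- v) * inverse H)))"

text \<open>Scaling by a power of \<open>p\<close> multiplies the real height by the same factor by
  which it divides \<open>p\<close>-adic norms. Taking the norm of the \<open>J\<close>-part as the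
  factor makes the product of the two norms the new height; the additional \<open>p ^ M\<close>
  makes the entries on \<open>I\<close> integral as well.\<close>

lemma padic_normalise:
  fixes A :: "nat \<Rightarrow> nat \<Rightarrow> 'p::prime_card padic"
  defines "Q \<equiv> \<lambda>J q. padic_maxnorm J (\<lambda>j. of_rat (q j) :: 'p padic)"
  assumes I: "finite I" "I \<noteq> {}" and J: "finite J" "J \<noteq> {}"
    and A: "\<forall>i\<in>I. \<forall>j\<in>J. padic_norm (A i j) \<le> real CARD('p) ^ M"
    and q: "\<forall>i\<in>I \<union> J. q i \<in> Z_inv CARD('p)" "Q J q > 0" "lin_norm I J A q \<le> Q J q"
  obtains r where "\<forall>i\<in>I \<union> J. r i \<in> \<int>"
    "real_maxnorm (I \<union> J) r = real CARD('p) ^ M * (Q J q * real_maxnorm (I \<union> J) q)"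
    "lin_norm I J A r = lin_norm I J A q / (real CARD('p) ^ M * Q J q)"
proof -
  let ?p = "real CARD('p)"
  have p: "?p > 1" by (rule prime_card_gt_1)
  have K: "finite (I \<union> J)" "I \<union> J \<noteq> {}" using I J by auto
  obtain j where j: "j \<in> J" "Q J q = padic_abs CARD('p) (q j)"
    using padic_maxnorm_attained[OF J, of "\<lambda>j. of_rat (q j) :: 'p padic"] unfolding Q_def by auto
  then have "q j \<noteq> 0" using q(2) by auto
  then obtain e where e: "Q J q = ?p powi e"
    using padic_abs_eq_powi[where 'p='p] j(2) by metis
  define c :: rat where "c = of_nat CARD('p) powi (int M + e)"
  have pM: "?p powi (int M + e) = ?p ^ M * Q J q"
    using p e by (simp add: power_int_add)
  have cabs: "padic_abs CARD('p) c = inverse (?p ^ M * Q J q)"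
    unfolding c_def padic_abs_powi pM[symmetric] by (rule power_int_minus)
  have creal: "real_of_rat \<bar>c\<bar> = ?p ^ M * Q J q"
    unfolding c_def pM[symmetric] by (simp add: power_int_def of_rat_power of_rat_inverse)
  have M1: "?p ^ M \<ge> 1" using p by simp
  show ?thesis
  proof (rule that[of "\<lambda>i. c * q i"])
    show "\<forall>i\<in>I \<union> J. c * q i \<in> \<int>"
    proof
      fix i assume i: "i \<in> I \<union> J"
      have "padic_abs CARD('p) (q i) \<le> ?p ^ M * Q J q"
      proof (cases "i \<in> J")
        case True
        then have "padic_abs CARD('p) (q i) \<le> 1 * Q J q"
          using padic_maxnorm_ge[OF J(1), of i "\<lambda>j. of_rat (q j) :: 'p padic"] by (simp add: Q_def)
        also have "\<dots> \<le> ?p ^ M * Q J q" using M1 q(2) by (intro mult_right_mono) auto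
        finally show ?thesis .
      next
        case False
        then have "padic_abs CARD('p) (q i) \<le> max (lin_norm I J A q) (?p ^ M * Q J q)"
          using padic_abs_le_lin_norm[OF I(1) _ J A, of i q] i by (auto simp: Q_def)
        moreover have "1 * Q J q \<le> ?p ^ M * Q J q"
          using M1 q(2) by (intro mult_right_mono) auto
        ultimately have "padic_abs CARD('p) (q i) \<le> max (?p ^ M * Q J q) (?p ^ M * Q J q)"
          using q(3) by linarith
        then show ?thesis by simp
      qed
      then have "padic_abs CARD('p) (c * q i) \<le> 1"
        using q(2) p by (simp add: padic_abs_mult[OF prime_card] cabs field_simps)
      moreover have "c * q i \<in> Z_inv CARD('p)"
        unfolding c_def using q(1) i by (intro Z_inv_mult_powi) auto
      ultimately show "c * q i \<in> \<int>" by (intro Z_inv_padic_integer)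
    qed
    show "real_maxnorm (I \<union> J) (\<lambda>i. c * q i) = ?p ^ M * (Q J q * real_maxnorm (I \<union> J) q)"
      using real_maxnorm_mult[OF K, of c q] creal by simp
    show "lin_norm I J A (\<lambda>i. c * q i) = lin_norm I J A q / (?p ^ M * Q J q)"
      using lin_norm_mult[OF I, of J A c q] cabs by (simp add: field_simps)
  qed
qed

text \<open>Normalising divides the value by \<open>P * a\<close>, and 1 / (a H) = 1 / Q is where
  the exponent gains 1. For large Q the spare exponent v + 1 - u > 0 outweighs the constant
  \<open>P\<close>.\<close>

lemma pinv_approx_imp_int_approx:
  fixes A :: "nat \<Rightarrow> nat \<Rightarrow> 'p::prime_card padic"
  assumes I: "finite I" "I \<noteq> {}" and J: "finite J" "J \<noteq> {}"
    and v: "v \<ge> 0" "u < v + 1" and app: "pinv_approx (\<le>) I J A v"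
  shows "int_approx (I \<union> J) (lin_norm I J A) u"
  unfolding int_approx_def
proof
  fix N
  let ?K = "I \<union> J" and ?p = "real CARD('p)"
  have p: "?p > 1" by (rule prime_card_gt_1)
  obtain M where M: "\<forall>i\<in>I. \<forall>j\<in>J. padic_norm (A i j) \<le> ?p ^ M"
    using obtain_coefficient_bound[OF I(1) J(1)] by blast
  define P where "P = ?p ^ M"
  have P: "P \<ge> 1" unfolding P_def using p by simp
  have "((\<lambda>x::real. x powr (u - v - 1)) \<longlongrightarrow> 0) at_top"
    using v by (intro tendsto_neg_powr filterlim_ident) auto
  then have "eventually (\<lambda>x::real. x powr (u - v - 1) < P powr (- u)) at_top"
    using P by (intro order_tendstoD) auto
  then obtain L where L: "\<And>x. x \<ge> L \<Longrightarrow> x powr (u - v - 1) < P powr (- u)"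
    by (auto simp: eventually_at_top_linorder)
  obtain q where q: "\<forall>i\<in>?K. q i \<in> Z_inv CARD('p)"
    and *: "let H = real_maxnorm ?K q; Q = padic_maxnorm J (\<lambda>j. of_rat (q j) :: 'p padic) * H
        in max (max 1 N) L < Q \<and> lin_norm I J A q \<le> Q powr (- v) * inverse H"
    using app unfolding pinv_approx_def by blast
  define H where "H = real_maxnorm ?K q"
  define a where "a = padic_maxnorm J (\<lambda>j. of_rat (q j) :: 'p padic)"
  define Q where "Q = a * H"
  have Q: "Q > 1" "Q > N" "Q > L" and lin: "lin_norm I J A q \<le> Q powr (- v) * inverse H"
    using * by (simp_all add: Let_def H_def a_def Q_def)
  have "a \<ge> 0" "H \<ge> 0"
    unfolding a_def H_def using I J by (auto intro: padic_maxnorm_nonneg real_maxnorm_nonneg)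
  then have a: "a > 0" and H: "H > 0"
    using Q unfolding Q_def by (auto simp: less_le)
  \<comment> \<open>\<open>Q > 1\<close> bounds the value by 1 / H and also gives 1 / H \<le> a, as
    \<open>padic_normalise\<close> requires.\<close>
  have "Q powr (- v) * inverse H \<le> 1 * inverse H"
    using Q v H powr_mono[of "-v" 0 Q] by (intro mult_right_mono) auto
  also have "\<dots> \<le> a" using Q H unfolding Q_def by (simp add: field_simps)
  finally have "lin_norm I J A q \<le> a" using lin by linarith
  then have "\<exists>r. (\<forall>i\<in>?K. r i \<in> \<int>) \<and> real_maxnorm ?K r = P * Q \<and>
      lin_norm I J A r = lin_norm I J A q / (P * a)"
    using a q unfolding P_def a_def Q_def H_def by - (rule padic_normalise[OF I J M], assumption+, blast)
  then obtain r where r: "\<forall>i\<in>?K. r i \<in> \<int>" "real_maxnorm ?K r = P * Q"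
      "lin_norm I J A r = lin_norm I J A q / (P * a)" by blast
  have "lin_norm I J A r \<le> Q powr (- v) * inverse H / (P * a)"
    unfolding r(3) using lin P a by (intro divide_right_mono) auto
  also have "\<dots> = Q powr (- v) / (P * Q)"
    using a H by (simp add: Q_def field_simps)
  also have "\<dots> \<le> Q powr (- v) / Q"
    using P Q by (intro divide_left_mono) auto
  also have "\<dots> = Q powr (u - v - 1) * Q powr (- u)"
    using Q by (simp add: powr_minus_divide powr_add powr_diff)
  also have "\<dots> \<le> P powr (- u) * Q powr (- u)"
    using L[of Q] Q by (intro mult_right_mono) auto
  also have "\<dots> = (P * Q) powr (- u)"
    using P Q by (simp add: powr_mult)
  finally have "lin_norm I J A r \<le> real_maxnorm ?K r powr (- u)" using r by simp
  moreover have "N < real_maxnorm ?K r"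
  proof -
    have "1 * Q \<le> P * Q" using P Q by (intro mult_right_mono) auto
    with r(2) Q show ?thesis by linarith
  qed
  ultimately show "\<exists>q. (\<forall>i\<in>?K. q i \<in> \<int>) \<and> N < real_maxnorm ?K q \<and>
      lin_norm I J A q \<le> real_maxnorm ?K q powr (- u)"
    using r(1) by blast
qed

text \<open>If \<open>q\<close> vanished on \<open>J\<close>, the value would be at least the
  \<open>p\<close>-adic size of the entry \<open>a\<close> of largest absolute value, which is at
  least 1 / |a|, the inverse height.\<close>

lemma padic_maxnorm_pos_of_small_lin_norm:
  fixes A :: "nat \<Rightarrow> nat \<Rightarrow> 'p::prime_card padic"
  assumes I: "finite I" "I \<noteq> {}" and J: "finite J" "J \<noteq> {}"
    and q: "\<forall>i\<in>I \<union> J. q i \<in> \<int>" "real_maxnorm (I \<union> J) q > 0"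
    and lin: "lin_norm I J A q < inverse (real_maxnorm (I \<union> J) q)"
  shows "padic_maxnorm J (\<lambda>j. of_rat (q j) :: 'p padic) > 0"
proof (rule ccontr)
  assume "\<not> ?thesis"
  then have "padic_norm (of_rat (q j) :: 'p padic) \<le> 0" if "j \<in> J" for j
    using padic_maxnorm_ge[OF J(1) that, of "\<lambda>j. of_rat (q j) :: 'p padic"] by simp
  then have qJ: "q j = 0" if "j \<in> J" for j
    using that padic_abs_pos[OF prime_card[where 'a='p], of "q j"] by fastforce
  obtain i where i: "i \<in> I \<union> J" "real_maxnorm (I \<union> J) q = real_of_rat \<bar>q i\<bar>"
    using real_maxnorm_attained[of "I \<union> J"] I J by blast
  with q(2) qJ have iI: "i \<in> I" by auto
  obtain a where a: "q i = of_int a" using q(1) i by (auto elim: Ints_cases)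
  have m: "real_maxnorm (I \<union> J) q = \<bar>of_int a\<bar>" unfolding i a by (rule real_of_rat_abs_of_int)
  then have a0: "a \<noteq> 0" using q(2) by auto
  have "padic_norm ((\<Sum>j\<in>J. A i j * of_rat (q j)) + of_rat (q i)) \<le> lin_norm I J A q"
    unfolding lin_norm_def
    by (rule padic_maxnorm_ge[OF I(1) iI, of "\<lambda>i. (\<Sum>j\<in>J. A i j * of_rat (q j)) + of_rat (q i)"])
  moreover have "(\<Sum>j\<in>J. A i j * of_rat (q j)) = 0"
    using qJ by (intro sum.neutral) auto
  ultimately have "padic_abs CARD('p) (of_int a) \<le> lin_norm I J A q"
    by (simp only: add_0_left padic_norm_of_rat a)
  then have "padic_abs CARD('p) (of_int a) < inverse \<bar>of_int a\<bar>" using lin m by simp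
  then have "padic_abs CARD('p) (of_int a) * \<bar>of_int a\<bar> < 1"
    using a0 by (simp add: field_simps)
  then show False using padic_abs_of_int_ge[OF a0, where 'p='p] by simp
qed

text \<open>An integral vector has \<open>J\<close>-norm at most 1, so Q \<le> H and the inequality
  itself only gets easier. The issue is that Q has to be unbounded. If Q \<le> N with H large, the
  normalised vector has height at most P N but a value tending to 0 as H grows, against the lower
  bound on a finite set. Exact solutions escape this argument and are replaced by multiples.\<close>

lemma int_approx_imp_pinv_approx:
  fixes A :: "nat \<Rightarrow> nat \<Rightarrow> 'p::prime_card padic"
  assumes I: "finite I" "I \<noteq> {}" and J: "finite J" "J \<noteq> {}"
    and v: "v \<ge> 0" "v + 1 < u" and app: "int_approx (I \<union> J) (lin_norm I J A) u"
  shows "pinv_approx (<) I J A v"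
  unfolding pinv_approx_def
proof
  fix N
  let ?K = "I \<union> J" and ?p = "real CARD('p)"
  let ?a = "\<lambda>q. padic_maxnorm J (\<lambda>j. of_rat (q j) :: 'p padic)" and ?H = "real_maxnorm ?K"
  have p: "?p > 1" by (rule prime_card_gt_1)
  have K: "finite ?K" "?K \<noteq> {}" using I J by auto
  show "\<exists>q. (\<forall>i\<in>?K. q i \<in> Z_inv CARD('p)) \<and>
      (let H = ?H q; Q = ?a q * H in N < Q \<and> lin_norm I J A q < Q powr (- v) * inverse H)"
  proof (cases "\<exists>q. (\<forall>i\<in>?K. q i \<in> \<int>) \<and> ?H q > 0 \<and> lin_norm I J A q = 0")
    case True
    then obtain q where q: "\<forall>i\<in>?K. q i \<in> \<int>" "?H q > 0" "lin_norm I J A q = 0" by blast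
    have a: "?a q > 0"
      using padic_maxnorm_pos_of_small_lin_norm[OF I J q(1,2), of A] q by simp
    then obtain k :: nat where k: "N < of_nat k * (?a q * ?H q)"
      using reals_Archimedean3[of "?a q * ?H q"] q(2) by auto
    define m where "m = CARD('p) * k + 1"
    \<comment> \<open>a multiplier prime to \<open>p\<close> changes the height but not the \<open>p\<close>-adic norm\<close>
    have "\<not> int CARD('p) dvd int m"
      using p dvd_add_right_iff[of "CARD('p)" "CARD('p) * k" 1] unfolding m_def int_dvd_int_iff by auto
    moreover have mk: "k \<le> m" "m > 0" using p unfolding m_def by (auto simp: trans_le_add1 le_SucI)
    ultimately have "multiplicity (int CARD('p)) (int m) = 0" by (intro not_dvd_imp_multiplicity_0)
    then have m1: "padic_abs CARD('p) (of_nat m) = 1"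
      using padic_abs_of_int[of "int m", where 'p='p] mk(2) by simp
    let ?q = "\<lambda>i. of_nat m * q i"
    have a': "?a ?q = ?a q"
      using padic_maxnorm_mult[OF J, of "of_nat m :: 'p padic" "\<lambda>j. of_rat (q j)"] m1
        padic_norm_of_rat[of "of_nat m", where 'p='p] by (simp add: of_rat_mult)
    have H': "?H ?q = of_nat m * ?H q"
      using real_maxnorm_mult[OF K, of "of_nat m" q] by simp
    have "of_nat k * (?a q * ?H q) \<le> of_nat m * (?a q * ?H q)"
      using mk a q(2) by (intro mult_right_mono) auto
    then have "N < ?a ?q * ?H ?q"
      using k by (simp add: a' H' mult_ac)
    moreover have "lin_norm I J A ?q = 0"
      using lin_norm_mult[OF I, of J A "of_nat m" q] q by simp
    moreover have "0 < (?a ?q * ?H ?q) powr (- v) * inverse (?H ?q)"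
      using a q(2) mk by (simp add: a' H')
    ultimately show ?thesis
      using q(1) by (intro exI[of _ ?q]) (auto simp: Let_def intro!: Ints_subset_Z_inv)
  next
    case False
    obtain M where M: "\<forall>i\<in>I. \<forall>j\<in>J. padic_norm (A i j) \<le> ?p ^ M"
      using obtain_coefficient_bound[OF I(1) J(1)] by blast
    define P where "P = ?p ^ M"
    have P: "P \<ge> 1" unfolding P_def using p by simp
    have pos: "lin_norm I J A q > 0" if "\<forall>i\<in>?K. q i \<in> \<int>" "?H q > 0" for q
    proof -
      have "lin_norm I J A q \<noteq> 0" using False that by blast
      with lin_norm_nonneg[OF I, of J A q] show ?thesis by simp
    qed
    \<comment> \<open>\<open>P * N\<close> bounds the heights of normalised vectors with Q \<le>
      N.\<close>
    obtain c where c: "c > 0" "\<And>q. \<forall>i\<in>?K. q i \<in> \<int> \<Longrightarrow> ?H q > 0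
        \<Longrightarrow> ?H q \<le> P * N \<Longrightarrow> c \<le> lin_norm I J A q"
      by (rule integer_vectors_lower_bound[of ?K "lin_norm I J A" "P * N"])
        (use K pos in \<open>simp_all add: lin_norm_restrict\<close>)
    \<comment> \<open>The value after normalising is at most \<open>H powr (1 - u)\<close>, because
      a \<ge> 1 / H.\<close>
    have "((\<lambda>x::real. x powr (1 - u)) \<longlongrightarrow> 0) at_top"
      using v by (intro tendsto_neg_powr filterlim_ident) auto
    then have "eventually (\<lambda>x::real. x powr (1 - u) < c) at_top"
      using c by (intro order_tendstoD) auto
    then obtain L where L: "\<And>x. x \<ge> L \<Longrightarrow> x powr (1 - u) < c"
      by (auto simp: eventually_at_top_linorder)
    obtain q where q: "\<forall>i\<in>?K. q i \<in> \<int>" "max 1 L < ?H q" "lin_norm I J A q \<le> ?H q powr (- u)"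
      using app unfolding int_approx_def by blast
    define H where "H = ?H q"
    define a where "a = ?a q"
    have H: "H > 1" "H > L" using q(2) by (simp_all add: H_def)
    have lin: "lin_norm I J A q < H powr (- v) * inverse H"
    proof -
      have "lin_norm I J A q \<le> H powr (- u)" using q(3) H_def by simp
      also have "\<dots> < H powr (- (v + 1))" using v H by (intro powr_less_mono) auto
      also have "\<dots> = H powr (- v) * inverse H"
      proof -
        have "- (v + 1) = - v + - 1" by simp
        then have "H powr (- (v + 1)) = H powr (- v) * H powr (- 1)" by (simp only: powr_add)
        also have "H powr (- 1) = inverse H" using H by (simp only: powr_minus powr_one)
        finally show ?thesis .
      qed
      finally show ?thesis .
    qed
    have "H powr (- v) * inverse H \<le> 1 * inverse H"
      using H v powr_mono[of "-v" 0 H] by (intro mult_right_mono) auto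
    then have lin1: "lin_norm I J A q < inverse H" using lin by linarith
    then have a: "a > 0"
      using padic_maxnorm_pos_of_small_lin_norm[OF I J q(1)] H by (simp add: H_def a_def)
    have a1: "a \<le> 1" unfolding a_def using q(1) J by (intro padic_maxnorm_le_1) auto
    \<comment> \<open>An entry \<open>b\<close> on \<open>J\<close> attains the norm
      \<open>a\<close>, and it is a nonzero integer, so a H \<ge> |b|_p |b| \<ge> 1.\<close>
    have Q1: "1 \<le> a * H"
    proof -
      obtain j where j: "j \<in> J" "a = padic_abs CARD('p) (q j)"
        using padic_maxnorm_attained[OF J, of "\<lambda>j. of_rat (q j) :: 'p padic"] unfolding a_def by auto
      obtain b where b: "q j = of_int b" using q(1) j by (auto elim: Ints_cases)
      have b0: "b \<noteq> 0" using a j b by auto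
      have "\<bar>of_int b\<bar> \<le> H"
        using real_maxnorm_ge[of ?K j q] K j unfolding b real_of_rat_abs_of_int H_def by simp
      then have "a * \<bar>of_int b\<bar> \<le> a * H" using a by (intro mult_left_mono) auto
      moreover have "1 \<le> a * \<bar>of_int b\<bar>"
        unfolding j(2) b by (rule padic_abs_of_int_ge[OF b0])
      ultimately show ?thesis by linarith
    qed
    have "N < a * H"
    proof (rule ccontr)
      assume N: "\<not> N < a * H"
      have "inverse H \<le> a" using Q1 H by (simp add: field_simps)
      with lin1 have "lin_norm I J A q \<le> a" by linarith
      moreover have "\<forall>i\<in>?K. q i \<in> Z_inv CARD('p)" using q(1) by (auto intro: Ints_subset_Z_inv)
      ultimately have "\<exists>r. (\<forall>i\<in>?K. r i \<in> \<int>) \<and> ?H r = P * (a * H) \<and>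
          lin_norm I J A r = lin_norm I J A q / (P * a)"
        using a unfolding P_def a_def H_def by - (rule padic_normalise[OF I J M], assumption+, blast)
      then obtain r where r: "\<forall>i\<in>?K. r i \<in> \<int>" "?H r = P * (a * H)"
          "lin_norm I J A r = lin_norm I J A q / (P * a)" by blast
      have "?H r > 0" "?H r \<le> P * N"
        using r(2) P a H N by auto
      then have "c \<le> lin_norm I J A r" using c(2) r(1) by blast
      also have "\<dots> \<le> H powr (- u) / (P * a)"
        unfolding r(3) using q(3) P a by (intro divide_right_mono) (auto simp: H_def)
      also have "\<dots> \<le> H powr (- u) / (1 * (1 / H))"
        using P a H Q1 by (intro divide_left_mono mult_mono) (auto simp: field_simps)
      also have "\<dots> = H powr (1 - u)"
        using H by (simp add: powr_minus powr_diff field_simps)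
      also have "\<dots> < c" using L H by simp
      finally show False by simp
    qed
    moreover have "lin_norm I J A q < (a * H) powr (- v) * inverse H"
    proof -
      have "a * H \<le> 1 * H" using a1 H by (intro mult_right_mono) auto
      then have "H powr (- v) \<le> (a * H) powr (- v)"
        using v a H by (intro powr_mono2') auto
      then have "H powr (- v) * inverse H \<le> (a * H) powr (- v) * inverse H"
        using H by (intro mult_right_mono) auto
      with lin show ?thesis by linarith
    qed
    ultimately show ?thesis
      using q(1) by (intro exI[of _ q]) (auto simp: Let_def a_def H_def intro!: Ints_subset_Z_inv)
  qed
qed


section \<open>Dirichlet's theorem for one linear form\<close>

lemma lin_norm_single: "lin_norm {0} J (\<lambda>_. y) q = padic_norm ((\<Sum>j\<in>J. y j * of_rat (q j)) + of_rat (q 0))"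
  by (simp add: lin_norm_def padic_maxnorm_def)

text \<open>The values at vectors with entries in 0..T, scaled by \<open>p ^ M\<close> into the
  \<open>p\<close>-adic integers, fall into p^k residue classes. Two vectors in one class have the
  required \<open>q\<close> as their difference.\<close>

lemma dirichlet_pigeonhole:
  fixes y :: "nat \<Rightarrow> 'p::prime_card padic"
  assumes y: "\<forall>j\<in>{1..n}. padic_norm (y j) \<le> real CARD('p) ^ M" and T: "T \<ge> 1"
  obtains q where "\<forall>i\<in>{0..n}. q i \<in> \<int>" "real_maxnorm {0..n} q > 0" "real_maxnorm {0..n} q \<le> real T"
    "lin_norm {0} {1..n} (\<lambda>_. y) q \<le> real CARD('p) ^ (M + 1) / real (T + 1) ^ (n + 1)"
proof -
  let ?K = "{0..n}" and ?p = "real CARD('p)" and ?X = "(T + 1) ^ (n + 1)"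
  have p2: "CARD('p) \<ge> 2" using prime_ge_2_nat[OF prime_card] .
  have p: "?p > 1" by (rule prime_card_gt_1)
  have "2 \<le> T + 1" using T by simp
  also have "\<dots> \<le> ?X" by (intro self_le_power) auto
  \<comment> \<open>The largest power of \<open>p\<close> below the number \<open>?X\<close> of
    vectors: two of them must share a class, and \<open>inverse (?p ^ k)\<close> is at most
    \<open>p\<close> times 1 / \<open>?X\<close>, which explains \<open>M + 1\<close> in the
    bound.\<close>
  finally obtain k where k: "CARD('p) ^ k < ?X" "?X \<le> CARD('p) ^ (k + 1)"
    using ex_power_ivl2[OF p2] by blast
  define val :: "(nat \<Rightarrow> nat) \<Rightarrow> 'p padic" where
    "val g = (\<Sum>j=1..n. y j * of_nat (g j)) + of_nat (g 0)" for g
  have val: "padic_norm (of_nat CARD('p) ^ M * val g) \<le> 1" for g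
  proof -
    have "padic_norm (y j * of_nat (g j)) \<le> ?p ^ M * 1" if "j \<in> {1..n}" for j
      unfolding padic_norm_mult using y that p
      by (intro mult_mono padic_norm_of_nat_le_1) auto
    then have "padic_norm (\<Sum>j=1..n. y j * of_nat (g j)) \<le> ?p ^ M"
      using p by (intro padic_norm_sum_le) auto
    moreover have "padic_norm (of_nat (g 0) :: 'p padic) \<le> ?p ^ M"
      using padic_norm_of_nat_le_1[of "g 0", where 'p='p] p one_le_power[of ?p M] by linarith
    ultimately have "padic_norm (val g) \<le> ?p ^ M"
      unfolding val_def using order_trans[OF padic_norm_add_max] by (metis max.bounded_iff)
    moreover have "padic_norm (of_nat CARD('p) ^ M :: 'p padic) = inverse (?p ^ M)"
      using padic_abs_powi[of "int M", where 'p='p] padic_norm_of_rat[of "of_nat CARD('p) ^ M", where 'p='p]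
      by (simp add: power_int_minus of_rat_power)
    ultimately have "padic_norm (of_nat CARD('p) ^ M * val g) \<le> inverse (?p ^ M) * ?p ^ M"
      unfolding padic_norm_mult by (intro mult_mono) auto
    then show ?thesis using p by simp
  qed
  then have "\<forall>g. \<exists>a. a < CARD('p) ^ k \<and>
      padic_norm (of_nat CARD('p) ^ M * val g - of_nat a) \<le> inverse (?p ^ k)"
    using padic_digit_approx by metis
  then obtain dig where dig: "\<And>g. dig g < CARD('p) ^ k"
      "\<And>g. padic_norm (of_nat CARD('p) ^ M * val g - of_nat (dig g)) \<le> inverse (?p ^ k)"
    by metis
  let ?S = "?K \<rightarrow>\<^sub>E {0..T}"
  have "\<not> inj_on dig ?S"
  proof
    assume "inj_on dig ?S"
    then have "card ?S \<le> card {..<CARD('p) ^ k}"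
      using dig(1) by (intro card_inj_on_le[of dig]) auto
    then show False using k(1) by (simp add: card_PiE)
  qed
  then obtain g h where gh: "g \<in> ?S" "h \<in> ?S" "g \<noteq> h" "dig g = dig h"
    unfolding inj_on_def by blast
  define q :: "nat \<Rightarrow> rat" where "q i = of_nat (g i) - of_nat (h i)" for i
  show ?thesis
  proof (rule that[of q])
    show "\<forall>i\<in>?K. q i \<in> \<int>" by (auto simp: q_def)
    obtain i where i: "i \<in> ?K" "g i \<noteq> h i"
      using gh PiE_ext by blast
    then have "real_of_rat \<bar>q i\<bar> > 0" by (simp add: q_def)
    then show "real_maxnorm ?K q > 0"
      using real_maxnorm_ge[OF finite_atLeastAtMost i(1), of q] by linarith
    have "real_of_rat \<bar>q i\<bar> \<le> real T" if "i \<in> ?K" for i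
    proof -
      have "g i \<le> T" "h i \<le> T" using gh that by auto
      then have "\<bar>q i\<bar> \<le> of_nat T" by (auto simp: q_def abs_le_iff)
      then have "real_of_rat \<bar>q i\<bar> \<le> real_of_rat (of_nat T)" by (simp only: of_rat_less_eq)
      then show ?thesis by simp
    qed
    then show "real_maxnorm ?K q \<le> real T" by (subst real_maxnorm_le_iff) auto
    have "lin_norm {0} {1..n} (\<lambda>_. y) q = padic_norm (val g - val h)"
      by (simp add: lin_norm_single val_def q_def of_rat_diff algebra_simps sum_subtractf)
    also have "\<dots> = ?p ^ M * padic_norm (of_nat CARD('p) ^ M * (val g - val h))"
      using padic_abs_powi[of "int M", where 'p='p] padic_norm_of_rat[of "of_nat CARD('p) ^ M", where 'p='p] p
      by (simp add: power_int_minus of_rat_power padic_norm_mult)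
    finally have lin: "lin_norm {0} {1..n} (\<lambda>_. y) q = ?p ^ M * padic_norm (of_nat CARD('p) ^ M * (val g - val h))" .
    have "of_nat CARD('p) ^ M * (val g - val h) =
        (of_nat CARD('p) ^ M * val g - of_nat (dig g)) - (of_nat CARD('p) ^ M * val h - of_nat (dig h))"
      using gh(4) by (simp add: algebra_simps)
    also have "padic_norm \<dots> \<le> inverse (?p ^ k)"
      using order_trans[OF padic_norm_diff_max] dig(2)[of g] dig(2)[of h] by (metis max.bounded_iff)
    also have "inverse (?p ^ k) \<le> ?p / real (T + 1) ^ (n + 1)"
    proof -
      have "real ?X \<le> real (CARD('p) ^ (k + 1))" using k(2) by (simp only: of_nat_le_iff)
      then have "real (T + 1) ^ (n + 1) \<le> ?p ^ (k + 1)" by (simp only: of_nat_power)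
      moreover have "inverse (?p ^ k) \<le> ?p / X" if "0 < X" "X \<le> ?p ^ (k + 1)" for X
        using that p by (simp add: field_simps)
      moreover have "0 < real (T + 1) ^ (n + 1)" by (intro zero_less_power) simp
      ultimately show ?thesis by blast
    qed
    finally have "?p ^ M * padic_norm (of_nat CARD('p) ^ M * (val g - val h)) \<le> ?p ^ M * (?p / real (T + 1) ^ (n + 1))"
      using p by (intro mult_left_mono) auto
    then show "lin_norm {0} {1..n} (\<lambda>_. y) q \<le> ?p ^ (M + 1) / real (T + 1) ^ (n + 1)"
      unfolding lin by (simp add: mult.commute)
  qed
qed

text \<open>The pigeonhole argument bounds heights only from above. In the absence of exact zeros,
  vectors of bounded height have values at least some c > 0, and T > C / c then forces the height
  beyond that bound.\<close>

lemma dirichlet_int_approx: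
  fixes y :: "nat \<Rightarrow> 'p::prime_card padic"
  assumes v: "v < real n + 1"
  shows "int_approx {0..n} (lin_norm {0} {1..n} (\<lambda>_. y)) v"
proof -
  let ?p = "real CARD('p)" and ?K = "{0..n}" and ?\<eta> = "lin_norm {0} {1..n} (\<lambda>_. y)"
  have p: "?p > 1" by (rule prime_card_gt_1)
  have K: "{0} \<union> {1..n} = ?K" by auto
  show ?thesis
  proof (cases "\<exists>q. (\<forall>i\<in>?K. q i \<in> \<int>) \<and> real_maxnorm ?K q > 0 \<and> ?\<eta> q = 0")
    case True
    then show ?thesis using int_approx_zero[of "{0}" "{1..n}" _ "\<lambda>_. y" v] unfolding K by auto
  next
    case False
    have pos: "?\<eta> q > 0" if "\<forall>i\<in>?K. q i \<in> \<int>" "real_maxnorm ?K q > 0" for q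
    proof -
      have "?\<eta> q \<noteq> 0" using False that by blast
      with lin_norm_nonneg[of "{0}" "{1..n}" "\<lambda>_. y" q] show ?thesis by simp
    qed
    obtain M where M: "\<forall>i\<in>{0}. \<forall>j\<in>{1..n}. padic_norm (y j) \<le> ?p ^ M"
      using obtain_coefficient_bound[of "{0::nat}" "{1..n}" "\<lambda>_. y"] by auto
    define C where "C = ?p ^ (M + 1)"
    have C: "C > 0" unfolding C_def using p by simp
    have "((\<lambda>x::real. x powr (v - (real n + 1))) \<longlongrightarrow> 0) at_top"
      using v by (intro tendsto_neg_powr filterlim_ident) auto
    then have "eventually (\<lambda>x::real. x powr (v - (real n + 1)) < 1 / C) at_top"
      using C by (intro order_tendstoD) auto
    then obtain L where L: "\<And>x. x \<ge> L \<Longrightarrow> x powr (v - (real n + 1)) < 1 / C"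
      by (auto simp: eventually_at_top_linorder)
    show ?thesis
      unfolding int_approx_def
    proof
      fix N
      obtain c where c: "c > 0" "\<And>q. \<forall>i\<in>?K. q i \<in> \<int> \<Longrightarrow> real_maxnorm ?K q > 0
          \<Longrightarrow> real_maxnorm ?K q \<le> max N L \<Longrightarrow> c \<le> ?\<eta> q"
        by (rule integer_vectors_lower_bound[of ?K ?\<eta> "max N L"])
          (use pos lin_norm_restrict[of "{0}" "{1..n}" "\<lambda>_. y"] K in \<open>simp_all\<close>)
      obtain T :: nat where T: "C / c < real T" using reals_Archimedean2 by blast
      have T0: "T \<ge> 1" using T C c(1) by (cases T) (auto simp: field_simps)
      obtain q where q: "\<forall>i\<in>?K. q i \<in> \<int>" "real_maxnorm ?K q > 0" "real_maxnorm ?K q \<le> real T"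
          "?\<eta> q \<le> C / real (T + 1) ^ (n + 1)"
        using dirichlet_pigeonhole[OF _ T0, of n y M] M unfolding C_def by auto
      define x where "x = real_maxnorm ?K q"
      have "real (T + 1) \<le> real (T + 1) ^ (n + 1)" by (intro self_le_power) auto
      then have "C / real (T + 1) ^ (n + 1) \<le> C / real (T + 1)"
        using C by (intro divide_left_mono) auto
      also have "\<dots> < c" using T C c(1) by (simp add: field_simps)
      finally have "?\<eta> q < c" using q(4) by linarith
      then have x: "x > N" "x > L" "x > 0" "x \<le> real T"
        using c(2)[of q] q unfolding x_def by force+
      \<comment> \<open>Since x \<le> T, the bound in terms of T becomes one in terms of the height
        itself.\<close>
      have "?\<eta> q \<le> C / x ^ (n + 1)"
        using x C q(4) by (rule_tac order_trans[OF q(4)]) (intro divide_left_mono power_mono, auto)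
      also have "\<dots> = C * (x powr (v - (real n + 1)) * x powr (- v))"
      proof -
        have "x powr (v - (real n + 1)) * x powr (- v) = x powr (- real (n + 1))"
          by (simp flip: powr_add add: algebra_simps)
        also have "\<dots> = inverse (x ^ (n + 1))"
          using x by (simp only: powr_minus powr_realpow)
        finally show ?thesis by (simp add: divide_inverse)
      qed
      also have "\<dots> \<le> C * (1 / C * x powr (- v))"
        using L[of x] x C by (intro mult_left_mono mult_right_mono) auto
      also have "\<dots> = x powr (- v)" using C by simp
      finally show "\<exists>q. (\<forall>i\<in>?K. q i \<in> \<int>) \<and> N < real_maxnorm ?K q \<and> ?\<eta> q \<le> real_maxnorm ?K q powr (- v)"
        using q(1) x(1) unfolding x_def by (intro exI[of _ q]) simp
    qed
  qed
qed

lemma pinv_approx_weaken: "pinv_approx (<) I J A v \<Longrightarrow> pinv_approx (\<le>) I J A v"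
  unfolding pinv_approx_def Let_def by (meson less_imp_le)

text \<open>Each direction loses an arbitrarily small part of the exponent. The quantifiers over
  \<open>u\<close> hide this, since an exponent halfway to the bound still lies above it.\<close>

lemma pinv_approx_iff_int_approx:
  fixes A :: "nat \<Rightarrow> nat \<Rightarrow> 'p::prime_card padic"
  assumes I: "finite I" "I \<noteq> {}" and J: "finite J" "J \<noteq> {}" and v: "v \<ge> 0"
    and R: "R = (<) \<or> R = (\<le>)"
  shows "(\<exists>u>v. pinv_approx R I J A u) \<longleftrightarrow> (\<exists>u>v + 1. int_approx (I \<union> J) (lin_norm I J A) u)"
proof
  assume "\<exists>u>v. pinv_approx R I J A u"
  then obtain u where u: "u > v" "pinv_approx R I J A u" by blast
  then have "pinv_approx (\<le>) I J A u"
    using R by (elim disjE) (simp_all add: pinv_approx_weaken)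
  then have "int_approx (I \<union> J) (lin_norm I J A) ((u + v) / 2 + 1)"
    using u v by (intro pinv_approx_imp_int_approx[OF I J, of u]) auto
  then show "\<exists>u>v + 1. int_approx (I \<union> J) (lin_norm I J A) u"
    using u by (intro exI[of _ "(u + v) / 2 + 1"]) auto
next
  assume "\<exists>u>v + 1. int_approx (I \<union> J) (lin_norm I J A) u"
  then obtain u where u: "u > v + 1" "int_approx (I \<union> J) (lin_norm I J A) u" by blast
  then have "pinv_approx (<) I J A ((v + u - 1) / 2)"
    using v u by (intro int_approx_imp_pinv_approx[OF I J, of _ u]) (auto simp: field_simps)
  then have "pinv_approx R I J A ((v + u - 1) / 2)"
    using R by (elim disjE) (simp_all add: pinv_approx_weaken)
  then show "\<exists>u>v. pinv_approx R I J A u"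
    using u by (intro exI[of _ "(v + u - 1) / 2"]) auto
qed

section \<open>Exponents as suprema\<close>

text \<open>\<open>w_vec\<close> admits positive exponents only; above \<open>v \<ge> 0\<close> this
  is automatic.\<close>

lemma less_w_vec_iff:
  assumes "v \<ge> 0"
  shows "ereal v < w_vec n y \<longleftrightarrow> (\<exists>u>v. int_approx {0..n} (lin_norm {0} {1..n} (\<lambda>_. y)) u)"
proof -
  have K: "{0} \<union> {1..n} = {0..n}" by auto
  have eq: "padic_norm (of_rat (q 0) + (\<Sum>j=1..n. of_rat (q j) * y j)) = lin_norm {0} {1..n} (\<lambda>_. y) q" for q
    by (simp add: lin_norm_single ac_simps)
  have "infinite {q \<in> {0..n} \<rightarrow>\<^sub>E \<int>. lin_norm {0} {1..n} (\<lambda>_. y) q \<le> real_maxnorm {0..n} q powr (- u)}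
      \<longleftrightarrow> int_approx {0..n} (lin_norm {0} {1..n} (\<lambda>_. y)) u" for u
    using lin_norm_restrict[of "{0}" "{1..n}" "\<lambda>_. y"] unfolding K by (intro infinite_iff_int_approx) auto
  then have "ereal v < w_vec n y \<longleftrightarrow> (\<exists>u. 0 < u \<and> v < u \<and> int_approx {0..n} (lin_norm {0} {1..n} (\<lambda>_. y)) u)"
    unfolding w_vec_def less_Sup_iff eq by auto
  also have "\<dots> \<longleftrightarrow> (\<exists>u>v. int_approx {0..n} (lin_norm {0} {1..n} (\<lambda>_. y)) u)"
    using order.strict_trans1[OF assms] by blast
  finally show ?thesis .
qed

lemma less_w_p_vec_iff:
  fixes y :: "nat \<Rightarrow> 'p::prime_card padic"
  shows "ereal v < w_p_vec n y \<longleftrightarrow> (\<exists>u>v. pinv_approx (<) {0} {1..n} (\<lambda>_. y) u)"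
proof -
  have K: "{0} \<union> {1..n} = {0..n}" by auto
  let ?P = "\<lambda>u N q. let Q = padic_maxnorm {1..n} (\<lambda>j. of_rat (q j) :: 'p padic) * real_maxnorm {0..n} q in
       Q > N \<and> padic_norm ((\<Sum>j=1..n. of_rat (q j) * y j) + of_rat (q 0))
         < Q powr (- u) * inverse (real_maxnorm {0..n} q)"
  let ?R = "\<lambda>q. restrict q {0..n}"
  have cong: "?P u N (?R q) = ?P u N q" for u N q
  proof -
    have "padic_maxnorm {1..n} (\<lambda>j. of_rat (?R q j) :: 'p padic) = padic_maxnorm {1..n} (\<lambda>j. of_rat (q j) :: 'p padic)"
      "real_maxnorm {0..n} (?R q) = real_maxnorm {0..n} q"
      "(\<Sum>j=1..n. of_rat (?R q j) * y j) = (\<Sum>j=1..n. of_rat (q j) * y j)"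
      by (auto intro!: padic_maxnorm_cong real_maxnorm_cong sum.cong)
    then show ?thesis by (simp add: Let_def)
  qed
  have ex: "(\<exists>q \<in> {0..n} \<rightarrow>\<^sub>E Z_inv CARD('p). ?P u N q) \<longleftrightarrow> (\<exists>q. (\<forall>i\<in>{0..n}. q i \<in> Z_inv CARD('p)) \<and> ?P u N q)"
    (is "?lhs \<longleftrightarrow> ?rhs") for u N
  proof
    assume ?rhs
    then obtain q where q: "\<forall>i\<in>{0..n}. q i \<in> Z_inv CARD('p)" "?P u N q" by blast
    moreover have "?P u N (restrict q {0..n})" using q(2) by (subst cong)
    ultimately show ?lhs by (intro bexI[of _ "restrict q {0..n}"]) auto
  next
    assume ?lhs
    then show ?rhs by (meson PiE_mem)
  qed
  have "(\<forall>N. \<exists>q. (\<forall>i\<in>{0..n}. q i \<in> Z_inv CARD('p)) \<and> ?P u N q) \<longleftrightarrow> pinv_approx (<) {0} {1..n} (\<lambda>_. y) u" for u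
    unfolding pinv_approx_def K lin_norm_single by (simp add: Let_def mult.commute)
  then show ?thesis
    unfolding w_p_vec_def less_Sup_iff ex by auto
qed

text \<open>As \<open>I\<close> and \<open>J\<close> are disjoint, a vector on the union amounts to
  its pair of restrictions, so infinitude carries over.\<close>

lemma less_w_mat_iff:
  fixes A :: "nat \<Rightarrow> nat \<Rightarrow> 'p::prime_card padic"
  assumes I: "finite I" "I \<noteq> {}" and J: "finite J" "J \<noteq> {}" and IJ: "I \<inter> J = {}"
  shows "ereal v < w_mat I J A \<longleftrightarrow> (\<exists>u>v. int_approx (I \<union> J) (lin_norm I J A) u)"
proof -
  let ?\<eta> = "lin_norm I J A" and ?f = "\<lambda>q. (restrict q I, restrict q J)"
  let ?S = "\<lambda>u. {q \<in> I \<union> J \<rightarrow>\<^sub>E \<int>. ?\<eta> q \<le> real_maxnorm (I \<union> J) q powr (- u)}"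
  let ?T = "\<lambda>u. {(q0, q) \<in> (I \<rightarrow>\<^sub>E \<int>) \<times> (J \<rightarrow>\<^sub>E \<int>).
       padic_maxnorm I (\<lambda>i. (\<Sum>j\<in>J. A i j * of_rat (q j)) + of_rat (q0 i))
         \<le> max (real_maxnorm I q0) (real_maxnorm J q) powr (- u)}"
  have inj: "inj_on ?f (I \<union> J \<rightarrow>\<^sub>E (\<int> :: rat set))"
  proof (rule inj_onI)
    fix q r assume qr: "q \<in> I \<union> J \<rightarrow>\<^sub>E (\<int> :: rat set)" "r \<in> I \<union> J \<rightarrow>\<^sub>E (\<int> :: rat set)" "?f q = ?f r"
    show "q = r"
    proof (rule PiE_ext[OF qr(1,2)])
      fix i assume "i \<in> I \<union> J"
      then show "q i = r i" using qr(3) by (metis Pair_inject UnE restrict_apply')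
    qed
  qed
  have \<eta>: "?\<eta> q = padic_maxnorm I (\<lambda>i. (\<Sum>j\<in>J. A i j * of_rat (restrict q J j)) + of_rat (restrict q I i))" for q
    unfolding lin_norm_def by (intro padic_maxnorm_cong) auto
  have H: "real_maxnorm (I \<union> J) q = max (real_maxnorm I (restrict q I)) (real_maxnorm J (restrict q J))" for q
    unfolding real_maxnorm_Un[OF I J] by (intro arg_cong2[of _ _ _ _ max] real_maxnorm_cong) auto
  have "?f ` ?S u = ?T u" for u
  proof
    show "?f ` ?S u \<subseteq> ?T u" using H \<eta> by auto
    show "?T u \<subseteq> ?f ` ?S u"
    proof
      fix x assume x: "x \<in> ?T u"
      obtain q0 q1 where xq: "x = (q0, q1)" by fastforce
      let ?q = "\<lambda>i\<in>I \<union> J. if i \<in> I then q0 i else q1 i"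
      have q: "q0 \<in> I \<rightarrow>\<^sub>E \<int>" "q1 \<in> J \<rightarrow>\<^sub>E \<int>" using x xq by auto
      have r: "restrict ?q I = q0" "restrict ?q J = q1"
        using q IJ by (auto intro!: ext simp: PiE_iff extensional_def restrict_def)
      have "?q \<in> I \<union> J \<rightarrow>\<^sub>E \<int>" using q by auto
      then have "?q \<in> ?S u" using x xq by (simp only: mem_Collect_eq H \<eta> r) auto
      then show "x \<in> ?f ` ?S u" by (intro image_eqI[of _ _ ?q]) (simp_all only: r xq)
    qed
  qed
  moreover have "inj_on ?f (?S u)" for u
    using inj by (rule inj_on_subset) auto
  ultimately have "infinite (?T u) \<longleftrightarrow> infinite (?S u)" for u
    using finite_image_iff[of ?f "?S u"] by simp
  also have "infinite (?S u) \<longleftrightarrow> int_approx (I \<union> J) ?\<eta> u" for u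
    using I J by (intro infinite_iff_int_approx lin_norm_restrict) auto
  finally have "infinite (?T u) \<longleftrightarrow> int_approx (I \<union> J) ?\<eta> u" for u .
  then show ?thesis
    unfolding w_mat_def less_Sup_iff by auto
qed

lemma less_w_p_mat_iff:
  fixes A :: "nat \<Rightarrow> nat \<Rightarrow> 'p::prime_card padic"
  assumes I: "finite I" "I \<noteq> {}" and J: "finite J" "J \<noteq> {}" and IJ: "I \<inter> J = {}"
  shows "ereal v < w_p_mat I J A \<longleftrightarrow> (\<exists>u>v. pinv_approx (\<le>) I J A u)"
proof -
  let ?Z = "Z_inv CARD('p)"
  let ?P = "\<lambda>u N q0 q. let H = max (real_maxnorm I q0) (real_maxnorm J q);
           Q = padic_maxnorm J (\<lambda>j. of_rat (q j) :: 'p padic) * H in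
         Q > N \<and> padic_maxnorm I (\<lambda>i. (\<Sum>j\<in>J. A i j * of_rat (q j)) + of_rat (q0 i))
           \<le> Q powr (- u) * inverse H"
  let ?L = "\<lambda>u N q. let H = real_maxnorm (I \<union> J) q;
            Q = padic_maxnorm J (\<lambda>j. of_rat (q j) :: 'p padic) * H
        in N < Q \<and> lin_norm I J A q \<le> Q powr (- u) * inverse H"
  have PL: "?P u N q0 q1 \<longleftrightarrow> ?L u N q" if "\<And>i. i \<in> I \<Longrightarrow> q0 i = q i" "\<And>j. j \<in> J \<Longrightarrow> q1 j = q j" for u N q0 q1 q
  proof -
    have "lin_norm I J A q = padic_maxnorm I (\<lambda>i. (\<Sum>j\<in>J. A i j * of_rat (q1 j)) + of_rat (q0 i))"
      unfolding lin_norm_def using that by (intro padic_maxnorm_cong) auto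
    moreover have "real_maxnorm (I \<union> J) q = max (real_maxnorm I q0) (real_maxnorm J q1)"
      unfolding real_maxnorm_Un[OF I J] using that by (intro arg_cong2[of _ _ _ _ max] real_maxnorm_cong) auto
    moreover have "padic_maxnorm J (\<lambda>j. of_rat (q j) :: 'p padic) = padic_maxnorm J (\<lambda>j. of_rat (q1 j) :: 'p padic)"
      using that by (intro padic_maxnorm_cong) auto
    ultimately show ?thesis by (simp add: Let_def)
  qed
  have "(\<exists>q0 \<in> I \<rightarrow>\<^sub>E ?Z. \<exists>q \<in> J \<rightarrow>\<^sub>E ?Z. ?P u N q0 q) \<longleftrightarrow> (\<exists>q. (\<forall>i\<in>I \<union> J. q i \<in> ?Z) \<and> ?L u N q)" for u N
  proof
    assume "\<exists>q0 \<in> I \<rightarrow>\<^sub>E ?Z. \<exists>q \<in> J \<rightarrow>\<^sub>E ?Z. ?P u N q0 q"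
    then obtain q0 q1 where q: "q0 \<in> I \<rightarrow>\<^sub>E ?Z" "q1 \<in> J \<rightarrow>\<^sub>E ?Z" "?P u N q0 q1" by blast
    let ?q = "\<lambda>i. if i \<in> I then q0 i else q1 i"
    have "?L u N ?q" using q(3) IJ by (subst PL[symmetric, of q0 _ q1]) auto
    moreover have "\<forall>i\<in>I \<union> J. ?q i \<in> ?Z" using q by auto
    ultimately show "\<exists>q. (\<forall>i\<in>I \<union> J. q i \<in> ?Z) \<and> ?L u N q" by (intro exI[of _ ?q] conjI)
  next
    assume "\<exists>q. (\<forall>i\<in>I \<union> J. q i \<in> ?Z) \<and> ?L u N q"
    then obtain q where q: "\<forall>i\<in>I \<union> J. q i \<in> ?Z" "?L u N q" by blast
    have "?P u N (restrict q I) (restrict q J)" using q(2) by (subst PL[of _ q]) auto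
    moreover have "restrict q I \<in> I \<rightarrow>\<^sub>E ?Z" "restrict q J \<in> J \<rightarrow>\<^sub>E ?Z" using q(1) by auto
    ultimately show "\<exists>q0 \<in> I \<rightarrow>\<^sub>E ?Z. \<exists>q \<in> J \<rightarrow>\<^sub>E ?Z. ?P u N q0 q" by blast
  qed
  then show ?thesis
    unfolding w_p_mat_def less_Sup_iff pinv_approx_def by auto
qed

lemma less_w_p_mat_iff_less_w_mat:
  assumes "finite I" "I \<noteq> {}" "finite J" "J \<noteq> {}" "I \<inter> J = {}" "v \<ge> 0"
  shows "ereal v < w_p_mat I J A \<longleftrightarrow> ereal (v + 1) < w_mat I J A"
  using assms by (simp add: less_w_p_mat_iff less_w_mat_iff pinv_approx_iff_int_approx)

lemma less_w_vec:
  assumes "v < real n + 1"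
  shows "ereal v < w_vec n y"
proof -
  \<comment> \<open>\<open>max v 0\<close> lies in the range of \<open>less_w_vec_iff\<close>, and
    the witness is halfway between it and n + 1.\<close>
  have "\<exists>u>max v 0. int_approx {0..n} (lin_norm {0} {1..n} (\<lambda>_. y)) u"
    using assms by (intro exI[of _ "(max v 0 + real n + 1) / 2"] conjI dirichlet_int_approx)
      (auto simp: max_def)
  then have "ereal (max v 0) < w_vec n y" by (subst less_w_vec_iff) auto
  then show ?thesis by (rule order.strict_trans1[rotated]) simp
qed

text \<open>For \<open>v \<ge> 0\<close> this is the equivalence of the two kinds of approximation;
  for negative \<open>v\<close> both sides hold by Dirichlet's theorem.\<close>

lemma less_w_p_vec_iff_less_w_vec:
  assumes n: "n \<ge> 1"
  shows "ereal v < w_p_vec n y \<longleftrightarrow> ereal (v + 1) < w_vec n y"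
proof -
  have K: "{0} \<union> {1..n} = {0..n}" by auto
  have *: "ereal v < w_p_vec n y \<longleftrightarrow> ereal (v + 1) < w_vec n y" if "v \<ge> 0" for v
    using that n pinv_approx_iff_int_approx[of "{0}" "{1..n}" v "(<)" "\<lambda>_. y"] less_w_vec_iff[of "v + 1" n y]
    unfolding less_w_p_vec_iff K by simp
  show ?thesis
  proof (cases "v \<ge> 0")
    case False
    have "ereal 0 < w_p_vec n y" using n by (subst *) (auto intro!: less_w_vec)
    then have "ereal v < w_p_vec n y" by (rule order.strict_trans[rotated]) (use False in simp)
    moreover have "ereal (v + 1) < w_vec n y" using False n by (intro less_w_vec) auto
    ultimately show ?thesis by simp
  qed (rule *)
qed

section \<open>Topology and Haar measure\<close>

lemma dist_padic_add_le:
  "dist (x + y) (a + b :: 'p::prime_card padic) \<le> max (dist x a) (dist y b)"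
proof -
  have "x + y - (a + b) = (x - a) + (y - b)" by simp
  then show ?thesis
    using padic_norm_add_max[of "x - a" "y - b"] by (simp only: dist_padic_def)
qed

text \<open>Makes finite sums continuous through \<open>tendsto_sum\<close>.\<close>

instance padic :: (prime_card) topological_comm_monoid_add
proof
  fix a b :: "'a padic"
  show "LIM x nhds a \<times>\<^sub>F nhds b. fst x + snd x :> nhds (a + b)"
    unfolding tendsto_iff eventually_prod_filter
  proof (intro allI impI)
    fix e :: real assume e: "e > 0"
    have ev: "eventually (\<lambda>x. dist x c < e) (nhds c)" for c :: "'a padic"
      using e by (auto simp: eventually_nhds_metric)
    show "\<exists>Pf Pg. eventually Pf (nhds a) \<and> eventually Pg (nhds b) \<and>
        (\<forall>x y. Pf x \<longrightarrow> Pg y \<longrightarrow> dist (fst (x, y) + snd (x, y)) (a + b) < e)"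
      using ev[of a] ev[of b] by (intro exI conjI) (auto intro: le_less_trans[OF dist_padic_add_le])
  qed
qed

lemma continuous_on_padic_mult_right: "continuous_on S (\<lambda>x. x * c :: 'p::prime_card padic)"
  unfolding continuous_on_iff
proof (intro ballI allI impI)
  fix x :: "'p padic" and e :: real assume e: "e > 0"
  let ?d = "e / (padic_norm c + 1)"
  have c: "padic_norm c + 1 > 0" using padic_norm_nonneg[of c] by linarith
  have "dist (y * c) (x * c) < e" if "dist y x < ?d" for y
  proof -
    have "dist (y * c) (x * c) = dist y x * padic_norm c"
      by (simp add: dist_padic_def padic_norm_mult flip: left_diff_distrib)
    also have "\<dots> \<le> dist y x * (padic_norm c + 1)" by (intro mult_left_mono) auto
    also have "\<dots> < e" using that c by (simp add: pos_less_divide_eq)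
    finally show ?thesis .
  qed
  then show "\<exists>d>0. \<forall>y\<in>S. dist y x < d \<longrightarrow> dist (y * c) (x * c) < e"
    using e c by (intro exI[of _ ?d]) auto
qed

lemma continuous_on_padic_norm: "continuous_on S (padic_norm :: 'p::prime_card padic \<Rightarrow> real)"
  unfolding continuous_on_iff
proof (intro ballI allI impI)
  fix x :: "'p padic" and e :: real assume e: "e > 0"
  have le: "padic_norm y - padic_norm x \<le> dist y x" for x y :: "'p padic"
    using padic_norm_add_max[of "y - x" x] padic_norm_nonneg[of x] padic_norm_nonneg[of "y - x"]
    by (simp add: dist_padic_def del: padic_norm_nonneg)
  have "dist (padic_norm y) (padic_norm x) \<le> dist y x" for y
    using le[of y x] le[of x y] by (simp add: dist_real_def dist_commute)
  then show "\<exists>d>0. \<forall>y\<in>S. dist y x < d \<longrightarrow> dist (padic_norm y) (padic_norm x) < e"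
    using e le_less_trans by blast
qed

lemma continuous_map_padic_affine:
  assumes "finite J" "J \<subseteq> I"
  shows "continuous_map (product_topology (\<lambda>_. euclidean) I) euclidean
           (\<lambda>x. b + (\<Sum>i\<in>J. x i * c i) :: 'p::prime_card padic)"
proof -
  let ?X = "product_topology (\<lambda>_. euclidean :: 'p padic topology) I"
  have "continuous_map ?X euclidean (\<lambda>x. x i * c i)" if "i \<in> J" for i
  proof -
    have "continuous_map ?X euclidean (\<lambda>x. x i)"
      using that assms(2) by (intro continuous_map_product_projection) auto
    moreover have "continuous_map euclidean euclidean (\<lambda>z. z * c i)"
      using continuous_on_padic_mult_right by simp
    ultimately show ?thesis
      by (rule continuous_map_compose[unfolded o_def])
  qed
  then show ?thesis
    unfolding continuous_map_atin by (auto intro!: tendsto_add tendsto_sum)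
qed

lemma space_padic_borel: "space (padic_borel I :: (nat \<Rightarrow> 'p::prime_card padic) measure) = I \<rightarrow>\<^sub>E UNIV"
  and sets_padic_borel: "sets (padic_borel I :: (nat \<Rightarrow> 'p::prime_card padic) measure) =
     sigma_sets (I \<rightarrow>\<^sub>E UNIV) {U. openin (product_topology (\<lambda>_. euclidean) I) U}"
proof -
  have "{U. openin (product_topology (\<lambda>_. euclidean :: 'p padic topology) I) U} \<subseteq> Pow (I \<rightarrow>\<^sub>E UNIV)"
    using openin_subset by fastforce
  then show "sets (padic_borel I :: (nat \<Rightarrow> 'p padic) measure) =
     sigma_sets (I \<rightarrow>\<^sub>E UNIV) {U. openin (product_topology (\<lambda>_. euclidean) I) U}"
    and "space (padic_borel I :: (nat \<Rightarrow> 'p padic) measure) = I \<rightarrow>\<^sub>E UNIV"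
    by (simp_all add: padic_borel_def)
qed

lemma closedin_padic_borel:
  assumes "closedin (product_topology (\<lambda>_. euclidean) I) S"
  shows "S \<in> sets (padic_borel I :: (nat \<Rightarrow> 'p::prime_card padic) measure)"
proof -
  have S: "S \<subseteq> I \<rightarrow>\<^sub>E UNIV" "openin (product_topology (\<lambda>_. euclidean) I) ((I \<rightarrow>\<^sub>E UNIV) - S)"
    using assms by (auto simp: closedin_def)
  have "(I \<rightarrow>\<^sub>E UNIV) - S \<in> sets (padic_borel I :: (nat \<Rightarrow> 'p padic) measure)"
    unfolding sets_padic_borel using S(2) by (intro sigma_sets.Basic) auto
  then have "(I \<rightarrow>\<^sub>E UNIV) - ((I \<rightarrow>\<^sub>E UNIV) - S) \<in> sets (padic_borel I :: (nat \<Rightarrow> 'p padic) measure)"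
    by (metis sets.compl_sets space_padic_borel)
  then show ?thesis using S(1) by (simp add: double_diff)
qed

lemma padic_affine_sublevel_measurable:
  fixes c :: "nat \<Rightarrow> 'p::prime_card padic"
  assumes "finite J" "J \<subseteq> I"
  shows "{x \<in> I \<rightarrow>\<^sub>E UNIV. padic_norm (b + (\<Sum>i\<in>J. x i * c i)) \<le> \<rho>} \<in> sets (padic_borel I)"
proof -
  have "continuous_map (product_topology (\<lambda>_. euclidean) I) euclidean
      (padic_norm \<circ> (\<lambda>x. b + (\<Sum>i\<in>J. x i * c i)))"
    using continuous_on_padic_norm
    by (intro continuous_map_compose[OF continuous_map_padic_affine[OF assms]]) simp
  then have "closedin (product_topology (\<lambda>_. euclidean) I)
      {x \<in> topspace (product_topology (\<lambda>_. euclidean) I). (padic_norm \<circ> (\<lambda>x. b + (\<Sum>i\<in>J. x i * c i))) x \<in> {..\<rho>}}"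
    by (rule closedin_continuous_map_preimage) auto
  then show ?thesis
    by (intro closedin_padic_borel) simp
qed

text \<open>Multiplication by \<open>p ^ M\<close> maps the ball into the \<open>p\<close>-adic
  integers, where \<open>padic_digit_approx\<close> supplies a finite net.\<close>

lemma compact_padic_cball:
  "compact {z :: 'p::prime_card padic. padic_norm z \<le> real CARD('p) ^ M}"
  unfolding compact_eq_totally_bounded
proof (intro conjI allI impI)
  let ?B = "{z :: 'p padic. padic_norm z \<le> real CARD('p) ^ M}" and ?p = "real CARD('p)"
  have p: "?p > 1" by (rule prime_card_gt_1)
  have pM: "padic_norm (of_nat CARD('p) ^ M :: 'p padic) = inverse (?p ^ M)"
    using padic_abs_powi[of "int M", where 'p='p] padic_norm_of_rat[of "of_nat CARD('p) ^ M", where 'p='p]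
    by (simp add: power_int_minus of_rat_power)
  have "closed ?B"
    by (intro closed_Collect_le continuous_on_padic_norm continuous_on_const)
  then show "complete ?B" by (simp add: complete_eq_closed)
  fix e :: real assume e: "e > 0"
  \<comment> \<open>Scaling back multiplies distances by \<open>p ^ M\<close>, so the net must have
    mesh below e / p^M.\<close>
  obtain k where k: "?p ^ M / e < ?p ^ k" using real_arch_pow[OF p] by blast
  let ?K = "(\<lambda>a. of_nat a / of_nat CARD('p) ^ M :: 'p padic) ` {..<CARD('p) ^ k}"
  have "z \<in> (\<Union>x\<in>?K. ball x e)" if z: "z \<in> ?B" for z
  proof -
    have "padic_norm (of_nat CARD('p) ^ M * z) \<le> inverse (?p ^ M) * ?p ^ M"
      unfolding padic_norm_mult pM using z p by (intro mult_left_mono) auto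
    then have "padic_norm (of_nat CARD('p) ^ M * z) \<le> 1" using p by simp
    then obtain a where a: "a < CARD('p) ^ k"
        "padic_norm (of_nat CARD('p) ^ M * z - of_nat a) \<le> inverse (?p ^ k)"
      by (rule padic_digit_approx)
    have "of_nat CARD('p) ^ M * (z - of_nat a / of_nat CARD('p) ^ M) = of_nat CARD('p) ^ M * z - of_nat a"
      by (simp add: algebra_simps)
    then have "inverse (?p ^ M) * padic_norm (z - of_nat a / of_nat CARD('p) ^ M) \<le> inverse (?p ^ k)"
      using a(2) by (metis padic_norm_mult pM)
    then have "padic_norm (z - of_nat a / of_nat CARD('p) ^ M) \<le> ?p ^ M / ?p ^ k"
      using p by (simp add: field_simps)
    also have "\<dots> < e" using k e p by (simp add: field_simps)
    finally have "z \<in> ball (of_nat a / of_nat CARD('p) ^ M) e"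
      by (simp add: dist_commute dist_padic_def)
    then show ?thesis using a(1) by blast
  qed
  then show "\<exists>k. finite k \<and> ?B \<subseteq> (\<Union>x\<in>k. ball x e)"
    by (intro exI[of _ ?K]) auto
qed

section \<open>Measure of the points where an affine form is small\<close>

text \<open>The radius is at least 1 and the norm is ultrametric, so translations by integral
  vectors map the box onto itself. Compactness makes its Haar measure finite.\<close>

definition padic_box :: "nat set \<Rightarrow> nat \<Rightarrow> (nat \<Rightarrow> 'p::prime_card padic) set" where
  "padic_box I M = I \<rightarrow>\<^sub>E {z. padic_norm z \<le> real CARD('p) ^ M}"

lemma compactin_padic_box: "compactin (product_topology (\<lambda>_. euclidean) I) (padic_box I M)"
  unfolding padic_box_def compactin_PiE using compact_padic_cball by auto

lemma padic_box_measurable: "padic_box I M \<in> sets (padic_borel I :: (nat \<Rightarrow> 'p::prime_card padic) measure)"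
  unfolding padic_box_def
  by (intro closedin_padic_borel)
    (auto simp: closedin_product_topology intro!: closed_Collect_le continuous_on_padic_norm continuous_on_const)

lemma padic_box_exhausts:
  fixes x :: "nat \<Rightarrow> 'p::prime_card padic"
  assumes "x \<in> I \<rightarrow>\<^sub>E UNIV" "finite I"
  obtains M where "x \<in> padic_box I M"
proof -
  obtain M where M: "\<forall>i\<in>{0}. \<forall>j\<in>I. padic_norm (x j) \<le> real CARD('p) ^ M"
    using obtain_coefficient_bound[of "{0::nat}" I "\<lambda>_. x"] assms(2) by auto
  then have "x \<in> padic_box I M"
    using assms(1) by (auto simp: padic_box_def PiE_iff)
  then show ?thesis by (rule that)
qed

text \<open>
  The translates of the slab by \<open>t\<close> times the \<open>i\<close>-th unit vector, \<open>0 \<le> t < m\<close>, are disjoint as soon as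
  \<open>\<bar>g\<^sub>i\<bar> / m \<ge> \<rho>\<close>, because nonzero integers satisfy \<open>\<bar>t\<bar>\<^sub>p \<ge> 1 / \<bar>t\<bar>\<close>; all of them stay in the box.
\<close>

lemma haar_measure_slab:
  fixes \<nu> :: "(nat \<Rightarrow> 'p::prime_card padic) measure"
  assumes haar: "haar_measure I \<nu>" and I: "finite I" "i \<in> I" and \<rho>: "0 < \<rho>" "\<rho> < padic_norm (g i)"
  shows "measure \<nu> {x \<in> padic_box I M. padic_norm (b + (\<Sum>j\<in>I. x j * g j)) \<le> \<rho>}
         \<le> 2 * \<rho> / padic_norm (g i) * measure \<nu> (padic_box I M)"
proof -
  have sets: "sets \<nu> = sets (padic_borel I)" using haar by (simp add: haar_measure_def)
  define B :: "(nat \<Rightarrow> 'p padic) set" where "B = padic_box I M"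
  define L :: "(nat \<Rightarrow> 'p padic) \<Rightarrow> 'p padic" where "L x = (\<Sum>j\<in>I. x j * g j)" for x
  define E where "E b = {x \<in> B. padic_norm (b + L x) \<le> \<rho>}" for b
  have B: "B \<in> sets \<nu>" unfolding B_def sets by (rule padic_box_measurable)
  have Bfin: "emeasure \<nu> B < \<infinity>"
    using haar compactin_padic_box unfolding haar_measure_def B_def by blast
  have BE: "B \<subseteq> I \<rightarrow>\<^sub>E UNIV" by (auto simp: B_def padic_box_def PiE_iff)
  have E: "E b \<in> sets \<nu>" for b
  proof -
    have "E b = B \<inter> {x \<in> I \<rightarrow>\<^sub>E UNIV. padic_norm (b + (\<Sum>j\<in>I. x j * g j)) \<le> \<rho>}"
      using BE by (auto simp: E_def L_def)
    then show ?thesis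
      using B padic_affine_sublevel_measurable[OF I(1) order_refl, of b g \<rho>] sets by auto
  qed
  \<comment> \<open>|g_i| / \<rho> < m + 1 \<le> 2 m, whence the factor 2 in the bound.\<close>
  define m where "m = nat \<lfloor>padic_norm (g i) / \<rho>\<rfloor>"
  have quot: "1 < padic_norm (g i) / \<rho>" using \<rho> by simp
  then have m: "1 \<le> m" "real m \<le> padic_norm (g i) / \<rho>" "padic_norm (g i) / \<rho> < real m + 1"
    unfolding m_def by linarith+
  define a :: "nat \<Rightarrow> nat \<Rightarrow> 'p padic" where "a t = (\<lambda>j\<in>I. if j = i then of_nat t else 0)" for t
  define \<tau> where "\<tau> t x = (\<lambda>j\<in>I. a t j + x j)" for t x
  have L\<tau>: "L (\<tau> t x) = of_nat t * g i + L x" for t x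
  proof -
    have "L (\<tau> t x) = (\<Sum>j\<in>I. (if j = i then of_nat t * g i else 0) + x j * g j)"
      unfolding L_def \<tau>_def a_def by (intro sum.cong) (auto simp: algebra_simps)
    also have "\<dots> = of_nat t * g i + L x"
      using I by (simp add: sum.distrib L_def)
    finally show ?thesis .
  qed
  have p: "real CARD('p) > 1" by (rule prime_card_gt_1)
  have tM: "padic_norm (of_nat t :: 'p padic) \<le> real CARD('p) ^ M" for t
    using padic_norm_of_nat_le_1[of t, where 'p='p] p one_le_power[of "real CARD('p)" M] by linarith
  have aM: "padic_norm (a t j) \<le> real CARD('p) ^ M" if "j \<in> I" for t j
    using that tM[of t] p by (simp add: a_def)
  \<comment> \<open>Translating by \<open>t\<close> times the unit vector only changes the offset
    \<open>b\<close>, so every translate is a slab in the same box.\<close>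
  have img: "\<tau> t ` E b = E (b - of_nat t * g i)" for t b
  proof
    show "\<tau> t ` E b \<subseteq> E (b - of_nat t * g i)"
    proof (intro image_subsetI)
      fix x assume x: "x \<in> E b"
      have "padic_norm (a t j + x j) \<le> real CARD('p) ^ M" if "j \<in> I" for j
        using aM x that by (intro order_trans[OF padic_norm_add_max] max.boundedI) (auto simp: E_def B_def padic_box_def)
      then have "\<tau> t x \<in> B" unfolding B_def padic_box_def \<tau>_def by auto
      then show "\<tau> t x \<in> E (b - of_nat t * g i)" using x by (simp add: E_def L\<tau>)
    qed
    show "E (b - of_nat t * g i) \<subseteq> \<tau> t ` E b"
    proof
      fix x assume x: "x \<in> E (b - of_nat t * g i)"
      define y where "y = (\<lambda>j\<in>I. x j - a t j)"
      have "padic_norm (x j - a t j) \<le> real CARD('p) ^ M" if "j \<in> I" for j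
        using aM x that by (intro order_trans[OF padic_norm_diff_max] max.boundedI) (auto simp: E_def B_def padic_box_def)
      then have yB: "y \<in> B" unfolding B_def padic_box_def y_def by auto
      have \<tau>y: "\<tau> t y = x"
      proof
        fix j show "\<tau> t y j = x j"
          using x BE by (cases "j \<in> I") (auto simp: \<tau>_def y_def E_def PiE_iff extensional_def)
      qed
      have "L x = of_nat t * g i + L y" using L\<tau>[of t y] \<tau>y by simp
      then have "y \<in> E b" using x yB by (simp add: E_def)
      then show "x \<in> \<tau> t ` E b" using \<tau>y by blast
    qed
  qed
  have meas: "emeasure \<nu> (E (b - of_nat t * g i)) = emeasure \<nu> (E b)" for t
  proof -
    have "a t \<in> I \<rightarrow>\<^sub>E UNIV" by (auto simp: a_def)
    then have "emeasure \<nu> ((\<lambda>x. \<lambda>i\<in>I. a t i + x i) ` E b) = emeasure \<nu> (E b)"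
      using haar E unfolding haar_measure_def by blast
    then show ?thesis using img[of t b] by (simp add: \<tau>_def)
  qed
  have disj: "E (b - of_nat t * g i) \<inter> E (b - of_nat u * g i) = {}" if "t < u" "u < m" for t u
  proof (rule ccontr)
    assume "\<not> ?thesis"
    then obtain x where x: "x \<in> E (b - of_nat t * g i)" "x \<in> E (b - of_nat u * g i)" by blast
    have "of_nat (u - t) * g i = (b - of_nat t * g i + L x) - (b - of_nat u * g i + L x)"
      using that by (simp add: of_nat_diff algebra_simps)
    then have "padic_norm (of_nat (u - t) * g i) \<le> \<rho>"
      using order_trans[OF padic_norm_diff_max] x unfolding E_def
      by (metis (no_types, lifting) max.bounded_iff mem_Collect_eq)
    then have le: "padic_abs CARD('p) (of_int (int (u - t))) * padic_norm (g i) \<le> \<rho>"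
      using padic_norm_of_rat[of "of_nat (u - t)", where 'p='p] by (simp add: padic_norm_mult)
    have "1 \<le> padic_abs CARD('p) (of_int (int (u - t))) * \<bar>of_int (int (u - t))\<bar>"
      using that by (intro padic_abs_of_int_ge) auto
    then have ge: "1 \<le> padic_abs CARD('p) (of_int (int (u - t))) * real (u - t)"
      by (simp only: of_int_of_nat_eq abs_of_nat)
    let ?y = "padic_abs CARD('p) (of_int (int (u - t)))"
    have "padic_norm (g i) \<le> ?y * real (u - t) * padic_norm (g i)"
      using mult_right_mono[OF ge padic_norm_nonneg[of "g i"]] by simp
    also have "\<dots> \<le> \<rho> * real (u - t)"
      using mult_right_mono[OF le, of "real (u - t)"] by (simp add: mult_ac)
    also have "\<dots> < \<rho> * real m" using that \<rho> by (intro mult_strict_left_mono) auto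
    also have "\<dots> \<le> padic_norm (g i)" using m(2) \<rho> by (simp add: field_simps)
    finally show False by simp
  qed
  have dj: "disjoint_family_on (\<lambda>t. E (b - of_nat t * g i)) {..<m}"
    unfolding disjoint_family_on_def
  proof (intro ballI impI)
    fix t u assume "t \<in> {..<m}" "u \<in> {..<m}" "t \<noteq> u"
    then show "E (b - of_nat t * g i) \<inter> E (b - of_nat u * g i) = {}"
      using disj[of t u] disj[of u t] by (cases t u rule: linorder_cases) auto
  qed
  have "of_nat m * emeasure \<nu> (E b) = (\<Sum>t<m. emeasure \<nu> (E (b - of_nat t * g i)))"
    by (simp add: meas)
  also have "\<dots> = emeasure \<nu> (\<Union>t<m. E (b - of_nat t * g i))"
    using E dj by (intro sum_emeasure) auto
  also have "\<dots> \<le> emeasure \<nu> B"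
    using B by (intro emeasure_mono) (auto simp: E_def)
  finally have le: "of_nat m * emeasure \<nu> (E b) \<le> emeasure \<nu> B" .
  have "emeasure \<nu> (E b) \<le> emeasure \<nu> B" using B by (intro emeasure_mono) (auto simp: E_def)
  then have "emeasure \<nu> (E b) = ennreal (measure \<nu> (E b))" "emeasure \<nu> B = ennreal (measure \<nu> B)"
    using Bfin by (auto intro!: emeasure_eq_ennreal_measure)
  with le have "ennreal (real m * measure \<nu> (E b)) \<le> ennreal (measure \<nu> B)"
    by (simp add: ennreal_mult ennreal_of_nat_eq_real_of_nat)
  then have mle: "real m * measure \<nu> (E b) \<le> measure \<nu> B" by (simp add: ennreal_le_iff)
  have "padic_norm (g i) / \<rho> * measure \<nu> (E b) \<le> (2 * real m) * measure \<nu> (E b)"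
    using m by (intro mult_right_mono) auto
  also have "\<dots> \<le> 2 * measure \<nu> B" using mle by simp
  finally have "measure \<nu> (E b) \<le> 2 * \<rho> / padic_norm (g i) * measure \<nu> B"
    using \<rho> by (simp add: field_simps)
  then show ?thesis by (simp add: E_def B_def L_def)
qed

lemma padic_norm_sum_less:
  assumes "B > 0" "finite S" "\<And>i. i \<in> S \<Longrightarrow> padic_norm (f i :: 'p::prime_card padic) < B"
  shows "padic_norm (\<Sum>i\<in>S. f i) < B"
  using assms(2,3)
proof (induction S rule: finite_induct)
  case (insert x S)
  then have "padic_norm (f x) < B" "padic_norm (sum f S) < B" by auto
  then show ?case
    using insert le_less_trans[OF padic_norm_add_max[of "f x" "sum f S"], of B] by simp
qed (use assms(1) in auto)

text \<open>Write P = p^M. A coefficient with P |g_i| \<ge> G and |g_i| > \<rho> is covered by the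
  slab estimate. If P |g_i| < G for all i, the constant term dominates on the whole box, and the set
  is empty for \<rho> < G. In the remaining cases G \<le> 2 P \<rho>, and the bound is at least the
  measure of the box.\<close>

lemma haar_measure_affine_sublevel:
  fixes \<nu> :: "(nat \<Rightarrow> 'p::prime_card padic) measure"
  assumes haar: "haar_measure I \<nu>" and I: "finite I" and \<rho>: "0 < \<rho>" and G: "0 < G"
    and coeff: "G \<le> padic_norm b \<or> (\<exists>i\<in>I. G \<le> padic_norm (g i))"
  shows "measure \<nu> {x \<in> padic_box I M. padic_norm (b + (\<Sum>j\<in>I. x j * g j)) \<le> \<rho>}
         \<le> 2 * real CARD('p) ^ M * measure \<nu> (padic_box I M) * \<rho> / G"
    (is "measure \<nu> ?E \<le> _")
proof -
  let ?P = "real CARD('p) ^ M" and ?B = "padic_box I M :: (nat \<Rightarrow> 'p padic) set"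
  have P: "?P \<ge> 1" using prime_card_gt_1[where 'p='p] by simp
  have B: "?B \<in> sets \<nu>" using haar padic_box_measurable by (auto simp: haar_measure_def)
  have Bfin: "emeasure \<nu> ?B \<noteq> \<infinity>"
    using haar compactin_padic_box unfolding haar_measure_def by (metis less_irrefl)
  have \<beta>: "measure \<nu> ?B \<ge> 0" by simp
  \<comment> \<open>Outside the \<sigma>-algebra \<open>measure\<close> has the default value
    0.\<close>
  have "measure \<nu> ?E \<le> measure \<nu> ?B"
    using B Bfin by (cases "?E \<in> sets \<nu>") (auto simp: fmeasurable_def top.not_eq_extremum measure_notin_sets intro!: measure_mono_fmeasurable)
  then have triv: ?thesis if "G \<le> 2 * ?P * \<rho>"
  proof -
    have "measure \<nu> ?B * G \<le> measure \<nu> ?B * (2 * ?P * \<rho>)"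
      using that by (intro mult_left_mono) auto
    then have "measure \<nu> ?B \<le> 2 * ?P * measure \<nu> ?B * \<rho> / G"
      using G by (simp add: field_simps)
    with \<open>measure \<nu> ?E \<le> measure \<nu> ?B\<close> show ?thesis by linarith
  qed
  show ?thesis
  proof (cases "\<exists>i\<in>I. G \<le> ?P * padic_norm (g i)")
    case True
    then obtain i where i: "i \<in> I" "G \<le> ?P * padic_norm (g i)" by blast
    have gi: "padic_norm (g i) > 0"
    proof (rule ccontr)
      assume "\<not> ?thesis"
      then have "padic_norm (g i) = 0" using padic_norm_nonneg[of "g i"] by linarith
      then have "?P * padic_norm (g i) = 0" by (simp only: mult_zero_right)
      then show False using i(2) G by linarith
    qed
    show ?thesis
    proof (cases "\<rho> < padic_norm (g i)")
      case True
      have "measure \<nu> ?E \<le> 2 * \<rho> / padic_norm (g i) * measure \<nu> ?B"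
        using \<rho> True by (intro haar_measure_slab[OF haar I i(1)])
      also have "\<dots> \<le> (2 * \<rho> * ?P / G) * measure \<nu> ?B"
      proof (intro mult_right_mono \<beta>)
        have "2 * \<rho> * G \<le> 2 * \<rho> * (?P * padic_norm (g i))"
          using i(2) \<rho> by (intro mult_left_mono) auto
        then show "2 * \<rho> / padic_norm (g i) \<le> 2 * \<rho> * ?P / G"
          using gi G by (simp add: field_simps)
      qed
      finally show ?thesis by (simp add: mult_ac)
    next
      case False
      then have "?P * padic_norm (g i) \<le> ?P * \<rho>" using P by (intro mult_left_mono) auto
      moreover have "0 \<le> ?P * \<rho>" using P \<rho> by (intro mult_nonneg_nonneg) auto
      ultimately have "G \<le> 2 * ?P * \<rho>" using i(2) by linarith
      then show ?thesis by (rule triv)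
    qed
  next
    case False
    have small: "?P * padic_norm (g i) < G" if "i \<in> I" for i using False that by force
    have "padic_norm (g i) < G" if "i \<in> I" for i
      using small[OF that] mult_right_mono[OF P padic_norm_nonneg[of "g i"]] by simp
    then have b: "G \<le> padic_norm b" using coeff by force
    show ?thesis
    proof (cases "\<rho> < G")
      case True
      have "?E = {}"
      proof (rule ccontr)
        assume "?E \<noteq> {}"
        then obtain x where x: "x \<in> ?B" "padic_norm (b + (\<Sum>j\<in>I. x j * g j)) \<le> \<rho>" by blast
        have "padic_norm (\<Sum>j\<in>I. x j * g j) < G"
        proof (rule padic_norm_sum_less[OF G I])
          fix j assume j: "j \<in> I"
          have "padic_norm (x j * g j) \<le> ?P * padic_norm (g j)"
            unfolding padic_norm_mult using x(1) j by (intro mult_right_mono) (auto simp: padic_box_def)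
          with small[OF j] show "padic_norm (x j * g j) < G" by linarith
        qed
        moreover have "b = (b + (\<Sum>j\<in>I. x j * g j)) - (\<Sum>j\<in>I. x j * g j)" by simp
        then have "padic_norm b \<le> max (padic_norm (b + (\<Sum>j\<in>I. x j * g j))) (padic_norm (\<Sum>j\<in>I. x j * g j))"
          by (metis padic_norm_diff_max)
        ultimately show False using x(2) True b by linarith
      qed
      then have "measure \<nu> ?E = 0" by (simp only: measure_empty)
      then show ?thesis using \<rho> G by simp
    next
      case False
      have "1 * \<rho> \<le> 2 * ?P * \<rho>" using P \<rho> by - (rule mult_right_mono; linarith)
      then have "G \<le> 2 * ?P * \<rho>" using False by linarith
      then show ?thesis by (rule triv)
    qed
  qed
qed

section \<open>Counting integer vectors with small values\<close>

lemma real_of_rat_abs: "real_of_rat \<bar>x\<bar> = \<bar>real_of_rat x\<bar>"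
  by (cases "x < 0") (simp_all add: of_rat_minus)

text \<open>Cut the box into cells of side \<open>l\<close>. Separated vectors lie in different
  cells, and there are at most 2 T / l + 2 \<le> 4 T / l cells in each direction because
  \<open>l \<le> T\<close>.\<close>

lemma card_separated_integer_vectors:
  assumes K: "finite K" "K \<noteq> {}" and S: "S \<subseteq> K \<rightarrow>\<^sub>E (\<int> :: rat set)"
    and T: "\<And>q. q \<in> S \<Longrightarrow> real_maxnorm K q \<le> T" and l: "0 < l" "l \<le> T"
    and sep: "\<And>q r. q \<in> S \<Longrightarrow> r \<in> S \<Longrightarrow> q \<noteq> r \<Longrightarrow> l \<le> real_maxnorm K (\<lambda>i. q i - r i)"
  shows "real (card S) \<le> (4 * T / l) ^ card K"
proof -
  define F where "F q = (\<lambda>i\<in>K. \<lfloor>real_of_rat (q i) / l\<rfloor>)" for q :: "nat \<Rightarrow> rat"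
  let ?R = "{\<lfloor>- T / l\<rfloor>..\<lfloor>T / l\<rfloor>}"
  have "inj_on F S"
  proof (rule inj_onI, rule ccontr)
    fix q r assume qr: "q \<in> S" "r \<in> S" "F q = F r" "q \<noteq> r"
    obtain i where i: "i \<in> K" "real_maxnorm K (\<lambda>i. q i - r i) = real_of_rat \<bar>q i - r i\<bar>"
      using real_maxnorm_attained[OF K, of "\<lambda>i. q i - r i"] .
    have "F q i = F r i" using qr(3) by simp
    then have "\<lfloor>real_of_rat (q i) / l\<rfloor> = \<lfloor>real_of_rat (r i) / l\<rfloor>"
      using i(1) by (simp add: F_def)
    then have "\<bar>real_of_rat (q i) / l - real_of_rat (r i) / l\<bar> < 1" by linarith
    then have "\<bar>real_of_rat (q i) - real_of_rat (r i)\<bar> / l < 1"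
      using l(1) by (simp flip: diff_divide_distrib)
    then have "\<bar>real_of_rat (q i - r i)\<bar> < l" using l(1) by (simp add: of_rat_diff)
    moreover have "real_of_rat \<bar>q i - r i\<bar> = \<bar>real_of_rat (q i - r i)\<bar>" by (rule real_of_rat_abs)
    ultimately show False using sep[OF qr(1,2,4)] i(2) by linarith
  qed
  moreover have "F ` S \<subseteq> K \<rightarrow>\<^sub>E ?R"
  proof (intro image_subsetI)
    fix q assume q: "q \<in> S"
    have "\<lfloor>real_of_rat (q i) / l\<rfloor> \<in> ?R" if i: "i \<in> K" for i
    proof -
      have "real_of_rat \<bar>q i\<bar> \<le> T"
        using real_maxnorm_ge[OF K(1) i, of q] T[OF q] by linarith
      moreover have "real_of_rat \<bar>q i\<bar> = \<bar>real_of_rat (q i)\<bar>" by (rule real_of_rat_abs)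
      ultimately have T': "- T \<le> real_of_rat (q i)" "real_of_rat (q i) \<le> T" by linarith+
      have "\<lfloor>- T / l\<rfloor> \<le> \<lfloor>real_of_rat (q i) / l\<rfloor>"
        using l(1) by (intro floor_mono divide_right_mono T') simp
      moreover have "\<lfloor>real_of_rat (q i) / l\<rfloor> \<le> \<lfloor>T / l\<rfloor>"
        using l(1) by (intro floor_mono divide_right_mono T') simp
      ultimately show ?thesis by simp
    qed
    then show "F q \<in> K \<rightarrow>\<^sub>E ?R" by (auto simp: F_def)
  qed
  ultimately have "card S \<le> card (K \<rightarrow>\<^sub>E ?R)"
    using K by (intro card_inj_on_le) (auto intro: finite_PiE)
  also have "\<dots> = card ?R ^ card K" using K by (simp add: card_PiE)
  finally have "real (card S) \<le> real (card ?R) ^ card K"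
    by (metis of_nat_le_iff of_nat_power)
  also have "\<dots> \<le> (4 * T / l) ^ card K"
  proof (rule power_mono)
    have 1: "1 \<le> T / l" using l by simp
    have "real (card ?R) = of_int (\<lfloor>T / l\<rfloor> - \<lfloor>- T / l\<rfloor> + 1)"
    proof -
      have "\<lfloor>- T / l\<rfloor> \<le> \<lfloor>T / l\<rfloor>" using 1 by (intro floor_mono) simp
      then show ?thesis by simp
    qed
    also have "\<dots> \<le> 2 * (T / l) + 2" by (simp, linarith)
    also have "\<dots> \<le> 4 * T / l" using 1 by simp
    finally show "real (card ?R) \<le> 4 * T / l" .
  qed auto
  finally show ?thesis .
qed

text \<open>Ordering the elements of \<open>S\<close> by \<open>f\<close>, the \<open>k\<close>-th value is at least \<open>k / B\<close>.\<close>

lemma sum_inverse_le_harm: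
  fixes f :: "'a \<Rightarrow> real"
  assumes "finite S" "\<And>x. x \<in> S \<Longrightarrow> f x > 0" "B \<ge> 0"
    and "\<And>d. d > 0 \<Longrightarrow> real (card {x \<in> S. f x \<le> d}) \<le> B * d"
  shows "(\<Sum>x\<in>S. 1 / f x) \<le> B * harm (card S)"
  using assms
proof (induction S rule: finite_ranking_induct[where f = f])
  case (insert x S)
  show ?case
  proof (cases "x \<in> S")
    case True
    then show ?thesis using insert by (simp add: insert_absorb)
  next
    case False
    have "real (card {y \<in> S. f y \<le> d}) \<le> B * d" if "d > 0" for d
    proof -
      have "card {y \<in> S. f y \<le> d} \<le> card {y \<in> insert x S. f y \<le> d}"
        using insert.hyps by (intro card_mono) auto
      then show ?thesis using insert.prems(3)[OF that] by linarith
    qed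
    then have IH: "(\<Sum>x\<in>S. 1 / f x) \<le> B * harm (card S)"
      using insert by auto
    \<comment> \<open>The induction adds elements in increasing order of \<open>f\<close>, so at d =
      f x the hypothesis counts all of them.\<close>
    have "{y \<in> insert x S. f y \<le> f x} = insert x S" using insert.hyps by auto
    then have "real (card (insert x S)) \<le> B * f x"
      using insert.prems(1)[of x] insert.prems(3)[of "f x"] by simp
    then have "1 / f x \<le> B * inverse (real (card (insert x S)))"
      using insert.prems(1)[of x] insert.hyps False by (simp add: field_simps)
    then show ?thesis
      using IH False insert.hyps by (simp add: harm_Suc algebra_simps)
  qed
qed (simp add: harm_def)

text \<open>
  Two integer vectors with values at most \<open>d\<close> differ by a vector with value at most \<open>d\<close>, hence of height
  at least \<open>l = (c / d)\<^bsup>1/v\<^esup>\<close>. So at most \<open>(4T / l)\<^bsup>k\<^esup>\<close> of them have height at most \<open>T\<close>, where \<open>k\<close> is the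
  number of coordinates, and as \<open>v \<ge> k\<close> this is linear in \<open>d\<close>.
\<close>

lemma sum_inverse_lin_norm:
  fixes A :: "nat \<Rightarrow> nat \<Rightarrow> 'p::prime_card padic"
  defines "S \<equiv> \<lambda>K T. {q \<in> K \<rightarrow>\<^sub>E \<int>. 0 < real_maxnorm K q \<and> real_maxnorm K q \<le> T}"
  assumes I: "finite I" "I \<noteq> {}" and J: "finite J" and c: "c > 0"
    and v: "real (card (I \<union> J)) \<le> v"
    and low: "\<And>q. \<forall>i\<in>I \<union> J. q i \<in> \<int> \<Longrightarrow> real_maxnorm (I \<union> J) q > 0
       \<Longrightarrow> c * real_maxnorm (I \<union> J) q powr (- v) \<le> lin_norm I J A q"
    and T: "T \<ge> 1"
  shows "(\<Sum>q\<in>S (I \<union> J) T. 1 / lin_norm I J A q)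
    \<le> 4 ^ card (I \<union> J) * T powr v / c * harm (card (S (I \<union> J) T))"
proof -
  let ?K = "I \<union> J" and ?\<eta> = "lin_norm I J A"
  let ?m = "card ?K"
  have K: "finite ?K" "?K \<noteq> {}" using I J by auto
  have m: "?m \<ge> 1" using K by (simp add: Suc_leI card_gt_0_iff)
  then have v0: "v > 0" using v by linarith
  have fin: "finite (S ?K T)"
    unfolding S_def using finite_integer_vectors[OF K, of T] by (rule rev_finite_subset) auto
  have pos: "?\<eta> q > 0" if "q \<in> S ?K T" for q
  proof -
    have "0 < c * real_maxnorm ?K q powr (- v)" using that c by (auto simp: S_def)
    also have "\<dots> \<le> ?\<eta> q" using that by (intro low) (auto simp: S_def)
    finally show ?thesis .
  qed
  have count: "real (card {q \<in> S ?K T. ?\<eta> q \<le> d}) \<le> 4 ^ ?m * T powr v / c * d" if d: "d > 0" for d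
  proof (cases "{q \<in> S ?K T. ?\<eta> q \<le> d} = {}")
    case True
    then show ?thesis using d c T by (simp only: card.empty) simp
  next
    case False
    define l where "l = (c / d) powr (1 / v)"
    have l: "l > 0" "l powr v = c / d" using c d v0 by (simp_all add: l_def powr_powr)
    have sep: "l \<le> real_maxnorm ?K q"
      if "\<forall>i\<in>?K. q i \<in> \<int>" "real_maxnorm ?K q > 0" "?\<eta> q \<le> d" for q
    proof -
      let ?x = "real_maxnorm ?K q"
      have "c * ?x powr (- v) \<le> d" using low[OF that(1,2)] that(3) by linarith
      then have "l powr v \<le> ?x powr v"
        using that(2) d c by (simp add: l powr_minus field_simps)
      then show ?thesis
        using l(1) that(2) v0 powr_less_mono2[of v ?x l] by (cases "l \<le> ?x") auto
    qed
    obtain q where q: "q \<in> S ?K T" "?\<eta> q \<le> d" using False by blast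
    \<comment> \<open>A member of the set gives T / l \<ge> 1, so that the exponent of T / l can be
      raised from \<open>?m\<close> to \<open>v\<close>; the empty set was treated apart for this
      reason.\<close>
    have "l \<le> real_maxnorm ?K q" using q by (intro sep) (auto simp: S_def)
    also have "\<dots> \<le> T" using q by (simp add: S_def)
    finally have lT: "l \<le> T" .
    have "real (card {q \<in> S ?K T. ?\<eta> q \<le> d}) \<le> (4 * T / l) ^ ?m"
    proof (rule card_separated_integer_vectors[OF K _ _ l(1) lT])
      fix q r assume qr: "q \<in> {q \<in> S ?K T. ?\<eta> q \<le> d}" "r \<in> {q \<in> S ?K T. ?\<eta> q \<le> d}" "q \<noteq> r"
      have PiE: "q \<in> ?K \<rightarrow>\<^sub>E \<int>" "r \<in> ?K \<rightarrow>\<^sub>E \<int>" using qr by (auto simp: S_def)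
      obtain i where i: "i \<in> ?K" "q i \<noteq> r i" using PiE_ext[OF PiE] qr(3) by blast
      then have "0 < real_of_rat \<bar>q i - r i\<bar>" by simp
      then have "0 < real_maxnorm ?K (\<lambda>i. q i - r i)"
        using real_maxnorm_ge[OF K(1) i(1), of "\<lambda>i. q i - r i"] by linarith
      moreover have "?\<eta> (\<lambda>i. q i - r i) \<le> d"
        using lin_norm_diff[OF I, of J A q r] qr by auto
      moreover have "\<forall>i\<in>?K. q i - r i \<in> \<int>" using PiE by (auto intro!: Ints_diff)
      ultimately show "l \<le> real_maxnorm ?K (\<lambda>i. q i - r i)" by (intro sep)
    qed (auto simp: S_def)
    also have "\<dots> = 4 ^ ?m * (T / l) ^ ?m" by (simp add: power_mult_distrib power_divide)
    also have "\<dots> = 4 ^ ?m * (T / l) powr real ?m"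
      using T l(1) by (simp add: powr_realpow)
    also have "\<dots> \<le> 4 ^ ?m * (T / l) powr v"
      using v lT l(1) by (intro mult_left_mono powr_mono) auto
    also have "\<dots> = 4 ^ ?m * T powr v / c * d"
      using T l c d by (simp add: powr_divide)
    finally show ?thesis .
  qed
  show ?thesis
    by (rule sum_inverse_le_harm[OF fin pos _ count]) (use c in simp_all)
qed

text \<open>Distinct integral vectors are separated by 1.\<close>

lemma card_integer_vectors_le:
  assumes K: "finite K" "K \<noteq> {}" and T: "T \<ge> 1"
  shows "real (card {q \<in> K \<rightarrow>\<^sub>E (\<int> :: rat set). 0 < real_maxnorm K q \<and> real_maxnorm K q \<le> T}) \<le> (4 * T) ^ card K"
proof -
  have "real (card {q \<in> K \<rightarrow>\<^sub>E (\<int> :: rat set). 0 < real_maxnorm K q \<and> real_maxnorm K q \<le> T}) \<le> (4 * T / 1) ^ card K"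
  proof (rule card_separated_integer_vectors[OF K])
    fix q r :: "nat \<Rightarrow> rat"
    assume qr: "q \<in> {q \<in> K \<rightarrow>\<^sub>E \<int>. 0 < real_maxnorm K q \<and> real_maxnorm K q \<le> T}"
      "r \<in> {q \<in> K \<rightarrow>\<^sub>E \<int>. 0 < real_maxnorm K q \<and> real_maxnorm K q \<le> T}" "q \<noteq> r"
    then have PiE: "q \<in> K \<rightarrow>\<^sub>E \<int>" "r \<in> K \<rightarrow>\<^sub>E \<int>" by auto
    obtain i where i: "i \<in> K" "q i \<noteq> r i" using PiE_ext[OF PiE] qr(3) by blast
    then have "0 < real_of_rat \<bar>q i - r i\<bar>" by simp
    then have "0 < real_maxnorm K (\<lambda>i. q i - r i)"
      using real_maxnorm_ge[OF K(1) i(1), of "\<lambda>i. q i - r i"] by linarith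
    then show "1 \<le> real_maxnorm K (\<lambda>i. q i - r i)"
      using PiE by (intro real_maxnorm_ge_1[OF K]) (auto intro!: Ints_diff)
  qed (use T in auto)
  then show ?thesis by simp
qed

text \<open>The sequence harm N - ln N decreases and equals 1 at N = 1.\<close>

lemma harm_le_ln:
  assumes "N \<ge> 1"
  shows "harm N \<le> 1 + ln (real N)"
proof -
  obtain M where M: "N = Suc M" using assms by (cases N) auto
  have "harm (Suc M) - ln (real (Suc M)) \<le> harm (Suc 0) - ln (real (Suc 0))"
    using decseq_harm_diff_ln unfolding decseq_def by blast
  then show ?thesis by (simp add: M harm_Suc harm_def)
qed

text \<open>Writing a + b j = b (j + 1) + (a - b) leaves the geometric series and its
  derivative.\<close>

lemma summable_linear_times_power:
  fixes x :: real
  assumes "0 \<le> x" "x < 1"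
  shows "summable (\<lambda>j. (a + b * real j) * x ^ j)"
proof -
  have "summable (\<lambda>j. of_nat (Suc j) * x ^ j)"
    using geometric_deriv_sums[of x] assms sums_summable by auto
  from summable_add[OF summable_mult[OF this, of b] summable_mult[OF summable_geometric[of x], of "a - b"]]
  have "summable (\<lambda>j. b * (of_nat (Suc j) * x ^ j) + (a - b) * x ^ j)" using assms by auto
  then show ?thesis by (simp add: algebra_simps)
qed

section \<open>Affine subspaces\<close>

lemma sum_R_mat:
  assumes "s \<le> n" "i \<le> s"
  shows "(\<Sum>j=0..n. R_mat s A i j * of_rat (q j)) = (\<Sum>j=s+1..n. A i j * of_rat (q j)) + of_rat (q i)"
proof -
  have "(\<Sum>j=0..n. R_mat s A i j * of_rat (q j))
      = (\<Sum>j\<in>{0..s}. R_mat s A i j * of_rat (q j)) + (\<Sum>j=s+1..n. R_mat s A i j * of_rat (q j))"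
    using assms by (subst sum.union_disjoint[symmetric]) (auto intro!: sum.cong)
  also have "(\<Sum>j\<in>{0..s}. R_mat s A i j * of_rat (q j)) = (\<Sum>j\<in>{0..s}. if i = j then of_rat (q j) else 0)"
    by (intro sum.cong) (auto simp: R_mat_def)
  also have "\<dots> = of_rat (q i)" using assms by (simp add: sum.delta')
  also have "(\<Sum>j=s+1..n. R_mat s A i j * of_rat (q j)) = (\<Sum>j=s+1..n. A i j * of_rat (q j))"
    by (intro sum.cong) (auto simp: R_mat_def)
  finally show ?thesis by (simp add: add.commute)
qed

lemma sum_mult_R_mat_id:
  fixes x :: "nat \<Rightarrow> 'p::prime_card padic"
  assumes "j \<le> s"
  shows "(\<Sum>i=0..s. x i * R_mat s A i j) = x j"
proof -
  have "(\<Sum>i=0..s. x i * R_mat s A i j) = (\<Sum>i\<in>{0..s}. if i = j then x i else 0)"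
    using assms by (intro sum.cong) (auto simp: R_mat_def)
  then show ?thesis using assms by simp
qed

text \<open>Multiply (1, y) = (1, x) R_A by q. The identity block of \<open>R_mat\<close> gives x_i
  = y_i for i \<le> s, so the parameter can be replaced by coordinates of \<open>y\<close>.\<close>

lemma affine_subspace_dot:
  fixes y :: "nat \<Rightarrow> 'p::prime_card padic"
  assumes sn: "s \<le> n" and y: "y \<in> affine_subspace s n A"
  shows "(\<Sum>j=1..n. y j * of_rat (q j)) + of_rat (q 0)
    = (\<Sum>i=0..s. (y(0 := 1)) i * ((\<Sum>j=s+1..n. A i j * of_rat (q j)) + of_rat (q i)))"
proof -
  obtain x where x: "\<forall>j\<in>{0..n}. (y(0 := 1)) j = (\<Sum>i=0..s. (x(0 := 1)) i * R_mat s A i j)"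
    using y by (auto simp: affine_subspace_def)
  have xy: "(y(0 := 1)) i = (x(0 := 1)) i" if "i \<in> {0..s}" for i
    using x that sn sum_mult_R_mat_id[of i s "x(0 := 1)" A] by auto
  have "(\<Sum>j=1..n. y j * of_rat (q j)) + of_rat (q 0) = (\<Sum>j=0..n. (y(0 := 1)) j * of_rat (q j))"
    by (simp add: sum.atLeast_Suc_atMost add.commute)
  also have "\<dots> = (\<Sum>j=0..n. \<Sum>i=0..s. (x(0 := 1)) i * (R_mat s A i j * of_rat (q j)))"
    using x by (intro sum.cong) (auto simp: sum_distrib_right mult.assoc)
  also have "\<dots> = (\<Sum>i=0..s. (x(0 := 1)) i * (\<Sum>j=0..n. R_mat s A i j * of_rat (q j)))"
    by (subst sum.swap) (simp add: sum_distrib_left)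
  also have "\<dots> = (\<Sum>i=0..s. (y(0 := 1)) i * ((\<Sum>j=s+1..n. A i j * of_rat (q j)) + of_rat (q i)))"
    using xy sum_R_mat[OF sn, of _ A q] by (intro sum.cong) auto
  finally show ?thesis .
qed

lemma lin_norm_point_le:
  fixes y :: "nat \<Rightarrow> 'p::prime_card padic"
  assumes sn: "s \<le> n" and y: "y \<in> affine_subspace s n A"
  obtains X where "X > 0"
    "\<And>q. lin_norm {0} {1..n} (\<lambda>_. y) q \<le> X * lin_norm {0..s} {s+1..n} A q"
proof -
  define y' where "y' = y(0 := 1)"
  obtain M where M: "\<forall>i\<in>{0::nat}. \<forall>j\<in>{0..s}. padic_norm (y' j) \<le> real CARD('p) ^ M"
    using obtain_coefficient_bound[of "{0}" "{0..s}" "\<lambda>_. y'"] by auto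
  have p: "real CARD('p) > 1" by (rule prime_card_gt_1)
  show ?thesis
  proof (rule that)
    show "real CARD('p) ^ M > 0" using p by simp
    fix q
    let ?\<eta> = "lin_norm {0..s} {s+1..n} A q"
    let ?r = "\<lambda>i. (\<Sum>j=s+1..n. A i j * of_rat (q j)) + of_rat (q i)"
    have "padic_norm (\<Sum>i=0..s. y' i * ?r i) \<le> real CARD('p) ^ M * ?\<eta>"
    proof (rule padic_norm_sum_le)
      show "0 \<le> real CARD('p) ^ M * ?\<eta>" by (intro mult_nonneg_nonneg lin_norm_nonneg) auto
      fix i assume i: "i \<in> {0..s}"
      then have "padic_norm (?r i) \<le> ?\<eta>"
        unfolding lin_norm_def by (intro padic_maxnorm_ge[of _ _ ?r]) auto
      then show "padic_norm (y' i * ?r i) \<le> real CARD('p) ^ M * ?\<eta>"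
        unfolding padic_norm_mult using M i p by (intro mult_mono) auto
    qed
    then show "lin_norm {0} {1..n} (\<lambda>_. y) q \<le> real CARD('p) ^ M * ?\<eta>"
      by (simp only: lin_norm_single affine_subspace_dot[OF sn y] y'_def)
  qed
qed

text \<open>At large heights any decrease of the exponent outweighs the constant
  \<open>X\<close>.\<close>

lemma int_approx_scale:
  assumes "int_approx K \<eta> u" "t < u" "X > 0" "\<And>q. \<eta>' q \<le> X * \<eta> q"
  shows "int_approx K \<eta>' t"
  unfolding int_approx_def
proof
  fix N
  have "((\<lambda>x::real. x powr (t - u)) \<longlongrightarrow> 0) at_top"
    using assms(2) by (intro tendsto_neg_powr filterlim_ident) auto
  then have "eventually (\<lambda>x::real. x powr (t - u) < 1 / X) at_top"
    using assms(3) by (intro order_tendstoD) auto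
  then obtain L where L: "\<And>x. x \<ge> L \<Longrightarrow> x powr (t - u) < 1 / X"
    by (auto simp: eventually_at_top_linorder)
  obtain q where q: "\<forall>i\<in>K. q i \<in> \<int>" "max N (max L 0) < real_maxnorm K q"
      "\<eta> q \<le> real_maxnorm K q powr (- u)"
    using assms(1) unfolding int_approx_def by blast
  define x where "x = real_maxnorm K q"
  have x: "x > N" "x > L" "x > 0" using q(2) by (auto simp: x_def)
  have "\<eta>' q \<le> X * x powr (- u)"
    unfolding x_def using assms(3) by (intro order_trans[OF assms(4) mult_left_mono[OF q(3)]]) simp
  also have "x powr (- u) = x powr (t - u) * x powr (- t)"
    by (simp flip: powr_add)
  also have "X * \<dots> \<le> X * (1 / X * x powr (- t))"
    using L[of x] x assms(3) by (intro mult_left_mono mult_right_mono) auto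
  also have "\<dots> = x powr (- t)" using assms(3) by simp
  finally show "\<exists>q. (\<forall>i\<in>K. q i \<in> \<int>) \<and> N < real_maxnorm K q \<and> \<eta>' q \<le> real_maxnorm K q powr (- t)"
    using q(1) x(1) unfolding x_def by (intro exI[of _ q]) simp
qed

lemma less_w_vec_of_less_w_mat:
  fixes y :: "nat \<Rightarrow> 'p::prime_card padic"
  assumes sn: "s < n" and y: "y \<in> affine_subspace s n A"
    and v: "v \<ge> 0" "ereal v < w_mat {0..s} {s+1..n} A"
  shows "ereal v < w_vec n y"
proof -
  have K: "{0..s} \<union> {s+1..n} = {0..n}" using sn by auto
  obtain u where u: "u > v" "int_approx {0..n} (lin_norm {0..s} {s+1..n} A) u"
    using v(2) sn less_w_mat_iff[of "{0..s}" "{s+1..n}" v A] unfolding K by auto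
  obtain X where X: "X > 0" "\<And>q. lin_norm {0} {1..n} (\<lambda>_. y) q \<le> X * lin_norm {0..s} {s+1..n} A q"
    using lin_norm_point_le[OF less_imp_le[OF sn] y] by blast
  have "int_approx {0..n} (lin_norm {0} {1..n} (\<lambda>_. y)) ((u + v) / 2)"
    using u(1) by (intro int_approx_scale[OF u(2) _ X]) auto
  then show ?thesis
    using u(1) v(1) by (subst less_w_vec_iff) (auto intro!: exI[of _ "(u + v) / 2"])
qed

section \<open>Measurability\<close>

text \<open>The set is a countable union over k of countable intersections over N of countable
  unions over q of closed sets. Monotonicity of \<open>int_approx\<close> in the exponent permits
  the restriction to the exponents \<open>v + 1 / (k + 1)\<close>.\<close>

lemma w_vec_superlevel_measurable:
  assumes v: "v \<ge> 0"
  shows "{y \<in> space (padic_borel {1..n}). ereal v < w_vec n y}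
    \<in> sets (padic_borel {1..n} :: (nat \<Rightarrow> 'p::prime_card padic) measure)"
proof -
  let ?M = "padic_borel {1..n} :: (nat \<Rightarrow> 'p padic) measure"
  let ?\<eta> = "\<lambda>y. lin_norm {0} {1..n} (\<lambda>_. y :: nat \<Rightarrow> 'p padic)"
  let ?Z = "{0..n} \<rightarrow>\<^sub>E (\<int> :: rat set)"
  let ?u = "\<lambda>k::nat. v + inverse (real (Suc k))"
  let ?E = "\<lambda>k q. {y \<in> {1..n} \<rightarrow>\<^sub>E UNIV. ?\<eta> y q \<le> real_maxnorm {0..n} q powr (- ?u k)}"
  have K: "{0} \<union> {1..n} = {0..n}" by auto
  have E: "?E k q \<in> sets ?M" for k q
  proof -
    have "?E k q = {y \<in> {1..n} \<rightarrow>\<^sub>E UNIV.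
        padic_norm (of_rat (q 0) + (\<Sum>j\<in>{1..n}. y j * of_rat (q j))) \<le> real_maxnorm {0..n} q powr (- ?u k)}"
      by (simp add: lin_norm_single add.commute)
    then show ?thesis by (simp only:) (rule padic_affine_sublevel_measurable, auto)
  qed
  have Z: "countable ?Z"
    by (intro countable_PiE) (auto simp: Ints_def)
  have approx: "int_approx {0..n} (?\<eta> y) (?u k) \<longleftrightarrow>
      (\<forall>N::nat. \<exists>q\<in>?Z. real N < real_maxnorm {0..n} q \<and> ?\<eta> y q \<le> real_maxnorm {0..n} q powr (- ?u k))"
    (is "_ \<longleftrightarrow> ?R") for y k
  proof
    assume app: "int_approx {0..n} (?\<eta> y) (?u k)"
    show ?R
    proof
      fix N :: nat
      obtain q where q: "\<forall>i\<in>{0..n}. q i \<in> \<int>" "real N < real_maxnorm {0..n} q"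
          "?\<eta> y q \<le> real_maxnorm {0..n} q powr (- ?u k)"
        using app unfolding int_approx_def by blast
      have "real_maxnorm {0..n} (restrict q {0..n}) = real_maxnorm {0..n} q"
        by (intro real_maxnorm_cong) auto
      moreover have "?\<eta> y (restrict q {0..n}) = ?\<eta> y q"
        using lin_norm_restrict[of "{0}" "{1..n}"] unfolding K .
      moreover have "restrict q {0..n} \<in> ?Z" using q(1) by auto
      ultimately show "\<exists>q\<in>?Z. real N < real_maxnorm {0..n} q \<and> ?\<eta> y q \<le> real_maxnorm {0..n} q powr (- ?u k)"
        using q by (intro bexI[of _ "restrict q {0..n}"]) simp_all
    qed
  next
    assume R: ?R
    show "int_approx {0..n} (?\<eta> y) (?u k)"
      unfolding int_approx_def
    proof
      fix N :: real
      obtain N' :: nat where N': "N < real N'" using reals_Archimedean2 by blast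
      obtain q where "q \<in> ?Z" "real N' < real_maxnorm {0..n} q" "?\<eta> y q \<le> real_maxnorm {0..n} q powr (- ?u k)"
        using R by blast
      then show "\<exists>q. (\<forall>i\<in>{0..n}. q i \<in> \<int>) \<and> N < real_maxnorm {0..n} q \<and>
          ?\<eta> y q \<le> real_maxnorm {0..n} q powr (- ?u k)"
        using N' by (intro exI[of _ q]) auto
    qed
  qed
  have gt: "ereal v < w_vec n y \<longleftrightarrow> (\<exists>k. int_approx {0..n} (?\<eta> y) (?u k))" for y
  proof
    assume "ereal v < w_vec n y"
    then obtain u where u: "u > v" "int_approx {0..n} (?\<eta> y) u"
      using less_w_vec_iff[OF v] by blast
    obtain k where "inverse (real (Suc k)) < u - v"
      using reals_Archimedean[of "u - v"] u(1) by auto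
    then have "int_approx {0..n} (?\<eta> y) (?u k)"
      by (intro int_approx_mono[OF _ _ u(2)]) auto
    then show "\<exists>k. int_approx {0..n} (?\<eta> y) (?u k)" ..
  next
    assume "\<exists>k. int_approx {0..n} (?\<eta> y) (?u k)"
    then obtain k where "int_approx {0..n} (?\<eta> y) (?u k)" by blast
    moreover have "v < ?u k" by simp
    ultimately show "ereal v < w_vec n y"
      using less_w_vec_iff[OF v, of n y] by blast
  qed
  let ?U = "\<lambda>k N. \<Union>q\<in>{q \<in> ?Z. real N < real_maxnorm {0..n} q}. ?E k q"
  have "{y \<in> space ?M. ereal v < w_vec n y} = (\<Union>k. \<Inter>N::nat. ?U k N)"
  proof (rule Set.set_eqI)
    fix y
    show "y \<in> {y \<in> space ?M. ereal v < w_vec n y} \<longleftrightarrow> y \<in> (\<Union>k. \<Inter>N::nat. ?U k N)"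
    proof (cases "y \<in> space ?M")
      case True
      then have Om: "(y \<in> {1..n} \<rightarrow>\<^sub>E UNIV) = True" by (simp only: space_padic_borel)
      have "y \<in> ?U k N \<longleftrightarrow> (\<exists>q\<in>?Z. real N < real_maxnorm {0..n} q \<and>
          ?\<eta> y q \<le> real_maxnorm {0..n} q powr (- ?u k))" for k N
        by (simp only: UN_iff Om Bex_def mem_Collect_eq conj_assoc simp_thms)
      then have "y \<in> (\<Union>k. \<Inter>N::nat. ?U k N) \<longleftrightarrow> ereal v < w_vec n y"
        by (simp only: UN_iff INT_iff bex_UNIV ball_UNIV gt approx)
      with True show ?thesis by (simp only: mem_Collect_eq simp_thms)
    next
      case False
      then have "y \<notin> ?U k N" for k N by (simp only: UN_iff mem_Collect_eq space_padic_borel) simp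
      with False show ?thesis by (simp only: UN_iff INT_iff mem_Collect_eq) simp
    qed
  qed
  also have "\<dots> \<in> sets ?M"
  proof -
    have U: "?U k N \<in> sets ?M" for k N
    proof (rule sets.countable_UN')
      show "countable {q \<in> ?Z. real N < real_maxnorm {0..n} q}"
        by (rule countable_subset[OF Collect_restrict Z])
    qed (rule image_subsetI, rule E)
    have "(\<Inter>N::nat. ?U k N) \<in> sets ?M" for k
      by (rule sets.countable_INT, rule image_subsetI, rule U, rule UNIV_not_empty)
    then show ?thesis
      by - (rule sets.countable_UN, rule image_subsetI)
  qed
  finally show ?thesis .
qed

lemma haar_measure_space:
  assumes "haar_measure I (\<nu> :: (nat \<Rightarrow> 'p::prime_card padic) measure)"
  shows "space \<nu> = I \<rightarrow>\<^sub>E UNIV"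
proof -
  have "sets \<nu> = sets (padic_borel I)" using assms by (simp add: haar_measure_def)
  then show ?thesis using sets_eq_imp_space_eq space_padic_borel[of I, where 'p='p] by blast
qed

lemma affine_isomorphism_measurable:
  fixes \<nu> :: "(nat \<Rightarrow> 'p::prime_card padic) measure"
  assumes haar: "haar_measure {1..s} \<nu>" and \<phi>: "affine_isomorphism s n L \<phi>"
  shows "\<phi> \<in> measurable \<nu> (padic_borel {1..n})"
proof -
  let ?T = "\<lambda>k. product_topology (\<lambda>_. euclidean :: 'p padic topology) {1..k::nat}"
  have sets: "sets \<nu> = sets (padic_borel {1..s})" using haar by (simp add: haar_measure_def)
  note space = haar_measure_space[OF haar]
  obtain b c where \<phi>eq: "\<And>x. x \<in> {1..s} \<rightarrow>\<^sub>E UNIV \<Longrightarrow> \<phi> x = (\<lambda>j\<in>{1..n}. b j + (\<Sum>i=1..s. x i * c i j))"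
    using \<phi> by (auto simp: affine_isomorphism_def)
  have cont: "continuous_map (?T s) (?T n) (\<lambda>x. \<lambda>j\<in>{1..n}. b j + (\<Sum>i=1..s. x i * c i j))"
    by (subst continuous_map_componentwise) (auto intro!: continuous_map_padic_affine)
  show ?thesis
    unfolding padic_borel_def
  proof (rule measurable_measure_of)
    show "{U. openin (?T n) U} \<subseteq> Pow ({1..n} \<rightarrow>\<^sub>E UNIV)"
      using openin_subset by fastforce
    show "\<phi> \<in> space \<nu> \<rightarrow> {1..n} \<rightarrow>\<^sub>E UNIV"
      by (auto simp: space \<phi>eq)
    fix U assume "U \<in> {U. openin (?T n) U}"
    then have "openin (?T s) {x \<in> topspace (?T s). (\<lambda>j\<in>{1..n}. b j + (\<Sum>i=1..s. x i * c i j)) \<in> U}"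
      by (intro openin_continuous_map_preimage[OF cont]) simp
    moreover have "\<phi> -` U \<inter> space \<nu> = {x \<in> topspace (?T s). (\<lambda>j\<in>{1..n}. b j + (\<Sum>i=1..s. x i * c i j)) \<in> U}"
      using \<phi>eq by (auto simp: space)
    ultimately show "\<phi> -` U \<inter> space \<nu> \<in> sets \<nu>"
      unfolding sets sets_padic_borel by (intro sigma_sets.Basic) simp
  qed
qed

text \<open>The coefficients depend on \<phi>, the values r(q) on \<open>A\<close>. To compare them,
  evaluate the form at the \<phi>-preimages of the points with parameter 0 and with the unit vectors
  as parameters: the values are r_0 and r_0 + r_k. Coefficients that are all too small would make
  these values small, and with them every r_k. \<open>P\<close> bounds the coordinates of the
  preimages.\<close>

lemma affine_coefficients_lower_bound:
  fixes A :: "nat \<Rightarrow> nat \<Rightarrow> 'p::prime_card padic"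
  assumes sn: "s < n" and surj: "\<phi> ` ({1..s} \<rightarrow>\<^sub>E UNIV) = affine_subspace s n A"
    and dot: "\<And>x q. x \<in> {1..s} \<rightarrow>\<^sub>E UNIV \<Longrightarrow>
      (\<Sum>j=1..n. \<phi> x j * of_rat (q j)) + of_rat (q 0) = g0 q + (\<Sum>i\<in>{1..s}. x i * g q i)"
  obtains P :: real where "P \<ge> 1"
    "\<And>q. lin_norm {0..s} {s+1..n} A q > 0 \<Longrightarrow> lin_norm {0..s} {s+1..n} A q / P \<le> padic_norm (g0 q) \<or>
      (\<exists>i\<in>{1..s}. lin_norm {0..s} {s+1..n} A q / P \<le> padic_norm (g q i))"
proof -
  have p: "real CARD('p) > 1" by (rule prime_card_gt_1)
  \<comment> \<open>\<open>x 0\<close> is the zero vector, since indices start at 1; the other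
    \<open>x k\<close> with k \<le> s are the unit vectors.\<close>
  define x where "x k = (\<lambda>i\<in>{1..s}. if i = k then 1 else 0 :: 'p padic)" for k
  define y where "y k = (\<lambda>j\<in>{1..n}. \<Sum>i=0..s. ((x k)(0 := 1)) i * R_mat s A i j)" for k
  have yL: "y k \<in> affine_subspace s n A" for k
  proof -
    have "((y k)(0 := 1)) j = (\<Sum>i=0..s. ((x k)(0 := 1)) i * R_mat s A i j)" if "j \<in> {0..n}" for j
      using that sum_mult_R_mat_id[of 0 s "(x k)(0 := 1)" A] by (cases "j = 0") (auto simp: y_def)
    moreover have "x k \<in> {1..s} \<rightarrow>\<^sub>E UNIV" "y k \<in> {1..n} \<rightarrow>\<^sub>E UNIV" by (auto simp: x_def y_def)
    ultimately show ?thesis unfolding affine_subspace_def by blast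
  qed
  have "\<exists>z. z \<in> {1..s} \<rightarrow>\<^sub>E UNIV \<and> \<phi> z = y k" for k
  proof -
    have "y k \<in> \<phi> ` ({1..s} \<rightarrow>\<^sub>E UNIV)" unfolding surj by (rule yL)
    then obtain z where "y k = \<phi> z" "z \<in> {1..s} \<rightarrow>\<^sub>E UNIV" by (rule imageE)
    then show ?thesis by (intro exI[of _ z] conjI) (simp_all only:)
  qed
  then have "\<forall>k. \<exists>z. z \<in> {1..s} \<rightarrow>\<^sub>E UNIV \<and> \<phi> z = y k" by (rule allI)
  then obtain z where "\<forall>k. z k \<in> {1..s} \<rightarrow>\<^sub>E UNIV \<and> \<phi> (z k) = y k" by (rule choice[THEN exE])
  then have z: "z k \<in> {1..s} \<rightarrow>\<^sub>E UNIV" "\<phi> (z k) = y k" for k by simp_all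
  obtain M where M: "\<forall>k\<in>{0..s}. \<forall>i\<in>{1..s}. padic_norm (z k i) \<le> real CARD('p) ^ M"
    using obtain_coefficient_bound[of "{0..s}" "{1..s}" z] by blast
  define P where "P = real CARD('p) ^ M"
  have P: "P \<ge> 1" using p by (simp add: P_def)
  show ?thesis
  proof (rule that[OF P], rule ccontr)
    fix q
    define \<eta> where "\<eta> = lin_norm {0..s} {s+1..n} A q"
    define r where "r i = (\<Sum>j=s+1..n. A i j * of_rat (q j)) + of_rat (q i)" for i
    assume pos: "lin_norm {0..s} {s+1..n} A q > 0"
      and neg: "\<not> (lin_norm {0..s} {s+1..n} A q / P \<le> padic_norm (g0 q) \<or>
        (\<exists>i\<in>{1..s}. lin_norm {0..s} {s+1..n} A q / P \<le> padic_norm (g q i)))"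
    have \<eta>: "\<eta> > 0" using pos by (simp add: \<eta>_def)
    have g0: "padic_norm (g0 q) < \<eta> / P" and g: "\<And>i. i \<in> {1..s} \<Longrightarrow> padic_norm (g q i) < \<eta> / P"
      using neg by (auto simp: \<eta>_def not_le)
    have "\<eta> / P \<le> \<eta>" using P \<eta> by (simp add: divide_le_eq)
    have small: "padic_norm (\<Sum>i=0..s. ((y k)(0 := 1)) i * r i) < \<eta>" if k: "k \<in> {0..s}" for k
    proof -
      have "padic_norm (\<Sum>i\<in>{1..s}. z k i * g q i) < \<eta>"
      proof (rule padic_norm_sum_less[OF \<eta>])
        fix i assume i: "i \<in> {1..s}"
        have "padic_norm (z k i * g q i) \<le> P * padic_norm (g q i)"
          unfolding padic_norm_mult using M k i by (intro mult_right_mono) (auto simp: P_def)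
        also have "\<dots> < \<eta>" using g[OF i] P by (simp add: pos_less_divide_eq mult.commute)
        finally show "padic_norm (z k i * g q i) < \<eta>" .
      qed simp
      moreover have "padic_norm (g0 q) < \<eta>" using g0 \<open>\<eta> / P \<le> \<eta>\<close> by linarith
      ultimately have "padic_norm (g0 q + (\<Sum>i\<in>{1..s}. z k i * g q i)) < \<eta>"
        by (intro le_less_trans[OF padic_norm_add_max]) simp
      also have "g0 q + (\<Sum>i\<in>{1..s}. z k i * g q i) = (\<Sum>i=0..s. ((y k)(0 := 1)) i * r i)"
        using dot[OF z(1), of k q] affine_subspace_dot[OF less_imp_le[OF sn] yL, of k q]
        by (simp add: z(2) r_def)
      finally show ?thesis .
    qed
    have yi: "y k i = (if i = k then 1 else 0)" if "i \<in> {1..s}" for k i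
      using that sn sum_mult_R_mat_id[of i s "(x k)(0 := 1)" A] by (simp add: y_def x_def)
    have val: "(\<Sum>i=0..s. ((y k)(0 := 1)) i * r i) = r 0 + (if k = 0 then 0 else r k)" if k: "k \<in> {0..s}" for k
    proof -
      have "(\<Sum>i=0..s. ((y k)(0 := 1)) i * r i) = r 0 + (\<Sum>i=1..s. y k i * r i)"
        by (simp add: sum.atLeast_Suc_atMost)
      also have "(\<Sum>i=1..s. y k i * r i) = (\<Sum>i\<in>{1..s}. if i = k then r i else 0)"
        using yi by (intro sum.cong) auto
      also have "\<dots> = (if k = 0 then 0 else r k)" using k by auto
      finally show ?thesis .
    qed
    have r0: "padic_norm (r 0) < \<eta>" using small[of 0] val[of 0] by simp
    have "padic_norm (r k) < \<eta>" if k: "k \<in> {0..s}" for k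
    proof (cases "k = 0")
      case False
      then have "padic_norm (r 0 + r k) < \<eta>" using small[OF k] val[OF k] by simp
      then have "padic_norm ((r 0 + r k) - r 0) < \<eta>"
        using le_less_trans[OF padic_norm_diff_max[of "r 0 + r k" "r 0"]] r0 by simp
      then show ?thesis by simp
    qed (use r0 in simp)
    moreover obtain k where "k \<in> {0..s}" "\<eta> = padic_norm (r k)"
      using padic_maxnorm_attained[of "{0..s}" r] unfolding \<eta>_def lin_norm_def r_def by auto
    ultimately show False by force
  qed
qed


section \<open>The exponent of almost every point\<close>

lemma null_set_large_exponent:
  fixes A :: "nat \<Rightarrow> nat \<Rightarrow> 'p::prime_card padic"
  assumes sn: "s < n" and haar: "haar_measure {1..s} \<nu>"
    and \<phi>: "affine_isomorphism s n (affine_subspace s n A) \<phi>"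
    and v: "real (n + 1) < v" "w_mat {0..s} {s+1..n} A < ereal v"
  obtains N where "N \<in> null_sets \<nu>" "{x \<in> space \<nu>. ereal v < w_vec n (\<phi> x)} \<subseteq> N"
proof -
  let ?I = "{0..s}" and ?J = "{s+1..n}" and ?K = "{0..n}"
  let ?\<eta> = "lin_norm ?I ?J A" and ?H = "real_maxnorm ?K"
  have IJ: "?I \<union> ?J = ?K" using sn by auto
  have K: "finite ?K" "?K \<noteq> {}" by auto
  have sets: "sets \<nu> = sets (padic_borel {1..s})" using haar by (simp add: haar_measure_def)
  note space = haar_measure_space[OF haar]
  have "max (ereal (real (n + 1))) (w_mat ?I ?J A) < ereal v" using v by simp
  \<comment> \<open>\<open>u\<close> exceeds n + 1 for the counting and w(A) for the lower bound on
    values; its gap to \<open>v\<close> provides convergence.\<close>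
  then obtain u where u: "max (ereal (real (n + 1))) (w_mat ?I ?J A) < ereal u" "u < v"
    using ereal_dense2[of "max (ereal (real (n + 1))) (w_mat ?I ?J A)" "ereal v"] by auto
  \<comment> \<open>\<open>less_w_mat_iff\<close> wants an approximation exponent strictly above its
    argument, so \<open>u\<close> is compared with w(A) through a smaller \<open>t\<close>.\<close>
  obtain t where t: "w_mat ?I ?J A < ereal t" "t < u"
    using ereal_dense2[of "w_mat ?I ?J A" "ereal u"] u(1) by auto
  have un: "real (n + 1) < u" using u(1) by simp
  have "\<not> int_approx ?K ?\<eta> u"
  proof
    assume "int_approx ?K ?\<eta> u"
    then have "ereal t < w_mat ?I ?J A"
      using t(2) sn less_w_mat_iff[of ?I ?J t A] unfolding IJ by auto
    with t(1) show False by simp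
  qed
  then obtain c where c: "c > 0" "\<And>q. \<forall>i\<in>?K. q i \<in> \<int> \<Longrightarrow> ?H q > 0 \<Longrightarrow> c * ?H q powr (- u) \<le> ?\<eta> q"
    using not_int_approx_lower_bound[of ?I ?J u A] un unfolding IJ by auto
  obtain b d where \<phi>eq: "\<And>x. x \<in> {1..s} \<rightarrow>\<^sub>E UNIV \<Longrightarrow> \<phi> x = (\<lambda>j\<in>{1..n}. b j + (\<Sum>i=1..s. x i * d i j))"
    using \<phi> by (auto simp: affine_isomorphism_def)
  define g0 :: "(nat \<Rightarrow> rat) \<Rightarrow> 'p padic" where "g0 q = (\<Sum>j=1..n. b j * of_rat (q j)) + of_rat (q 0)" for q
  define g :: "(nat \<Rightarrow> rat) \<Rightarrow> nat \<Rightarrow> 'p padic" where "g q i = (\<Sum>j=1..n. d i j * of_rat (q j))" for q i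
  have dot: "(\<Sum>j=1..n. \<phi> x j * of_rat (q j)) + of_rat (q 0) = g0 q + (\<Sum>i\<in>{1..s}. x i * g q i)"
    if "x \<in> {1..s} \<rightarrow>\<^sub>E UNIV" for x q
  proof -
    have "(\<Sum>j=1..n. \<phi> x j * of_rat (q j))
        = (\<Sum>j=1..n. b j * of_rat (q j) + (\<Sum>i=1..s. x i * (d i j * of_rat (q j))))"
      using \<phi>eq[OF that] by (intro sum.cong) (simp_all add: distrib_right sum_distrib_right mult.assoc)
    also have "\<dots> = (\<Sum>j=1..n. b j * of_rat (q j)) + (\<Sum>i=1..s. x i * g q i)"
      unfolding g_def sum.distrib by (subst sum.swap) (simp add: sum_distrib_left)
    finally show ?thesis by (simp add: g0_def)
  qed
  have "\<phi> ` ({1..s} \<rightarrow>\<^sub>E UNIV) = affine_subspace s n A"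
    using \<phi> by (simp add: affine_isomorphism_def bij_betw_def)
  then obtain P where P: "P \<ge> 1" "\<And>q. ?\<eta> q > 0 \<Longrightarrow> ?\<eta> q / P \<le> padic_norm (g0 q) \<or>
      (\<exists>i\<in>{1..s}. ?\<eta> q / P \<le> padic_norm (g q i))"
    using affine_coefficients_lower_bound[OF sn _ dot] by blast
  have \<eta>pos: "?\<eta> q > 0" if "\<forall>i\<in>?K. q i \<in> \<int>" "?H q > 0" for q
  proof -
    have "0 < c * ?H q powr (- u)" using that c(1) by simp
    also have "\<dots> \<le> ?\<eta> q" by (rule c(2)[OF that])
    finally show ?thesis .
  qed
  define E where "E M q = {x \<in> padic_box {1..s} M.
      padic_norm (g0 q + (\<Sum>i\<in>{1..s}. x i * g q i)) \<le> ?H q powr (- v)}" for M q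
  define S where "S T = {q \<in> ?K \<rightarrow>\<^sub>E \<int>. 0 < ?H q \<and> ?H q \<le> T}" for T
  \<comment> \<open>Dyadic shells, on which |q|^(-v) is comparable to 2^(-j v); \<open>S\<close> is
    the full ball for which the sum of inverses is bounded.\<close>
  define R where "R j = {q \<in> ?K \<rightarrow>\<^sub>E \<int>. 2 ^ j \<le> ?H q \<and> ?H q \<le> 2 ^ (j + 1)}" for j :: nat
  define F where "F M j = (\<Union>q\<in>R j. E M q)" for M j
  have Sfin: "finite (S T)" for T
    unfolding S_def using finite_integer_vectors[OF K, of T] by (rule rev_finite_subset) auto
  have RS: "R j \<subseteq> S (2 ^ (j + 1))" for j
  proof
    fix q assume q: "q \<in> R j"
    have "(0::real) < 2 ^ j" by simp
    also have "\<dots> \<le> ?H q" using q by (simp add: R_def)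
    finally show "q \<in> S (2 ^ (j + 1))" using q by (simp add: R_def S_def)
  qed
  have Rfin: "finite (R j)" for j using RS Sfin finite_subset by blast
  have box: "padic_box {1..s} M \<in> sets \<nu>" for M unfolding sets by (rule padic_box_measurable)
  have boxfin: "emeasure \<nu> (padic_box {1..s} M) < \<infinity>" for M
    using haar compactin_padic_box unfolding haar_measure_def by blast
  have Emeas: "E M q \<in> sets \<nu>" for M q
  proof -
    have "E M q = padic_box {1..s} M \<inter> {x \<in> {1..s} \<rightarrow>\<^sub>E UNIV.
        padic_norm (g0 q + (\<Sum>i\<in>{1..s}. x i * g q i)) \<le> ?H q powr (- v)}"
      by (auto simp: E_def padic_box_def PiE_iff extensional_def)
    also have "\<dots> \<in> sets \<nu>"
      using box padic_affine_sublevel_measurable[of "{1..s}" "{1..s}" "g0 q" "g q"] unfolding sets by auto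
    finally show ?thesis .
  qed
  have Fmeas: "F M j \<in> sets \<nu>" for M j
    unfolding F_def using Emeas Rfin by (intro sets.finite_UN) auto
  have Fbox: "F M j \<subseteq> padic_box {1..s} M" for M j by (auto simp: F_def E_def)
  \<comment> \<open>Everything independent of \<open>q\<close> and \<open>j\<close>: the constant of
    \<open>haar_measure_affine_sublevel\<close> and the loss \<open>P\<close> in the
    coefficients.\<close>
  define D where "D M = 2 * real CARD('p) ^ M * measure \<nu> (padic_box {1..s} M) * P" for M
  have D: "D M \<ge> 0" for M using P by (simp add: D_def)
  have Ebound: "measure \<nu> (E M q) \<le> D M * (2 ^ j) powr (- v) * (1 / ?\<eta> q)" if q: "q \<in> R j" for M q j
  proof -
    have qS: "\<forall>i\<in>?K. q i \<in> \<int>" "?H q > 0" using RS q by (auto simp: S_def)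
    have \<eta>: "?\<eta> q > 0" by (rule \<eta>pos[OF qS])
    have "measure \<nu> (E M q) \<le> 2 * real CARD('p) ^ M * measure \<nu> (padic_box {1..s} M) * ?H q powr (- v) / (?\<eta> q / P)"
      unfolding E_def using haar P \<eta> qS(2) P(2)[OF \<eta>]
      by (intro haar_measure_affine_sublevel) (auto intro: divide_pos_pos)
    also have "\<dots> = D M * ?H q powr (- v) * (1 / ?\<eta> q)"
      using P \<eta> by (simp add: D_def field_simps)
    also have "\<dots> \<le> D M * (2 ^ j) powr (- v) * (1 / ?\<eta> q)"
    proof (intro mult_right_mono mult_left_mono D)
      show "?H q powr (- v) \<le> (2 ^ j) powr (- v)"
        using q un u(2) by (intro powr_mono2') (auto simp: R_def)
    qed (use \<eta> in simp)
    finally show ?thesis .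
  qed
  define m where "m = n + 1"
  have cardK: "card ?K = m" by (simp add: m_def)
  \<comment> \<open>\<open>2 powr u\<close> comes from T = 2 * 2^j, and
    \<open>1 + 3 * real m\<close> from the harmonic number.\<close>
  define W where "W = 4 ^ m * 2 powr u / c * (1 + 3 * real m)"
  have W: "W \<ge> 0" unfolding W_def using c(1) by (intro mult_nonneg_nonneg divide_nonneg_pos) auto
  \<comment> \<open>The ratio of the majorizing series, whose factor 1 + j is the logarithm of T up
    to a constant.\<close>
  define x where "x = 2 powr (u - v)"
  have x: "0 \<le> x" "x < 1" using u(2) powr_less_mono[of "u - v" 0 2] by (auto simp: x_def)
  have Fbound: "measure \<nu> (F M j) \<le> D M * W * ((1 + 1 * real j) * x ^ j)" for M j
  proof -
    let ?T = "2 ^ (j + 1) :: real"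
    have T: "?T \<ge> 1" by (rule one_le_power) simp
    \<comment> \<open>The ball has at most (4 T)^m = 2^((j + 3) m) vectors, and ln 2 < 1.\<close>
    have harm: "harm (card (S ?T)) \<le> (1 + 3 * real m) * (1 + real j)"
    proof (cases "card (S ?T) = 0")
      case False
      have "real (card (S ?T)) \<le> (4 * ?T) ^ m"
        using card_integer_vectors_le[OF K T] unfolding S_def cardK .
      also have "4 * ?T = 2 ^ (j + 3)" by (simp add: power_add)
      also have "(2 ^ (j + 3)) ^ m = (2::real) ^ ((j + 3) * m)" by (rule power_mult[symmetric])
      finally have "ln (real (card (S ?T))) \<le> ln (2 ^ ((j + 3) * m))"
        using False by (intro ln_mono) auto
      also have "\<dots> = real ((j + 3) * m) * ln 2" by (simp add: ln_realpow)
      also have "\<dots> \<le> real ((j + 3) * m) * 1"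
        using ln_2_less_1 by (intro mult_left_mono) auto
      finally have "harm (card (S ?T)) \<le> 1 + real ((j + 3) * m)"
        using harm_le_ln[of "card (S ?T)"] False by linarith
      also have "\<dots> \<le> (1 + 3 * real m) * (1 + real j)" by (simp add: algebra_simps)
      finally show ?thesis .
    qed (simp add: harm_def)
    have "measure \<nu> (F M j) \<le> (\<Sum>q\<in>R j. measure \<nu> (E M q))"
      unfolding F_def using Rfin Emeas by (intro measure_UNION_le) auto
    also have "\<dots> \<le> (\<Sum>q\<in>R j. D M * (2 ^ j) powr (- v) * (1 / ?\<eta> q))"
      by (intro sum_mono Ebound)
    also have "\<dots> = D M * (2 ^ j) powr (- v) * (\<Sum>q\<in>R j. 1 / ?\<eta> q)"
      by (rule sum_distrib_left[symmetric])
    also have "\<dots> \<le> D M * (2 ^ j) powr (- v) * (\<Sum>q\<in>S ?T. 1 / ?\<eta> q)"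
    proof (intro mult_left_mono sum_mono2 Sfin RS)
      fix q assume "q \<in> S ?T - R j"
      then have "?\<eta> q > 0" by (intro \<eta>pos) (auto simp: S_def)
      then show "0 \<le> 1 / ?\<eta> q" by simp
    qed (use D in simp)
    also have "\<dots> \<le> D M * (2 ^ j) powr (- v) * (4 ^ m * ?T powr u / c * harm (card (S ?T)))"
    proof (intro mult_left_mono)
      show "(\<Sum>q\<in>S ?T. 1 / ?\<eta> q) \<le> 4 ^ m * ?T powr u / c * harm (card (S ?T))"
        using sum_inverse_lin_norm[of ?I ?J c u A ?T] un c T unfolding IJ cardK S_def by (simp add: m_def)
    qed (use D in simp)
    also have "\<dots> \<le> D M * (2 ^ j) powr (- v) * (4 ^ m * ?T powr u / c * ((1 + 3 * real m) * (1 + real j)))"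
      using D harm c(1) by (intro mult_left_mono) auto
    also have "\<dots> = D M * W * ((1 + real j) * ((2 ^ j) powr (- v) * (2 ^ j) powr u))"
      by (simp add: W_def powr_mult)
    also have "(2 ^ j) powr (- v) * (2 ^ j) powr u = x ^ j"
      by (simp add: x_def powr_realpow[symmetric] powr_powr powr_add[symmetric] algebra_simps)
    finally show ?thesis by simp
  qed
  \<comment> \<open>The whole space may have infinite measure, so Borel-Cantelli is applied in one
    box at a time.\<close>
  have null: "limsup (F M) \<in> null_sets \<nu>" for M
  proof (rule borel_cantelli_limsup1[OF Fmeas])
    show "emeasure \<nu> (F M j) < \<infinity>" for j
      by (rule le_less_trans[OF emeasure_mono[OF Fbox box] boxfin])
    have "summable (\<lambda>j. D M * W * ((1 + 1 * real j) * x ^ j))"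
      by (rule summable_mult[OF summable_linear_times_power[OF x]])
    then show "summable (\<lambda>j. measure \<nu> (F M j))"
      by (rule summable_comparison_test'[of _ 0]) (simp only: real_norm_def abs_of_nonneg measure_nonneg Fbound)
  qed
  show ?thesis
  proof (rule that)
    show "(\<Union>M. limsup (F M)) \<in> null_sets \<nu>" using null by (intro null_sets_UN)
    show "{x \<in> space \<nu>. ereal v < w_vec n (\<phi> x)} \<subseteq> (\<Union>M. limsup (F M))"
    proof
      fix z assume z: "z \<in> {x \<in> space \<nu>. ereal v < w_vec n (\<phi> x)}"
      then have zE: "z \<in> {1..s} \<rightarrow>\<^sub>E UNIV" by (simp add: space)
      obtain M where M: "z \<in> padic_box {1..s} M"
        using padic_box_exhausts[OF zE] by auto
      let ?\<zeta> = "lin_norm {0} {1..n} (\<lambda>_. \<phi> z)"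
      have v0: "v \<ge> 0" using v(1) by linarith
      obtain w where w: "w > v" "int_approx ?K ?\<zeta> w"
        using z less_w_vec_iff[OF v0] by blast
      have app: "int_approx ?K ?\<zeta> v" by (rule int_approx_mono[OF K w(2)]) (use w in simp)
      have "\<exists>j\<ge>j0. z \<in> F M j" for j0
      proof -
        obtain q where q: "\<forall>i\<in>?K. q i \<in> \<int>" "2 ^ j0 < ?H q" "?\<zeta> q \<le> ?H q powr (- v)"
          using app unfolding int_approx_def by blast
        let ?q = "restrict q ?K"
        have Hq: "?H ?q = ?H q" by (intro real_maxnorm_cong) auto
        have \<zeta>q: "?\<zeta> ?q = ?\<zeta> q" by (intro lin_norm_cong) auto
        have H1: "1 \<le> ?H q" using q(2) one_le_power[of "2::real" j0] by linarith
        \<comment> \<open>\<open>ex_power_ivl1\<close> concerns natural numbers, so the height is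
          rounded down first; this respects the comparison with powers of 2.\<close>
        obtain j where j: "2 ^ j \<le> ?H q" "?H q < 2 ^ (j + 1)"
        proof -
          have "\<exists>j. 2 ^ j \<le> nat \<lfloor>?H q\<rfloor> \<and> nat \<lfloor>?H q\<rfloor> < 2 ^ (j + 1)"
            using H1 by (intro ex_power_ivl1) (auto simp: le_nat_iff)
          then obtain j where j: "2 ^ j \<le> nat \<lfloor>?H q\<rfloor>" "nat \<lfloor>?H q\<rfloor> < 2 ^ (j + 1)" by blast
          have "real (2 ^ j) \<le> ?H q" using j(1) H1 by (simp only: le_nat_iff le_floor_iff)
          moreover have "?H q < real (2 ^ (j + 1))"
          proof -
            have "\<lfloor>?H q\<rfloor> < int (2 ^ (j + 1))" using j(2) H1 by linarith
            then show ?thesis by linarith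
          qed
          ultimately show ?thesis using that[of j] by simp
        qed
        have "j0 \<le> j"
        proof (rule ccontr)
          assume "\<not> j0 \<le> j"
          then have "(2::real) ^ (j + 1) \<le> 2 ^ j0" by (intro power_increasing) auto
          then show False using j(2) q(2) by linarith
        qed
        have "?q \<in> R j" using q(1) j by (auto simp: R_def Hq)
        moreover have "z \<in> E M ?q"
        proof -
          have "padic_norm (g0 ?q + (\<Sum>i\<in>{1..s}. z i * g ?q i)) = ?\<zeta> ?q"
            unfolding lin_norm_single dot[OF zE] ..
          also have "\<dots> \<le> ?H ?q powr (- v)" unfolding Hq \<zeta>q by (rule q(3))
          finally show ?thesis using M by (simp add: E_def)
        qed
        ultimately show ?thesis using \<open>j0 \<le> j\<close> unfolding F_def by blast
      qed
      then have "z \<in> limsup (F M)" by (auto simp: limsup_INF_SUP)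
      then show "z \<in> (\<Union>M. limsup (F M))" by blast
    qed
  qed
qed

text \<open>Below the maximum every point of the subspace belongs to the set, and \<nu> is not zero.
  From the maximum on the set is null: \<open>null_set_large_exponent\<close> applies to each
  \<open>v + 1 / (k + 1)\<close>, and the union over k covers \<open>v\<close> itself.\<close>

lemma emeasure_superlevel_w_vec:
  fixes A :: "nat \<Rightarrow> nat \<Rightarrow> 'p::prime_card padic"
  assumes sn: "s < n" and haar: "haar_measure {1..s} \<nu>"
    and \<phi>: "affine_isomorphism s n (affine_subspace s n A) \<phi>"
    and \<mu>: "\<mu> = distr \<nu> (padic_borel {1..n}) \<phi>"
  shows "emeasure \<mu> {y \<in> space \<mu>. ereal v < w_vec n y} > 0
    \<longleftrightarrow> ereal v < max (ereal (real (n + 1))) (w_mat {0..s} {s+1..n} A)"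
proof -
  let ?B = "padic_borel {1..n} :: (nat \<Rightarrow> 'p padic) measure"
  let ?S = "{y \<in> space \<mu>. ereal v < w_vec n y}"
  have meas: "\<phi> \<in> measurable \<nu> ?B" by (rule affine_isomorphism_measurable[OF haar \<phi>])
  have space: "space \<mu> = space ?B" "sets \<mu> = sets ?B" by (simp_all add: \<mu>)
  have S: "?S \<in> sets ?B"
  proof (cases "v \<ge> 0")
    case True
    then show ?thesis using w_vec_superlevel_measurable[of v n] by (simp add: space)
  next
    \<comment> \<open>For negative \<open>v\<close> Dirichlet's theorem puts every point into the
      set.\<close>
    case False
    then have "?S = space ?B" using less_w_vec[of v n] by (auto simp: space)
    then show ?thesis by simp
  qed
  have em: "emeasure \<mu> ?S = emeasure \<nu> {x \<in> space \<nu>. ereal v < w_vec n (\<phi> x)}"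
  proof -
    have "emeasure \<mu> ?S = emeasure \<nu> (\<phi> -` ?S \<inter> space \<nu>)"
      unfolding \<mu> using meas S by (intro emeasure_distr) (simp_all add: \<mu>)
    also have "\<phi> -` ?S \<inter> space \<nu> = {x \<in> space \<nu>. ereal v < w_vec n (\<phi> x)}"
      using measurable_space[OF meas] by (auto simp: space)
    finally show ?thesis .
  qed
  show ?thesis
  proof
    assume pos: "emeasure \<mu> ?S > 0"
    show "ereal v < max (ereal (real (n + 1))) (w_mat {0..s} {s+1..n} A)"
    proof (rule ccontr)
      assume "\<not> ?thesis"
      then have le: "max (ereal (real (n + 1))) (w_mat {0..s} {s+1..n} A) \<le> ereal v" by (simp only: not_less)
      have ex: "\<exists>N\<in>null_sets \<nu>. {x \<in> space \<nu>. ereal (v + inverse (real (Suc k))) < w_vec n (\<phi> x)} \<subseteq> N" for k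
      proof -
        have "ereal v < ereal (v + inverse (real (Suc k)))" by simp
        then have "max (ereal (real (n + 1))) (w_mat {0..s} {s+1..n} A) < ereal (v + inverse (real (Suc k)))"
          using le le_less_trans by blast
        then have "real (n + 1) < v + inverse (real (Suc k))"
            "w_mat {0..s} {s+1..n} A < ereal (v + inverse (real (Suc k)))"
          by (simp_all only: max_less_iff_conj ereal_less_eq less_ereal.simps)
        then obtain N where "N \<in> null_sets \<nu>"
            "{x \<in> space \<nu>. ereal (v + inverse (real (Suc k))) < w_vec n (\<phi> x)} \<subseteq> N"
          by (rule null_set_large_exponent[OF sn haar \<phi>])
        then show ?thesis by (rule bexI[rotated])
      qed
      then have "\<forall>k. \<exists>N. N \<in> null_sets \<nu> \<and>
          {x \<in> space \<nu>. ereal (v + inverse (real (Suc k))) < w_vec n (\<phi> x)} \<subseteq> N"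
        unfolding Bex_def by (rule allI)
      then obtain N where "\<forall>k. N k \<in> null_sets \<nu> \<and>
          {x \<in> space \<nu>. ereal (v + inverse (real (Suc k))) < w_vec n (\<phi> x)} \<subseteq> N k"
        by (rule choice[THEN exE])
      then have N: "N k \<in> null_sets \<nu>"
          "{x \<in> space \<nu>. ereal (v + inverse (real (Suc k))) < w_vec n (\<phi> x)} \<subseteq> N k" for k
        by simp_all
      have "{x \<in> space \<nu>. ereal v < w_vec n (\<phi> x)} \<subseteq> (\<Union>k. N k)"
      proof
        fix x assume x: "x \<in> {x \<in> space \<nu>. ereal v < w_vec n (\<phi> x)}"
        then obtain r where r: "v < r" "ereal r < w_vec n (\<phi> x)"
          using ereal_dense2[of "ereal v" "w_vec n (\<phi> x)"] by auto
        obtain k where k: "inverse (real (Suc k)) < r - v" using reals_Archimedean[of "r - v"] r(1) by auto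
        then have "ereal (v + inverse (real (Suc k))) < ereal r" by simp
        then have "ereal (v + inverse (real (Suc k))) < w_vec n (\<phi> x)" using r(2) by (rule less_trans)
        then show "x \<in> (\<Union>k. N k)" using N(2)[of k] x by blast
      qed
      moreover have "(\<Union>k. N k) \<in> null_sets \<nu>" using N(1) by (intro null_sets_UN)
      ultimately have "emeasure \<nu> {x \<in> space \<nu>. ereal v < w_vec n (\<phi> x)} \<le> emeasure \<nu> (\<Union>k. N k)"
        "emeasure \<nu> (\<Union>k. N k) = 0"
        by (auto intro: emeasure_mono)
      with pos em show False by simp
    qed
  next
    assume less: "ereal v < max (ereal (real (n + 1))) (w_mat {0..s} {s+1..n} A)"
    have "ereal v < w_vec n (\<phi> x)" if x: "x \<in> space \<nu>" for x
    proof (cases "v < real n + 1")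
      case True
      then show ?thesis by (rule less_w_vec)
    next
      case False
      then have w: "ereal v < w_mat {0..s} {s+1..n} A" "v \<ge> 0"
        using less by (auto simp: max_def split: if_splits)
      have "\<phi> ` space \<nu> = affine_subspace s n A"
        using \<phi> haar_measure_space[OF haar] by (simp add: affine_isomorphism_def bij_betw_def)
      then have "\<phi> x \<in> affine_subspace s n A" using x by blast
      then show ?thesis using less_w_vec_of_less_w_mat[OF sn _ w(2,1)] by blast
    qed
    then have "{x \<in> space \<nu>. ereal v < w_vec n (\<phi> x)} = space \<nu>" by blast
    moreover have "emeasure \<nu> (space \<nu>) \<noteq> 0" using haar unfolding haar_measure_def by blast
    ultimately show "emeasure \<mu> ?S > 0"
      unfolding em by (simp only: zero_less_iff_neq_zero not_False_eq_True)
  qed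
qed

text \<open>Density of the reals in the extended reals, so infinite \<open>m\<close> is
  included.\<close>

lemma Sup_ereal_less: "Sup (ereal ` {v. ereal v < m}) = m"
proof (rule antisym)
  show "Sup (ereal ` {v. ereal v < m}) \<le> m"
  proof (rule Sup_least)
    fix x assume "x \<in> ereal ` {v. ereal v < m}"
    then obtain v where "x = ereal v" "ereal v < m" by blast
    then show "x \<le> m" by (simp only: less_imp_le)
  qed
  show "m \<le> Sup (ereal ` {v. ereal v < m})"
  proof (rule dense_le)
    fix x assume "x < m"
    then obtain r where r: "x < ereal r" "ereal r < m" using ereal_dense2 by blast
    have "ereal r \<le> Sup (ereal ` {v. ereal v < m})"
      by (rule Sup_upper) (use r(2) in blast)
    with r(1) show "x \<le> Sup (ereal ` {v. ereal v < m})" by (rule order_trans[OF less_imp_le])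
  qed
qed

theorem theorem1p3:
  fixes s n :: nat
    and A :: "nat \<Rightarrow> nat \<Rightarrow> 'p::prime_card padic"
    and \<nu> :: "(nat \<Rightarrow> 'p padic) measure"
    and \<phi> :: "(nat \<Rightarrow> 'p padic) \<Rightarrow> (nat \<Rightarrow> 'p padic)"
    and \<mu> :: "(nat \<Rightarrow> 'p padic) measure"
  assumes "s < n"
    and "haar_measure {1..s} \<nu>"
    and "affine_isomorphism s n (affine_subspace s n A) \<phi>"
    and "\<mu> = distr \<nu> (padic_borel {1..n}) \<phi>"
    and "rows_rational_multiples {0..s} {s+1..n} A \<or> cols_rational_multiples {0..s} {s+1..n} A"
  shows "w_p_measure n \<mu> = max (ereal (real n)) (w_p_mat {0..s} {s+1..n} A)
       \<and> w_measure n \<mu> = max (ereal (real (n + 1))) (w_mat {0..s} {s+1..n} A)"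
proof
  let ?w = "w_mat {0..s} {s+1..n} A" and ?wp = "w_p_mat {0..s} {s+1..n} A"
  note pos = emeasure_superlevel_w_vec[OF assms(1-4)]
  show "w_measure n \<mu> = max (ereal (real (n + 1))) ?w"
    unfolding w_measure_def pos by (rule Sup_ereal_less)
  have n: "n \<ge> 1" using assms(1) by simp
  \<comment> \<open>Below n both sides hold through the first term of the maximum; from n on
    \<open>v\<close> is nonnegative, where superlevels of w_p(A) and w(A) correspond with a shift by
    1.\<close>
  have eq: "ereal (v + 1) < max (ereal (real (n + 1))) ?w \<longleftrightarrow> ereal v < max (ereal (real n)) ?wp" for v
  proof (cases "v < real n")
    case False
    then have "ereal v < ?wp \<longleftrightarrow> ereal (v + 1) < ?w"
      using assms(1) by (intro less_w_p_mat_iff_less_w_mat) auto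
    then show ?thesis using False by (simp add: less_max_iff_disj)
  qed (simp add: less_max_iff_disj)
  show "w_p_measure n \<mu> = max (ereal (real n)) ?wp"
    unfolding w_p_measure_def less_w_p_vec_iff_less_w_vec[OF n] pos eq by (rule Sup_ereal_less)
qed

end
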